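(* For every $\varepsilon\in[\frac1T,1]$, if $\mathcal B$ is the algorithm HTINF with parameters $\alpha=2$ and $\sigma=\sqrt6$ (on the action set $[N]$), then the generic conversion from bandit algorithms to private bandit with expert advice algorithms (defined in the context), applied to $\mathcal B$, guarantees the existence of an $\varepsilon$-differentially private bandit with expert advice algorithm, with $K$ actions and $N$ experts, whose worst-case expected regret over $T$ rounds is at most $$O\left(\frac{\sqrt{TN}}{\sqrt\varepsilon}+\frac1\varepsilon\right),$$ where the constant hidden in $O(\cdot)$ is absolute.
   Context: $[K]=\{1,\dots,K\}$ is the set of actions, $[N]$ the set of experts, $\Pi(S)$ the set of probability distributions on a finite set $S$. $\operatorname{Lap}(\lambda)$ is the Laplace distribution with density $\frac1{2\lambda}e^{-|x|/\lambda}$. **Bandit with expert advice algorithm.** In each round $t$, each expert $j\in[N]$ announces $\mu_t^j\in\Pi([K])$; the learner then plays an action and observes only its loss. The algorithm is a deterministic map $\mathcal A$ that, for every $t$, maps the history $\mathcal H_t=(I_s,\ell_s(I_s))_{s=1}^{t-1}\in([K]\times\mathbb R)^{t-1}$ and the advice $\mu_{1:t}^{1:N}\in(\Pi([K])^N)^t$ to a distribution in $\Pi([K])$, from which $I_t$ is sampled; then $\ell_t(I_t)$ is observed. A procedure that keeps internal random state is identified with the algorithm given by its conditional law of $I_t$ given the history and advice. **Worst-case expected regret.** $\operatorname{R}_{\mathcal A}(T,K,N)=\sup_{\ell_{1:T}}\sup_{\mu_{1:T}^{1:N}}\Bigl(\mathbb E\bigl[\sum_{t=1}^T\ell_t(I_t)\bigr]-\inf_{j\in[N]}\sum_{t=1}^T\sum_{i=1}^K\mu_t^j(i)\,\ell_t(i)\Bigr)$,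 over sequences of functions $\ell_t:[K]\to[0,1]$ and advice sequences fixed in advance, expectation over the learner's randomness. **Differential privacy.** Expert advice is public; only the losses are sensitive. $\mathcal A$ is $\varepsilon$-differentially private if for every $T\in\mathbb N$, every advice sequence $\mu_{1:T}^{1:N}$, any two sequences $\ell_{1:T},\ell'_{1:T}$ of functions $[K]\to[0,1]$ differing at exactly one time point, and any $E\subset[K]^T$, $\mathbb P[(I_1,\dots,I_T)\in E]\le e^\varepsilon\,\mathbb P[(I'_1,\dots,I'_T)\in E]$, where $I_{1:T}$, $I'_{1:T}$ are the actions played by $\mathcal A$ on $\ell_{1:T}$, $\ell'_{1:T}$ with the same advice. **Generic conversion.** A bandit algorithm with action set $[N]$ is a deterministic map from histories of pairs (action in $[N]$, observed real loss) to $\Pi([N])$; each action is sampled from the resulting distribution. Given such a $\mathcal B$ and $\varepsilon\in(0,1]$, take batch size $\tau=\lceil1/\varepsilon\rceil$ and proceed in two steps. (i) Private bandit algorithm $\mathcal B_\tau$ on action set $[N]$: group rounds in consecutive batches, batch $r$ being rounds $(r-1)\tau+1,\dots,r\tau$; at the start of batch $r$ receive an action from $\mathcal B$ and play it in all rounds of the batch; at the end of a complete batch feed $\mathcal B$, as the observed loss of this action, the average of the losses of this action over the batch plus independent noise with law $\operatorname{Lap}(\frac1{\tau\varepsilon})$. (ii) Bandit with expert advice algorithm: in round $t$, receive $\mu_t^1,\dots,\mu_t^N$, sample $I_t^j\sim\mu_t^j$ for every $j\in[N]$, receive an expert $J_t\in[N]$ from $\mathcal B_\tau$, play the action $I_t=I_t^{J_t}\in[K]$,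 observe $\ell_t(I_t^{J_t})$, and pass this value to $\mathcal B_\tau$ as the loss of $J_t$. **HTINF** (heavy-tail Tsallis-INF) is Algorithm 1 of J. Huang, Y. Dai, L. Huang, "Adaptive best-of-both-worlds algorithm for heavy-tailed multi-armed bandits", ICML 2022, a Follow-the-Regularized-Leader bandit algorithm for possibly negative, heavy-tailed losses, with parameters $\alpha\in(1,2]$ and $\sigma>0$. For $\alpha=2$ and action set $[N]$ it reads: in round $t$, with learning rate $\eta_t=1/(\sigma\sqrt t)$, compute $x_t=\operatorname{argmin}_{x\in\Pi([N])}\bigl(\eta_t\sum_{s<t}\langle\hat\ell_s,x\rangle-2\sum_{j=1}^N\sqrt{x_j}\bigr)$; draw $J_t\sim x_t$ and receive the real loss value $v_t$ of $J_t$; with the skipping threshold $r_t=(1-2^{-1/3})\,\sigma\sqrt t\,\sqrt{x_{t,J_t}}$, set $\hat\ell_t=0$ if $|v_t|>r_t$, and otherwise $\hat\ell_t(j)=\frac{v_t}{x_{t,j}}\mathbb I\{J_t=j\}$ for $j\in[N]$. *)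

theory Defs
  imports "HOL-Probability.Probability"
begin

section \<open>Bandits with expert advice\<close>

text \<open>
  Actions are \<open>{1..K}\<close>, experts are \<open>{1..N}\<close>, rounds are \<open>1, 2, \<dots>\<close>. A tuple of advice of one
  round is a function on \<open>{1..N}\<close>, a loss function one on \<open>{1..K}\<close>, and a sequence of length \<open>T\<close>
  one on \<open>{1..T}\<close>. All of these are extensional (\<open>\<rightarrow>\<^sub>E\<close>), so that two of them are equal iff they
  agree on their domain. The sequence of played actions is a list, whose entry at position \<open>t\<close>
  belongs to round \<open>t + 1\<close>.
\<close>

type_synonym advice = "nat \<Rightarrow> nat pmf"

type_synonym bandit_algorithm = "(nat \<times> real) list \<Rightarrow> nat pmf"

type_synonym expert_algorithm = "(nat \<times> real) list \<Rightarrow> advice list \<Rightarrow> nat pmf"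

definition distributions_on :: "nat \<Rightarrow> nat pmf set" where
  "distributions_on n = {p. set_pmf p \<subseteq> {1..n}}"

definition advice_tuples :: "nat \<Rightarrow> nat \<Rightarrow> advice set" where
  "advice_tuples K N = {1..N} \<rightarrow>\<^sub>E distributions_on K"

definition is_expert_algorithm :: "nat \<Rightarrow> nat \<Rightarrow> expert_algorithm \<Rightarrow> bool" where
  "is_expert_algorithm K N A \<longleftrightarrow>
     (\<forall>h ms. fst ` set h \<subseteq> {1..K} \<and> set ms \<subseteq> advice_tuples K N \<and> length ms = Suc (length h)
        \<longrightarrow> A h ms \<in> distributions_on K)"

definition history :: "(nat \<Rightarrow> nat \<Rightarrow> real) \<Rightarrow> nat list \<Rightarrow> (nat \<times> real) list" where
  "history l xs = map2 (\<lambda>s i. (i, l s i)) [1..<Suc (length xs)] xs"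

primrec play ::
  "expert_algorithm \<Rightarrow> (nat \<Rightarrow> advice) \<Rightarrow> (nat \<Rightarrow> nat \<Rightarrow> real) \<Rightarrow> nat \<Rightarrow> nat list pmf" where
  "play A \<mu> l 0 = return_pmf []"
| "play A \<mu> l (Suc t) = do {
     xs \<leftarrow> play A \<mu> l t;
     i \<leftarrow> A (history l xs) (map \<mu> [1..<Suc (Suc t)]);
     return_pmf (xs @ [i])
   }"

definition regret ::
  "expert_algorithm \<Rightarrow> nat \<Rightarrow> nat \<Rightarrow> nat \<Rightarrow> (nat \<Rightarrow> nat \<Rightarrow> real) \<Rightarrow> (nat \<Rightarrow> advice) \<Rightarrow> real" where
  "regret A T K N l \<mu> =
     measure_pmf.expectation (play A \<mu> l T) (\<lambda>xs. \<Sum>t=1..T. l t (xs ! (t - 1)))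
     - (INF j\<in>{1..N}. \<Sum>t=1..T. \<Sum>i=1..K. pmf (\<mu> t j) i * l t i)"

text \<open>The supremum is taken in the extended reals, so that it needs no boundedness argument.\<close>

definition worst_case_regret :: "expert_algorithm \<Rightarrow> nat \<Rightarrow> nat \<Rightarrow> nat \<Rightarrow> ereal" where
  "worst_case_regret A T K N =
     (SUP l\<in>{1..T} \<rightarrow>\<^sub>E ({1..K} \<rightarrow>\<^sub>E {0..1}).
      SUP \<mu>\<in>{1..T} \<rightarrow>\<^sub>E advice_tuples K N. ereal (regret A T K N l \<mu>))"

definition differentially_private :: "real \<Rightarrow> nat \<Rightarrow> nat \<Rightarrow> expert_algorithm \<Rightarrow> bool" where
  "differentially_private \<epsilon> K N A \<longleftrightarrow>
     (\<forall>T. \<forall>\<mu>\<in>{1..T} \<rightarrow>\<^sub>E advice_tuples K N.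
      \<forall>l\<in>{1..T} \<rightarrow>\<^sub>E ({1..K} \<rightarrow>\<^sub>E {0..1}). \<forall>l'\<in>{1..T} \<rightarrow>\<^sub>E ({1..K} \<rightarrow>\<^sub>E {0..1}).
        (\<exists>!t. t \<in> {1..T} \<and> l t \<noteq> l' t) \<longrightarrow>
        (\<forall>E\<subseteq>{xs. length xs = T \<and> set xs \<subseteq> {1..K}}.
           measure_pmf.prob (play A \<mu> l T) E \<le> exp \<epsilon> * measure_pmf.prob (play A \<mu> l' T) E))"


section \<open>Procedures with internal randomness\<close>

text \<open>
  A procedure is given by the law of the actions it plays in the first \<open>T\<close> rounds, for all advice
  and loss sequences. An algorithm \<open>A\<close> is identified with it if, for all real-valued losses, \<open>A\<close>
  returns the conditional law of the next action given the history; it is unconstrained on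
  histories of probability zero. Since the loss values in the history are a function of the
  actions and the fixed loss sequence, conditioning on the history is conditioning on the actions.
\<close>

type_synonym procedure =
  "(nat \<Rightarrow> advice) \<Rightarrow> (nat \<Rightarrow> nat \<Rightarrow> real) \<Rightarrow> nat \<Rightarrow> nat list measure"

definition conditional_law_of :: "nat \<Rightarrow> nat \<Rightarrow> procedure \<Rightarrow> expert_algorithm \<Rightarrow> bool" where
  "conditional_law_of K N P A \<longleftrightarrow>
     (\<forall>t. \<forall>\<mu>\<in>{1..Suc t} \<rightarrow>\<^sub>E advice_tuples K N. \<forall>l\<in>{1..Suc t} \<rightarrow>\<^sub>E ({1..K} \<rightarrow>\<^sub>E UNIV).
        prob_space (P \<mu> l (Suc t)) \<and>
        (\<forall>xs. length xs = t \<and> set xs \<subseteq> {1..K} \<and> \<P>(w in P \<mu> l (Suc t). take t w = xs) > 0 \<longrightarrow>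
           (\<forall>i. pmf (A (history l xs) (map \<mu> [1..<Suc (Suc t)])) i =
                \<P>(w in P \<mu> l (Suc t). w ! t = i \<bar> take t w = xs))))"


section \<open>The generic conversion\<close>

definition laplace :: "real \<Rightarrow> real measure" where
  "laplace b = density lborel (\<lambda>x. ennreal (exp (- \<bar>x\<bar> / b) / (2 * b)))"

text \<open>
  The internal state of the private bandit algorithm \<open>B\<^sub>\<tau>\<close> consists of the history fed to \<open>B\<close> so far
  and of the (arm, loss) pairs of the rounds of the current, incomplete batch. The second list is
  empty exactly at the start of a batch. The number drawn from \<open>batch_noise\<close> is only used in the
  last round of a batch; in all other rounds it is the constant 0.
\<close>

type_synonym batch_state = "(nat \<times> real) list \<times> (nat \<times> real) list"

fun batch_arm :: "bandit_algorithm \<Rightarrow> batch_state \<Rightarrow> nat pmf" where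
  "batch_arm B (g, cur) = (if cur = [] then B g else return_pmf (fst (hd cur)))"

fun batch_noise :: "nat \<Rightarrow> real \<Rightarrow> batch_state \<Rightarrow> real measure" where
  "batch_noise \<tau> \<epsilon> (g, cur) =
     (if Suc (length cur) = \<tau> then laplace (1 / (real \<tau> * \<epsilon>)) else return borel 0)"

fun batch_update :: "nat \<Rightarrow> batch_state \<Rightarrow> nat \<Rightarrow> real \<Rightarrow> real \<Rightarrow> batch_state" where
  "batch_update \<tau> (g, cur) j v z =
     (let cur' = cur @ [(j, v)] in
      if length cur' = \<tau> then (g @ [(j, sum_list (map snd cur') / real \<tau> + z)], [])
      else (g, cur'))"

text \<open>
  \<open>conversion_from N \<tau> \<epsilon> B \<mu> l n t s\<close> is the law of the actions played in the \<open>n\<close> rounds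
  \<open>t, \<dots>, t + n - 1\<close> when \<open>B\<^sub>\<tau>\<close> is in state \<open>s\<close> before round \<open>t\<close>. Here \<open>I\<close> is the tuple of the
  independent samples \<open>I j\<close> from \<open>\<mu> t j\<close>.
\<close>

primrec conversion_from ::
  "nat \<Rightarrow> nat \<Rightarrow> real \<Rightarrow> bandit_algorithm \<Rightarrow> (nat \<Rightarrow> advice) \<Rightarrow> (nat \<Rightarrow> nat \<Rightarrow> real) \<Rightarrow>
   nat \<Rightarrow> nat \<Rightarrow> batch_state \<Rightarrow> nat list measure" where
  "conversion_from N \<tau> \<epsilon> B \<mu> l 0 t s = return (count_space UNIV) []"
| "conversion_from N \<tau> \<epsilon> B \<mu> l (Suc n) t s = do {
     I \<leftarrow> measure_pmf (Pi_pmf {1..N} undefined (\<mu> t));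
     j \<leftarrow> measure_pmf (batch_arm B s);
     z \<leftarrow> batch_noise \<tau> \<epsilon> s;
     xs \<leftarrow> conversion_from N \<tau> \<epsilon> B \<mu> l n (Suc t) (batch_update \<tau> s j (l t (I j)) z);
     return (count_space UNIV) (I j # xs)
   }"

definition conversion :: "nat \<Rightarrow> real \<Rightarrow> bandit_algorithm \<Rightarrow> procedure" where
  "conversion N \<epsilon> B \<mu> l T = conversion_from N (nat \<lceil>1 / \<epsilon>\<rceil>) \<epsilon> B \<mu> l T 1 ([], [])"


section \<open>HTINF for \<open>\<alpha> = 2\<close>\<close>

text \<open>The argument \<open>L\<close> is the sum of the loss estimates of the rounds before \<open>t\<close>.\<close>

definition htinf_distribution :: "nat \<Rightarrow> real \<Rightarrow> nat \<Rightarrow> (nat \<Rightarrow> real) \<Rightarrow> nat pmf" where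
  "htinf_distribution N \<sigma> t L =
     arg_min (\<lambda>x. 1 / (\<sigma> * sqrt (real t)) * (\<Sum>j=1..N. L j * pmf x j)
                  - 2 * (\<Sum>j=1..N. sqrt (pmf x j)))
             (\<lambda>x. x \<in> distributions_on N)"

definition htinf_estimate ::
  "real \<Rightarrow> nat \<Rightarrow> nat pmf \<Rightarrow> nat \<Rightarrow> real \<Rightarrow> nat \<Rightarrow> real" where
  "htinf_estimate \<sigma> t x J v =
     (let r = (1 - 2 powr (- 1 / 3)) * \<sigma> * sqrt (real t) * sqrt (pmf x J) in
      (\<lambda>j. if \<bar>v\<bar> > r then 0 else v / pmf x j * of_bool (J = j)))"

fun htinf_from :: "nat \<Rightarrow> real \<Rightarrow> nat \<Rightarrow> (nat \<Rightarrow> real) \<Rightarrow> bandit_algorithm" where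
  "htinf_from N \<sigma> t L [] = htinf_distribution N \<sigma> t L"
| "htinf_from N \<sigma> t L ((J, v) # h) =
     htinf_from N \<sigma> (Suc t)
       (\<lambda>j. L j + htinf_estimate \<sigma> t (htinf_distribution N \<sigma> t L) J v j) h"

definition htinf :: "nat \<Rightarrow> real \<Rightarrow> bandit_algorithm" where
  "htinf N \<sigma> = htinf_from N \<sigma> 1 (\<lambda>_. 0)"

end

theory Submission
  imports Defs
begin

text \<open>
  Privacy: a change of one loss moves a single batch average by at most \<open>1/\<tau>\<close>, and Laplace noise of
  scale \<open>1/(\<tau>\<epsilon>)\<close> turns this shift into a factor at most \<open>exp \<epsilon>\<close> for every later event.

  Regret: the expected loss of expert \<open>j\<close> in a round is that of its advice, and it does not depend
  on the choice of the expert. So the conversion reduces the problem to a bandit with \<open>T div \<tau>\<close>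
  rounds whose losses are an average in \<open>[0,1]\<close> plus symmetric noise, with second moment at
  most \<open>3\<close>. Skipping large losses biases the estimates: for the arms that are played the bias is
  second moment over threshold, and for the comparator it has the right sign, because the density of
  the noise is symmetric and unimodal around a nonnegative average. The potential
  \<open>L u - min\<^sub>x (\<langle>L, x\<rangle> - 2 \<sigma> \<surd>p \<Sum>\<^sub>j \<surd>x\<^sub>j)\<close> then grows by \<open>O(\<surd>N/\<surd>p)\<close> in expectation in batch \<open>p\<close>, which sums to
  \<open>O(\<surd>(N T/\<tau>))\<close>, and every batch lasts \<open>\<tau> \<le> 2/\<epsilon>\<close> rounds.

  The minimizer \<open>x\<close> has the explicit form \<open>x\<^sub>j = (L\<^sub>j/b + \<nu>)\<^sup>-\<^sup>2\<close>, where \<open>b = \<sigma> \<surd>p\<close>. It also depends measurably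
  on \<open>L\<close>; without this the Giry bind over the noise in the conversion would be meaningless.
\<close>

section \<open>The FTRL distribution of HTINF\<close>

text \<open>The conversion lives in the Giry monad over real noise, whereas privacy, regret and the
  conditional law concern finitely many action sequences. The recursion \<open>weight\<close>
  bridges the two. It is a number computed from a history, with no loss function in it, so the same
  quantity is a probability in the conversion, numerator and denominator of a conditional law that
  sees only histories, and the object compared for neighbouring losses.

  In the regret bound the comparator is the delicate point. Its skipping bias is of order
  \<open>1 / (b * sqrt (pmf x u))\<close>, and nothing averages this out when \<open>pmf x u\<close>
  is small, so a two-sided second-moment bound would not do; only one sign of the bias hurts, hence
  the symmetry argument. For a played arm \<open>j\<close> the same quantity is weighted by
  \<open>pmf x j\<close>, which leaves \<open>sqrt (pmf x j) / b\<close>, and Cauchy-Schwarz sums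
  these to \<open>sqrt N / b\<close>. The term \<open>1/\<epsilon>\<close> pays for the incomplete
  last batch.\<close>

lemma exists_pmf_finite_support:
  fixes f :: "'a \<Rightarrow> real"
  assumes "finite S" "\<And>x. x \<in> S \<Longrightarrow> 0 \<le> f x" "sum f S = 1"
  shows "\<exists>q. \<forall>x. pmf q x = (if x \<in> S then f x else 0)"
proof -
  let ?g = "\<lambda>x. if x \<in> S then f x else 0"
  have "(\<integral>\<^sup>+x. ennreal (?g x) \<partial>count_space UNIV) = (\<Sum>x\<in>S. ennreal (?g x))"
    by (intro nn_integral_count_space' assms) auto
  also have "\<dots> = ennreal (\<Sum>x\<in>S. ?g x)"
    using assms(2) by (intro sum_ennreal) auto
  also have "(\<Sum>x\<in>S. ?g x) = 1"
    using assms(3) by simp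
  finally have "(\<integral>\<^sup>+x. ennreal (?g x) \<partial>count_space UNIV) = 1"
    by simp
  then have "pmf (embed_pmf ?g) x = ?g x" for x
    using assms(2) by (intro pmf_embed_pmf) auto
  then show ?thesis by blast
qed

lemma sum_pmf_distributions_on: "p \<in> distributions_on n \<Longrightarrow> (\<Sum>i=1..n. pmf p i) = 1"
  unfolding distributions_on_def by (intro sum_pmf_eq_1) auto

lemma pmf_distributions_on_eq_0: "p \<in> distributions_on n \<Longrightarrow> i \<notin> {1..n} \<Longrightarrow> pmf p i = 0"
  unfolding distributions_on_def by (auto simp: set_pmf_iff)

lemma sum_sqrt_pmf_le:
  assumes "p \<in> distributions_on n"
  shows "(\<Sum>i=1..n. sqrt (pmf p i)) \<le> sqrt n"
proof -
  have "(\<Sum>i=1..n. sqrt (pmf p i) * 1)\<^sup>2 \<le> (\<Sum>i=1..n. (sqrt (pmf p i))\<^sup>2) * (\<Sum>i=1..n. 1\<^sup>2)"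
    by (rule Cauchy_Schwarz_ineq_sum)
  also have "\<dots> = n"
    using sum_pmf_distributions_on[OF assms] by simp
  finally show ?thesis
    by (intro real_le_rsqrt) simp
qed

definition tsallis_objective :: "nat \<Rightarrow> real \<Rightarrow> (nat \<Rightarrow> real) \<Rightarrow> nat pmf \<Rightarrow> real" where
  "tsallis_objective N b L p = (\<Sum>j=1..N. L j * pmf p j) - 2 * b * (\<Sum>j=1..N. sqrt (pmf p j))"

text \<open>\<open>\<nu>\<close> is the Lagrange multiplier of the constraint that the coordinates
  sum to 1. With \<open>m\<close> the least loss, the intermediate value theorem applies on
  \<open>[1 - m, sqrt N - m]\<close>: at the left end the least arm alone contributes 1, at the
  right end each of the \<open>N\<close> terms is at most \<open>1 / N\<close>.\<close>

lemma exists_tsallis_normalization: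
  fixes L :: "nat \<Rightarrow> real"
  assumes "N \<ge> 1"
  shows "\<exists>\<nu>. (\<forall>j\<in>{1..N}. L j + \<nu> > 0) \<and> (\<Sum>j=1..N. 1 / (L j + \<nu>)\<^sup>2) = 1"
proof -
  define m where "m = Min (L ` {1..N})"
  have m_le: "m \<le> L j" if "j \<in> {1..N}" for j
    unfolding m_def using that by (intro Min_le) auto
  obtain k where k: "k \<in> {1..N}" "L k = m"
    using Min_in[of "L ` {1..N}"] assms unfolding m_def by fastforce
  let ?g = "\<lambda>\<nu>. \<Sum>j=1..N. 1 / (L j + \<nu>)\<^sup>2"
  have sq: "1 \<le> sqrt N" using assms by simp
  have "\<exists>\<nu>. 1 - m \<le> \<nu> \<and> \<nu> \<le> sqrt N - m \<and> ?g \<nu> = 1"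
  proof (rule IVT2')
    have "?g (sqrt N - m) \<le> (\<Sum>j=1..N. 1 / N)"
    proof (rule sum_mono)
      fix j assume j: "j \<in> {1..N}"
      have "(sqrt N)\<^sup>2 \<le> (L j + (sqrt N - m))\<^sup>2"
        using m_le[OF j] sq by (intro power_mono) auto
      then show "1 / (L j + (sqrt N - m))\<^sup>2 \<le> 1 / N"
        using assms by (intro divide_left_mono) (auto simp: zero_less_mult_iff)
    qed
    then show "?g (sqrt N - m) \<le> 1" using assms by simp
    have "1 = 1 / (L k + (1 - m))\<^sup>2" using k by simp
    also have "\<dots> \<le> ?g (1 - m)"
      using k by (intro member_le_sum) auto
    finally show "1 \<le> ?g (1 - m)" .
    show "1 - m \<le> sqrt N - m" using sq by simp
    have "L j + x \<noteq> 0" if "x \<in> {1 - m..sqrt N - m}" "j \<in> {1..N}" for x j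
      using m_le[of j] that by auto
    then show "continuous_on {1 - m..sqrt N - m} ?g"
      by (intro continuous_intros) auto
  qed
  then obtain \<nu> where "1 - m \<le> \<nu>" "?g \<nu> = 1" by blast
  moreover have "L j + \<nu> > 0" if "j \<in> {1..N}" for j
    using m_le[OF that] \<open>1 - m \<le> \<nu>\<close> by linarith
  ultimately show ?thesis by blast
qed

text \<open>
  The right-hand sum is \<open>b\<close> times the Bregman divergence from \<open>x\<close> to \<open>y\<close> of the regularizer: the
  first-order term vanishes because the gradient of the objective at \<open>x\<close> is a constant vector.
\<close>

lemma exists_tsallis_minimizer:
  assumes "N \<ge> 1" "b > 0"
  shows "\<exists>x\<in>distributions_on N. (\<forall>j\<in>{1..N}. pmf x j > 0) \<and>
    (\<forall>y\<in>distributions_on N. tsallis_objective N b L y = tsallis_objective N b L x +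
        b * (\<Sum>j=1..N. (sqrt (pmf y j) - sqrt (pmf x j))\<^sup>2 / sqrt (pmf x j)))"
proof -
  obtain \<nu> where \<nu>: "\<And>j. j \<in> {1..N} \<Longrightarrow> L j / b + \<nu> > 0" "(\<Sum>j=1..N. 1 / (L j / b + \<nu>)\<^sup>2) = 1"
    using exists_tsallis_normalization[OF assms(1), of "\<lambda>j. L j / b"] by blast
  obtain x where x: "\<And>j. pmf x j = (if j \<in> {1..N} then 1 / (L j / b + \<nu>)\<^sup>2 else 0)"
    using exists_pmf_finite_support[of "{1..N}" "\<lambda>j. 1 / (L j / b + \<nu>)\<^sup>2"] \<nu>(2) by auto
  have xs: "sqrt (pmf x j) > 0" "1 / sqrt (pmf x j) = L j / b + \<nu>" if "j \<in> {1..N}" for j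
    using \<nu>(1)[OF that] that by (auto simp: x real_sqrt_divide)
  have x_dist: "x \<in> distributions_on N"
    unfolding distributions_on_def by (auto simp: set_pmf_iff x split: if_splits)
  have "tsallis_objective N b L y = tsallis_objective N b L x +
        b * (\<Sum>j=1..N. (sqrt (pmf y j) - sqrt (pmf x j))\<^sup>2 / sqrt (pmf x j))"
    if y: "y \<in> distributions_on N" for y
  proof -
    have eq: "L j * pmf y j - 2 * b * sqrt (pmf y j) - (L j * pmf x j - 2 * b * sqrt (pmf x j))
        = b * ((sqrt (pmf y j) - sqrt (pmf x j))\<^sup>2 / sqrt (pmf x j)) - b * \<nu> * (pmf y j - pmf x j)"
      if j: "j \<in> {1..N}" for j
    proof -
      define s u where "s = sqrt (pmf x j)" and "u = sqrt (pmf y j)"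
      have *: "pmf x j = s\<^sup>2" "pmf y j = u\<^sup>2" "s > 0" "L j = b * (1 / s - \<nu>)"
        using xs[OF j] assms(2) by (auto simp: s_def u_def field_simps)
      show ?thesis
        using *(3) unfolding *(4) s_def[symmetric] u_def[symmetric] *(1,2)
        by (simp add: field_simps power2_eq_square)
    qed
    have "tsallis_objective N b L y - tsallis_objective N b L x =
        (\<Sum>j=1..N. L j * pmf y j - 2 * b * sqrt (pmf y j) - (L j * pmf x j - 2 * b * sqrt (pmf x j)))"
      by (simp add: tsallis_objective_def sum_subtractf sum_distrib_left)
    also have "\<dots> = (\<Sum>j=1..N. b * ((sqrt (pmf y j) - sqrt (pmf x j))\<^sup>2 / sqrt (pmf x j))
        - b * \<nu> * (pmf y j - pmf x j))"
      by (intro sum.cong refl eq)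
    also have "\<dots> = b * (\<Sum>j=1..N. (sqrt (pmf y j) - sqrt (pmf x j))\<^sup>2 / sqrt (pmf x j))
        - b * \<nu> * ((\<Sum>j=1..N. pmf y j) - (\<Sum>j=1..N. pmf x j))"
      by (simp only: sum_subtractf sum_distrib_left[symmetric])
    finally show ?thesis
      using sum_pmf_distributions_on[OF y] sum_pmf_distributions_on[OF x_dist] by simp
  qed
  then show ?thesis using x_dist xs(1) real_sqrt_gt_0_iff by blast
qed

text \<open>\<open>arg_min\<close> is a Hilbert choice, so nothing is known of it before a minimizer
  exists and is unique. The Bregman identity at the explicit minimizer \<open>z\<close> yields both:
  a second minimizer has divergence at most 0 from \<open>z\<close>, hence equals it. The objective
  in the algorithm is \<open>tsallis_objective\<close> divided by \<open>b\<close>.\<close>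

lemma
  assumes "N \<ge> 1" "\<sigma> > 0" "t \<ge> 1"
  defines "x \<equiv> \<lambda>L. htinf_distribution N \<sigma> t L" and "b \<equiv> \<sigma> * sqrt t"
  shows htinf_distribution_in: "x L \<in> distributions_on N"
    and htinf_distribution_pos: "\<And>j. j \<in> {1..N} \<Longrightarrow> pmf (x L) j > 0"
    and htinf_distribution_bregman: "\<And>y. y \<in> distributions_on N \<Longrightarrow>
      tsallis_objective N b L y = tsallis_objective N b L (x L) +
        b * (\<Sum>j=1..N. (sqrt (pmf y j) - sqrt (pmf (x L) j))\<^sup>2 / sqrt (pmf (x L) j))"
proof -
  have b: "b > 0" using assms by simp
  obtain z where z: "z \<in> distributions_on N" "\<And>j. j \<in> {1..N} \<Longrightarrow> pmf z j > 0"
    "\<And>y. y \<in> distributions_on N \<Longrightarrow> tsallis_objective N b L y = tsallis_objective N b L z +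
        b * (\<Sum>j=1..N. (sqrt (pmf y j) - sqrt (pmf z j))\<^sup>2 / sqrt (pmf z j))"
    using exists_tsallis_minimizer[OF assms(1) b, of L] by blast
  let ?f = "\<lambda>x. 1 / (\<sigma> * sqrt (real t)) * (\<Sum>j=1..N. L j * pmf x j) - 2 * (\<Sum>j=1..N. sqrt (pmf x j))"
  have f: "?f p = tsallis_objective N b L p / b" for p
    using b unfolding tsallis_objective_def b_def[symmetric] by (simp add: diff_divide_distrib)
  have nonneg: "(\<Sum>j=1..N. (sqrt (pmf y j) - sqrt (pmf z j))\<^sup>2 / sqrt (pmf z j)) \<ge> 0" for y
    by (intro sum_nonneg) simp
  have "is_arg_min ?f (\<lambda>p. p \<in> distributions_on N) z"
    unfolding is_arg_min_def f
  proof (intro conjI notI)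
    assume "\<exists>y. y \<in> distributions_on N \<and> tsallis_objective N b L y / b < tsallis_objective N b L z / b"
    then obtain y where y: "y \<in> distributions_on N" "tsallis_objective N b L y < tsallis_objective N b L z"
      using b by (auto simp: divide_less_cancel)
    have "0 \<le> b * (\<Sum>j=1..N. (sqrt (pmf y j) - sqrt (pmf z j))\<^sup>2 / sqrt (pmf z j))"
      using b nonneg by (intro mult_nonneg_nonneg) auto
    then show False using z(3)[OF y(1)] y(2) by linarith
  qed (rule z(1))
  then have "is_arg_min ?f (\<lambda>p. p \<in> distributions_on N) (x L)"
    unfolding x_def htinf_distribution_def arg_min_def by (rule someI)
  then have "x L \<in> distributions_on N" "\<not> tsallis_objective N b L z / b < tsallis_objective N b L (x L) / b"
    unfolding is_arg_min_def f using z(1) by blast+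
  then have xL: "x L \<in> distributions_on N" "tsallis_objective N b L (x L) \<le> tsallis_objective N b L z"
    using b by (simp_all only: divide_less_cancel not_less, linarith)
  have "(\<Sum>j=1..N. (sqrt (pmf (x L) j) - sqrt (pmf z j))\<^sup>2 / sqrt (pmf z j)) \<le> 0"
    using z(3)[OF xL(1)] xL(2) b by (simp add: mult_le_0_iff)
  then have "(\<Sum>j=1..N. (sqrt (pmf (x L) j) - sqrt (pmf z j))\<^sup>2 / sqrt (pmf z j)) = 0"
    using nonneg by (intro antisym) auto
  then have "\<forall>j\<in>{1..N}. (sqrt (pmf (x L) j) - sqrt (pmf z j))\<^sup>2 / sqrt (pmf z j) = 0"
    by (subst (asm) sum_nonneg_eq_0_iff) auto
  then have "pmf (x L) j = pmf z j" if "j \<in> {1..N}" for j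
    using z(2)[OF that] that by fastforce
  moreover have "pmf (x L) j = pmf z j" if "j \<notin> {1..N}" for j
    using that xL(1) z(1) by (simp add: pmf_distributions_on_eq_0)
  ultimately have "x L = z"
    by (intro pmf_eqI) blast
  then show "x L \<in> distributions_on N" "\<And>j. j \<in> {1..N} \<Longrightarrow> pmf (x L) j > 0"
    "\<And>y. y \<in> distributions_on N \<Longrightarrow> tsallis_objective N b L y = tsallis_objective N b L (x L) +
        b * (\<Sum>j=1..N. (sqrt (pmf y j) - sqrt (pmf (x L) j))\<^sup>2 / sqrt (pmf (x L) j))"
    using z by blast+
qed

section \<open>The minimal value as a function of the losses\<close>

text \<open>Up to signs this is the convex conjugate of the regularizer: concave in
  \<open>L\<close>, with the FTRL distribution as gradient. It is the potential of the regret
  analysis.\<close>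

definition htinf_value :: "nat \<Rightarrow> real \<Rightarrow> nat \<Rightarrow> (nat \<Rightarrow> real) \<Rightarrow> real" where
  "htinf_value N \<sigma> t L = tsallis_objective N (\<sigma> * sqrt t) L (htinf_distribution N \<sigma> t L)"

context
  fixes N t :: nat and \<sigma> :: real
  assumes N: "N \<ge> 1" and \<sigma>: "\<sigma> > 0" and t: "t \<ge> 1"
begin

lemma htinf_value_le:
  assumes "y \<in> distributions_on N"
  shows "htinf_value N \<sigma> t L \<le> tsallis_objective N (\<sigma> * sqrt t) L y"
proof -
  have "0 \<le> \<sigma> * sqrt t * (\<Sum>j=1..N. (sqrt (pmf y j) - sqrt (pmf (htinf_distribution N \<sigma> t L) j))\<^sup>2
      / sqrt (pmf (htinf_distribution N \<sigma> t L) j))"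
    using \<sigma> by (intro mult_nonneg_nonneg sum_nonneg) auto
  then show ?thesis
    using htinf_distribution_bregman[OF N \<sigma> t assms, of L] unfolding htinf_value_def by linarith
qed

text \<open>Tests the minimum against the point mass at \<open>u\<close>. At the end of the horizon
  this makes the remaining potential nonnegative.\<close>

lemma htinf_value_le_arm:
  assumes "u \<in> {1..N}"
  shows "htinf_value N \<sigma> t L \<le> L u"
proof -
  have "return_pmf u \<in> distributions_on N"
    using assms by (auto simp: distributions_on_def)
  then have "htinf_value N \<sigma> t L \<le> tsallis_objective N (\<sigma> * sqrt t) L (return_pmf u)"
    by (rule htinf_value_le)
  also have "\<dots> = (\<Sum>j=1..N. L j * of_bool (u = j)) - 2 * (\<sigma> * sqrt t) * (\<Sum>j=1..N. of_bool (u = j))"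
    unfolding tsallis_objective_def
    by (intro arg_cong2[of _ _ _ _ minus] arg_cong2[of _ _ _ _ "(*)"] sum.cong) (auto simp: indicator_def)
  also have "\<dots> = L u - 2 * (\<sigma> * sqrt t)"
    using assms by (simp add: of_bool_def if_distrib[of "\<lambda>x. _ * x"])
  also have "\<dots> \<le> L u" using \<sigma> by simp
  finally show ?thesis .
qed

lemma htinf_value_zero_ge: "htinf_value N \<sigma> t (\<lambda>_. 0) \<ge> - 2 * \<sigma> * sqrt t * sqrt N"
proof -
  have "(\<sigma> * sqrt t) * (\<Sum>j=1..N. sqrt (pmf (htinf_distribution N \<sigma> t (\<lambda>_. 0)) j)) \<le> (\<sigma> * sqrt t) * sqrt N"
    using \<sigma> by (intro mult_left_mono sum_sqrt_pmf_le htinf_distribution_in N t) auto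
  then show ?thesis
    unfolding htinf_value_def tsallis_objective_def by simp
qed

text \<open>Price of changing the learning rate: the minimizer for round \<open>Suc t\<close>
  competes in round \<open>t\<close>, and the two objectives differ only in the weight of a sum of
  square roots, which is at most \<open>sqrt N\<close>.\<close>

lemma htinf_value_Suc_ge:
  "htinf_value N \<sigma> (Suc t) L \<ge> htinf_value N \<sigma> t L - 2 * sqrt N * (\<sigma> * sqrt (Suc t) - \<sigma> * sqrt t)"
proof -
  let ?x = "htinf_distribution N \<sigma> (Suc t) L"
  have x: "?x \<in> distributions_on N"
    using N \<sigma> by (intro htinf_distribution_in) auto
  have "(\<sigma> * sqrt (Suc t) - \<sigma> * sqrt t) * (\<Sum>j=1..N. sqrt (pmf ?x j)) \<le> (\<sigma> * sqrt (Suc t) - \<sigma> * sqrt t) * sqrt N"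
    using \<sigma> by (intro mult_left_mono sum_sqrt_pmf_le x) auto
  moreover have "htinf_value N \<sigma> (Suc t) L = tsallis_objective N (\<sigma> * sqrt t) L ?x -
      2 * ((\<sigma> * sqrt (Suc t) - \<sigma> * sqrt t) * (\<Sum>j=1..N. sqrt (pmf ?x j)))"
    unfolding htinf_value_def tsallis_objective_def by (simp add: algebra_simps)
  ultimately show ?thesis
    using htinf_value_le[OF x, of L] by (simp add: algebra_simps)
qed

text \<open>
  Let \<open>y\<close> be the minimizer for the shifted losses, \<open>b = \<sigma> \<surd>t\<close>, \<open>w = \<surd>(y\<^sub>k/x\<^sub>k) - 1\<close> and
  \<open>q = d \<surd>x\<^sub>k / b\<close>. The minimal value grows by at least
  \<open>d x\<^sub>k + b \<surd>x\<^sub>k (2 q w + (1 + q) w\<^sup>2)\<close>, and the bracket is at least \<open>-q\<^sup>2/(1 + q) \<ge> -2 q\<^sup>2\<close>.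
\<close>

lemma htinf_value_shift_ge:
  fixes d :: real and L :: "nat \<Rightarrow> real"
  defines "x \<equiv> htinf_distribution N \<sigma> t L"
  assumes k: "k \<in> {1..N}" and d: "\<bar>d\<bar> * sqrt (pmf x k) \<le> \<sigma> * sqrt t / 2"
  shows "htinf_value N \<sigma> t (\<lambda>j. L j + (if j = k then d else 0)) \<ge>
    htinf_value N \<sigma> t L + d * pmf x k - 2 * d\<^sup>2 * pmf x k * sqrt (pmf x k) / (\<sigma> * sqrt t)"
proof -
  define b where "b = \<sigma> * sqrt t"
  let ?L' = "\<lambda>j. L j + (if j = k then d else 0)"
  define y where "y = htinf_distribution N \<sigma> t ?L'"
  have b: "b > 0" using \<sigma> t by (simp add: b_def)
  have y: "y \<in> distributions_on N"
    unfolding y_def by (intro htinf_distribution_in N \<sigma> t)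
  have "htinf_value N \<sigma> t ?L' = tsallis_objective N b L y + d * pmf y k"
    using k unfolding htinf_value_def y_def[symmetric] b_def[symmetric] tsallis_objective_def
    by (simp add: algebra_simps sum.distrib if_distrib[of "\<lambda>x. _ * x"] cong: if_cong)
  also have "tsallis_objective N b L y = htinf_value N \<sigma> t L +
      b * (\<Sum>j=1..N. (sqrt (pmf y j) - sqrt (pmf x j))\<^sup>2 / sqrt (pmf x j))"
    unfolding b_def x_def htinf_value_def by (rule htinf_distribution_bregman[OF N \<sigma> t y])
  finally have eq: "htinf_value N \<sigma> t ?L' = htinf_value N \<sigma> t L + d * pmf y k +
      b * (\<Sum>j=1..N. (sqrt (pmf y j) - sqrt (pmf x j))\<^sup>2 / sqrt (pmf x j))"
    by simp
  \<comment> \<open>The other coordinates of the divergence are nonnegative; coordinate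
    \<open>k\<close> alone suffices to absorb the movement of the minimizer.\<close>
  have "(sqrt (pmf y k) - sqrt (pmf x k))\<^sup>2 / sqrt (pmf x k) \<le>
      (\<Sum>j=1..N. (sqrt (pmf y j) - sqrt (pmf x j))\<^sup>2 / sqrt (pmf x j))"
    using k by (intro member_le_sum) auto
  then have ge: "htinf_value N \<sigma> t ?L' \<ge> htinf_value N \<sigma> t L + d * pmf y k +
      b * ((sqrt (pmf y k) - sqrt (pmf x k))\<^sup>2 / sqrt (pmf x k))"
    unfolding eq using b by (intro add_left_mono mult_left_mono) auto
  define s w q where "s = sqrt (pmf x k)" and "w = sqrt (pmf y k) / s - 1" and "q = d * s / b"
  have "s > 0"
    unfolding s_def x_def using htinf_distribution_pos[OF N \<sigma> t k] by simp
  have *: "pmf x k = s\<^sup>2" "sqrt (pmf y k) = s * (1 + w)" "d = q * b / s"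
    using \<open>s > 0\<close> b unfolding w_def q_def by (auto simp: s_def)
  then have **: "pmf y k = s\<^sup>2 * (1 + w)\<^sup>2"
    by (metis pmf_nonneg power_mult_distrib real_sqrt_pow2)
  have "\<bar>q\<bar> \<le> 1 / 2"
    using d b \<open>s > 0\<close> unfolding s_def[symmetric] b_def[symmetric] q_def
    by (simp add: abs_mult field_simps)
  then have q: "1 + q \<ge> 1 / 2" by linarith
  \<comment> \<open>Completing the square in \<open>w\<close>, multiplied by \<open>1 + q\<close> to
    avoid division. The remainder is nonnegative because \<open>q \<ge> - 1 / 2\<close>, which is
    exactly what the smallness hypothesis on \<open>d\<close> provides.\<close>
  have "(1 + q) * (2 * q * w + (1 + q) * w\<^sup>2 + 2 * q\<^sup>2) = (q + (1 + q) * w)\<^sup>2 + q\<^sup>2 * (1 + 2 * q)"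
    by (simp add: power2_eq_square algebra_simps)
  also have "\<dots> \<ge> 0"
  proof -
    have "q\<^sup>2 * (1 + 2 * q) \<ge> 0" using q by (intro mult_nonneg_nonneg) auto
    then show ?thesis by simp
  qed
  finally have "2 * q * w + (1 + q) * w\<^sup>2 + 2 * q\<^sup>2 \<ge> 0"
    using q by (auto simp: zero_le_mult_iff)
  then have "0 \<le> b * s * (2 * q * w + (1 + q) * w\<^sup>2 + 2 * q\<^sup>2)"
    using b \<open>s > 0\<close> by simp
  also have "\<dots> = d * pmf y k + b * ((sqrt (pmf y k) - sqrt (pmf x k))\<^sup>2 / sqrt (pmf x k))
      - (d * pmf x k - 2 * d\<^sup>2 * pmf x k * sqrt (pmf x k) / b)"
    unfolding *(2) unfolding ** s_def[symmetric] unfolding *(1,3) using b \<open>s > 0\<close>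
    by (simp add: divide_simps) (simp add: power2_eq_square algebra_simps)
  finally show ?thesis
    using ge unfolding b_def by linarith
qed

text \<open>The minimizer for \<open>L\<close> is feasible for \<open>L'\<close> as well, so it is a
  supergradient of the concave minimal value at \<open>L\<close>.\<close>

lemma htinf_value_diff_le:
  "htinf_value N \<sigma> t L' - htinf_value N \<sigma> t L \<le>
    (\<Sum>j=1..N. (L' j - L j) * pmf (htinf_distribution N \<sigma> t L) j)"
proof -
  let ?x = "htinf_distribution N \<sigma> t L"
  have "htinf_value N \<sigma> t L' \<le> tsallis_objective N (\<sigma> * sqrt t) L' ?x"
    by (intro htinf_value_le htinf_distribution_in N \<sigma> t)
  then show ?thesis
    unfolding htinf_value_def[of _ _ _ L] tsallis_objective_def by (simp add: algebra_simps sum_subtractf)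
qed

lemma htinf_value_lipschitz:
  "\<bar>htinf_value N \<sigma> t L' - htinf_value N \<sigma> t L\<bar> \<le> (\<Sum>j=1..N. \<bar>L' j - L j\<bar>)"
proof -
  have "htinf_value N \<sigma> t L' - htinf_value N \<sigma> t L \<le> (\<Sum>j=1..N. \<bar>L' j - L j\<bar>)" for L L'
  proof -
    have "(\<Sum>j=1..N. (L' j - L j) * pmf (htinf_distribution N \<sigma> t L) j) \<le> (\<Sum>j=1..N. \<bar>L' j - L j\<bar>)"
    proof (rule sum_mono)
      fix j
      have "(L' j - L j) * pmf (htinf_distribution N \<sigma> t L) j \<le> \<bar>L' j - L j\<bar> * pmf (htinf_distribution N \<sigma> t L) j"
        by (intro mult_right_mono) auto
      also have "\<dots> \<le> \<bar>L' j - L j\<bar> * 1"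
        by (intro mult_left_mono pmf_le_1) auto
      finally show "(L' j - L j) * pmf (htinf_distribution N \<sigma> t L) j \<le> \<bar>L' j - L j\<bar>" by simp
    qed
    with htinf_value_diff_le[of L' L] show ?thesis by linarith
  qed
  from this[of L L'] this[of L' L]
  have "htinf_value N \<sigma> t L' - htinf_value N \<sigma> t L \<le> (\<Sum>j=1..N. \<bar>L' j - L j\<bar>)"
    "htinf_value N \<sigma> t L - htinf_value N \<sigma> t L' \<le> (\<Sum>j=1..N. \<bar>L j - L' j\<bar>)"
    by blast+
  moreover have "(\<Sum>j=1..N. \<bar>L j - L' j\<bar>) = (\<Sum>j=1..N. \<bar>L' j - L j\<bar>)"
    by (intro sum.cong refl abs_minus_commute)
  ultimately show ?thesis by linarith
qed

section \<open>Measurability of the minimizer in the losses\<close>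

text \<open>The Lipschitz bound involves only the finitely many coordinates in
  \<open>{1..N}\<close>, so it gives continuity in the product topology, whose Borel sets are the
  ones in use.\<close>

lemma htinf_value_measurable [measurable]: "htinf_value N \<sigma> t \<in> borel_measurable borel"
proof (intro borel_measurable_continuous_onI, unfold continuous_on_def, intro ballI)
  fix L :: "nat \<Rightarrow> real"
  have "((\<lambda>L'. L' j) \<longlongrightarrow> L j) (at L)" for j
    using continuous_on_product_coordinates[of j]
    unfolding continuous_on_def by auto
  then have "((\<lambda>L'. \<Sum>j=1..N. \<bar>L' j - L j\<bar>) \<longlongrightarrow> (\<Sum>j=1..N. \<bar>L j - L j\<bar>)) (at L)"
    by (intro tendsto_intros)
  then have "((\<lambda>L'. \<Sum>j=1..N. \<bar>L' j - L j\<bar>) \<longlongrightarrow> 0) (at L)"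
    by simp
  then have "((\<lambda>L'. htinf_value N \<sigma> t L' - htinf_value N \<sigma> t L) \<longlongrightarrow> 0) (at L)"
    by (rule Lim_null_comparison[rotated])
      (intro always_eventually allI, simp only: real_norm_def htinf_value_lipschitz)
  then show "(htinf_value N \<sigma> t \<longlongrightarrow> htinf_value N \<sigma> t L) (at L within UNIV)"
    by (simp add: LIM_zero_iff)
qed

text \<open>The coordinates of the minimizer are the partial derivatives of the minimal value.\<close>

lemma pmf_htinf_distribution_measurable [measurable]:
  "(\<lambda>L. pmf (htinf_distribution N \<sigma> t L) k) \<in> borel_measurable borel"
proof (cases "k \<in> {1..N}")
  case False
  then have "pmf (htinf_distribution N \<sigma> t L) k = 0" for L
    by (intro pmf_distributions_on_eq_0[OF htinf_distribution_in[OF N \<sigma> t]])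
  then show ?thesis by simp
next
  case True
  define b where "b = \<sigma> * sqrt t"
  have b: "b > 0" using \<sigma> t by (simp add: b_def)
  define L' :: "nat \<Rightarrow> (nat \<Rightarrow> real) \<Rightarrow> nat \<Rightarrow> real"
    where "L' n L = (\<lambda>j. L j + (if j = k then 1 / Suc n else 0))" for n L
  let ?D = "\<lambda>n L. (htinf_value N \<sigma> t (L' n L) - htinf_value N \<sigma> t L) * Suc n"
  have [measurable]: "L' n \<in> borel_measurable borel" for n
    unfolding L'_def by (intro measurable_coordinatewise_then_product) measurable
  show ?thesis
  proof (rule borel_measurable_LIMSEQ_metric)
    show "?D n \<in> borel_measurable borel" for n by measurable
    fix L :: "nat \<Rightarrow> real"
    let ?p = "pmf (htinf_distribution N \<sigma> t L) k"
    have up: "?D n L \<le> ?p" for n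
    proof -
      have "htinf_value N \<sigma> t (L' n L) - htinf_value N \<sigma> t L \<le> 1 / Suc n * ?p"
        using htinf_value_diff_le[of "L' n L" L] True unfolding L'_def
        by (simp add: if_distrib[of "\<lambda>x. x * _"] cong: if_cong)
      then show ?thesis by (simp add: field_simps)
    qed
    \<comment> \<open>The upper bound on the quotients is concavity and holds for every
      \<open>n\<close>. This lower bound comes from \<open>htinf_value_shift_ge\<close>, which asks
      for a small step and is therefore available only eventually.\<close>
    have low: "\<forall>\<^sub>F n in sequentially. ?p - 2 * ?p * sqrt ?p / b * (1 / Suc n) \<le> ?D n L"
    proof -
      have "(\<lambda>n. 1 / real (Suc n) * sqrt ?p) \<longlonglongrightarrow> 0 * sqrt ?p"
        by (intro tendsto_mult lim_1_over_n[THEN LIMSEQ_Suc] tendsto_const)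
      then have "\<forall>\<^sub>F n in sequentially. 1 / real (Suc n) * sqrt ?p < b / 2"
        using b by (intro order_tendstoD(2)[of _ 0]) auto
      then show ?thesis
      proof eventually_elim
        case (elim n)
        then have "htinf_value N \<sigma> t L + 1 / Suc n * ?p - 2 * (1 / Suc n)\<^sup>2 * ?p * sqrt ?p / b
            \<le> htinf_value N \<sigma> t (L' n L)"
          using htinf_value_shift_ge[OF True, of "1 / Suc n" L] unfolding L'_def b_def by simp
        then have "(1 / Suc n * ?p - 2 * (1 / Suc n)\<^sup>2 * ?p * sqrt ?p / b) * Suc n \<le> ?D n L"
          by (intro mult_right_mono) auto
        also have "(1 / Suc n * ?p - 2 * (1 / Suc n)\<^sup>2 * ?p * sqrt ?p / b) * Suc n =
            ?p - 2 * ?p * sqrt ?p / b * (1 / Suc n)"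
          using b by (simp add: field_simps power2_eq_square del: of_nat_Suc)
        finally show ?case .
      qed
    qed
    have "(\<lambda>n. ?p - 2 * ?p * sqrt ?p / b * (1 / real (Suc n))) \<longlonglongrightarrow> ?p - 2 * ?p * sqrt ?p / b * 0"
      by (intro tendsto_intros lim_1_over_n[THEN LIMSEQ_Suc])
    then have "(\<lambda>n. ?p - 2 * ?p * sqrt ?p / b * (1 / real (Suc n))) \<longlonglongrightarrow> ?p" by simp
    from tendsto_sandwich[OF low _ this tendsto_const] up
    show "(\<lambda>n. ?D n L) \<longlonglongrightarrow> ?p" by (simp add: always_eventually)
  qed
qed

end

section \<open>Laplace noise\<close>

definition laplace_density :: "real \<Rightarrow> real \<Rightarrow> real" where
  "laplace_density b x = exp (- \<bar>x\<bar> / b) / (2 * b)"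

lemma laplace_eq: "laplace b = density lborel (\<lambda>x. ennreal (laplace_density b x))"
  unfolding laplace_def laplace_density_def ..

lemma laplace_density_measurable [measurable]: "laplace_density b \<in> borel_measurable borel"
  unfolding laplace_density_def by measurable

lemma sets_laplace [measurable_cong, simp]: "sets (laplace b) = sets borel"
  and space_laplace [simp]: "space (laplace b) = UNIV"
  by (simp_all add: laplace_eq)

context
  fixes b :: real
  assumes b: "b > 0"
begin

lemma laplace_density_nonneg: "laplace_density b x \<ge> 0"
  using b by (simp add: laplace_density_def)

lemma laplace_density_antimono: "\<bar>x\<bar> \<le> \<bar>y\<bar> \<Longrightarrow> laplace_density b y \<le> laplace_density b x"
  using b by (simp add: laplace_density_def divide_right_mono)

text \<open>At 0 both one-sided densities contribute and the right-hand side is twice too large; a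
  null set, removed later by \<open>AE_lborel_singleton\<close>.\<close>

lemma laplace_density_exponential:
  "x \<noteq> 0 \<Longrightarrow> laplace_density b x = (exponential_density (1 / b) x + exponential_density (1 / b) (- x)) / 2"
  by (auto simp: laplace_density_def exponential_density_def)

text \<open>Reflecting one of the two halves makes them equal for an even integrand. Total mass and
  second moment are then read off from the exponential law.\<close>

lemma nn_integral_laplace_even:
  fixes f :: "real \<Rightarrow> ennreal"
  assumes [measurable]: "f \<in> borel_measurable borel" and even: "\<And>x. f (- x) = f x"
  shows "(\<integral>\<^sup>+x. f x \<partial>laplace b) = (\<integral>\<^sup>+x. f x \<partial>density lborel (exponential_density (1 / b)))"
proof -
  let ?e = "exponential_density (1 / b)"
  have e_nonneg: "?e x \<ge> 0" for x using b by (simp add: exponential_density_def)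
  have "(\<integral>\<^sup>+x. f x \<partial>laplace b) = (\<integral>\<^sup>+x. ennreal (laplace_density b x) * f x \<partial>lborel)"
    unfolding laplace_eq by (subst nn_integral_density) auto
  also have "\<dots> = (\<integral>\<^sup>+x. (ennreal (?e x) * f x + ennreal (?e (- x)) * f (- x)) / 2 \<partial>lborel)"
  proof (rule nn_integral_cong_AE)
    have "AE x in lborel. x \<noteq> (0::real)"
      by (rule AE_lborel_singleton)
    then show "AE x in lborel. ennreal (laplace_density b x) * f x =
        (ennreal (?e x) * f x + ennreal (?e (- x)) * f (- x)) / 2"
    proof eventually_elim
      case (elim x)
      have "(ennreal (?e x) * f x + ennreal (?e (- x)) * f (- x)) / 2
          = ennreal (?e x + ?e (- x)) / 2 * f x"
        using e_nonneg by (simp add: even ennreal_plus distrib_left ennreal_times_divide mult.commute del: ennreal_plus[symmetric])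
      also have "ennreal (?e x + ?e (- x)) / 2 = ennreal (laplace_density b x)"
        using elim e_nonneg[of x] e_nonneg[of "- x"]
        by (subst laplace_density_exponential) (auto simp: divide_ennreal[symmetric])
      finally show ?case by simp
    qed
  qed
  also have "\<dots> = ((\<integral>\<^sup>+x. ennreal (?e x) * f x \<partial>lborel) + (\<integral>\<^sup>+x. ennreal (?e (- x)) * f (- x) \<partial>lborel)) / 2"
    by (subst nn_integral_divide, simp, subst nn_integral_add) auto
  also have "(\<integral>\<^sup>+x. ennreal (?e (- x)) * f (- x) \<partial>lborel) = (\<integral>\<^sup>+x. ennreal (?e x) * f x \<partial>lborel)"
    using nn_integral_real_affine[of "\<lambda>x. ennreal (?e x) * f x" "-1" 0] by simp
  also have "((\<integral>\<^sup>+x. ennreal (?e x) * f x \<partial>lborel) + (\<integral>\<^sup>+x. ennreal (?e x) * f x \<partial>lborel)) / 2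
      = (\<integral>\<^sup>+x. ennreal (?e x) * f x \<partial>lborel)"
    unfolding mult_2[symmetric] mult.commute[of 2] by (simp add: ennreal_mult_divide_eq)
  also have "\<dots> = (\<integral>\<^sup>+x. f x \<partial>density lborel ?e)"
    by (subst nn_integral_density) auto
  finally show ?thesis .
qed

lemma prob_space_laplace: "prob_space (laplace b)"
proof
  have "emeasure (laplace b) (space (laplace b)) = (\<integral>\<^sup>+x. 1 \<partial>laplace b)"
    by simp
  also have "\<dots> = (\<integral>\<^sup>+x. 1 \<partial>density lborel (exponential_density (1 / b)))"
    by (intro nn_integral_laplace_even) auto
  also have "\<dots> = 1"
    using prob_space.emeasure_space_1[OF prob_space_exponential_density[of "1 / b"]] b by simp
  finally show "emeasure (laplace b) (space (laplace b)) = 1" .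
qed

lemma measure_laplace_UNIV [simp]: "measure (laplace b) UNIV = 1"
  using prob_space.prob_space[OF prob_space_laplace] by simp

lemma laplace_second_moment:
  shows "integrable (laplace b) (\<lambda>z. z\<^sup>2)" and "(\<integral>z. z\<^sup>2 \<partial>laplace b) = 2 * b\<^sup>2"
proof -
  have "(\<integral>\<^sup>+z. ennreal (z\<^sup>2) \<partial>laplace b) = (\<integral>\<^sup>+z. ennreal (z\<^sup>2) \<partial>density lborel (erlang_density 0 (1 / b)))"
    by (subst nn_integral_laplace_even) (auto simp: exponential_density_def erlang_density_def)
  also have "\<dots> = (\<integral>\<^sup>+z. ennreal (erlang_density 0 (1 / b) z * z ^ 2) \<partial>lborel)"
    using b by (subst nn_integral_density) (auto simp: ennreal_mult erlang_density_def)
  also have "\<dots> = ennreal (2 * b\<^sup>2)"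
    using b by (subst nn_integral_erlang_ith_moment) (auto simp: fact_numeral field_simps power2_eq_square)
  finally have eq: "(\<integral>\<^sup>+z. ennreal (z\<^sup>2) \<partial>laplace b) = ennreal (2 * b\<^sup>2)" .
  then show *: "integrable (laplace b) (\<lambda>z. z\<^sup>2)"
    by (intro integrableI_nonneg) auto
  show "(\<integral>z. z\<^sup>2 \<partial>laplace b) = 2 * b\<^sup>2"
    using eq by (subst integral_eq_nn_integral) auto
qed

lemma laplace_first_moment:
  shows "integrable (laplace b) (\<lambda>z. z)" and "(\<integral>z. z \<partial>laplace b) = 0"
proof -
  interpret prob_space "laplace b" by (rule prob_space_laplace)
  show int: "integrable (laplace b) (\<lambda>z. z)"
  proof (rule Bochner_Integration.integrable_bound)
    show "integrable (laplace b) (\<lambda>z. 1 + z\<^sup>2)"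
      using laplace_second_moment(1) by simp
    have "\<bar>z\<bar> \<le> 1 + z\<^sup>2" for z :: real
      using zero_le_power2[of "\<bar>z\<bar> - 1"] abs_ge_zero[of z] unfolding power2_diff by simp
    then show "AE z in laplace b. norm z \<le> norm (1 + z\<^sup>2)"
      by (auto intro!: AE_I2)
  qed simp
  have "(\<integral>z. z \<partial>laplace b) = (\<integral>z. laplace_density b z * z \<partial>lborel)"
    unfolding laplace_eq by (subst integral_density) (auto simp: laplace_density_nonneg)
  also have "\<dots> = (\<integral>z. laplace_density b (- z) * (- z) \<partial>lborel)"
    using lborel_integral_real_affine[of "-1" "\<lambda>z. laplace_density b z * z" 0] by simp
  also have "\<dots> = - (\<integral>z. laplace_density b z * z \<partial>lborel)"
    by (simp add: laplace_density_def)
  also have "(\<integral>z. laplace_density b z * z \<partial>lborel) = (\<integral>z. z \<partial>laplace b)"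
    unfolding laplace_eq by (subst integral_density) (auto simp: laplace_density_nonneg)
  finally show "(\<integral>z. z \<partial>laplace b) = 0" by simp
qed

lemma integrable_laplace_bounded:
  fixes f :: "real \<Rightarrow> real"
  assumes "f \<in> borel_measurable borel" "\<And>x. \<bar>f x\<bar> \<le> c"
  shows "integrable (laplace b) f"
proof -
  interpret prob_space "laplace b" by (rule prob_space_laplace)
  show ?thesis
    using assms by (intro integrable_const_bound[of _ c]) auto
qed

section \<open>Shifted Laplace noise: privacy and truncation\<close>

text \<open>Moves the shift from the integrand into the density, so that different shifts can be
  compared pointwise against one fixed \<open>f\<close>.\<close>

lemma integral_laplace_shift:
  fixes f :: "real \<Rightarrow> real"
  assumes [measurable]: "f \<in> borel_measurable borel"
  shows "(\<integral>z. f (a + z) \<partial>laplace b) = (\<integral>v. laplace_density b (v - a) * f v \<partial>lborel)"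
proof -
  have "(\<integral>z. f (a + z) \<partial>laplace b) = (\<integral>z. laplace_density b z * f (a + z) \<partial>lborel)"
    unfolding laplace_eq by (subst integral_density) (auto simp: laplace_density_nonneg)
  also have "\<dots> = (\<integral>v. laplace_density b (v - a) * f v \<partial>lborel)"
    using lborel_integral_real_affine[of "1" "\<lambda>v. laplace_density b (v - a) * f v" a] by simp
  finally show ?thesis .
qed

lemma integrable_laplace_shift:
  fixes f :: "real \<Rightarrow> real"
  assumes [measurable]: "f \<in> borel_measurable borel"
  shows "integrable (laplace b) (\<lambda>z. f (a + z)) \<longleftrightarrow> integrable lborel (\<lambda>v. laplace_density b (v - a) * f v)"
proof -
  have "integrable (laplace b) (\<lambda>z. f (a + z)) \<longleftrightarrow> integrable lborel (\<lambda>z. laplace_density b z * f (a + z))"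
    unfolding laplace_eq by (subst integrable_density) (auto simp: laplace_density_nonneg)
  also have "\<dots> \<longleftrightarrow> integrable lborel (\<lambda>v. laplace_density b (v - a) * f v)"
    using lborel_integrable_real_affine_iff[of "1" "\<lambda>v. laplace_density b (v - a) * f v" a] by simp
  finally show ?thesis .
qed

text \<open>The Laplace mechanism for test functions: by the triangle inequality in the exponent the
  ratio of the two shifted densities is bounded. A general bounded \<open>f\<close> is needed
  because the weight of all later rounds is inserted for it.\<close>

lemma laplace_shift_le:
  fixes f :: "real \<Rightarrow> real"
  assumes f: "f \<in> borel_measurable borel" "\<And>x. 0 \<le> f x" "\<And>x. f x \<le> c"
  shows "(\<integral>z. f (a + z) \<partial>laplace b) \<le> exp (\<bar>a - a'\<bar> / b) * (\<integral>z. f (a' + z) \<partial>laplace b)"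
proof -
  note [measurable] = f(1)
  have "integrable (laplace b) (\<lambda>z. f (x + z))" for x
    using f by (intro integrable_laplace_bounded[of _ c]) auto
  then have int: "integrable lborel (\<lambda>v. laplace_density b (v - x) * f v)" for x
    using integrable_laplace_shift[OF f(1)] by blast
  have "laplace_density b (v - a) \<le> exp (\<bar>a - a'\<bar> / b) * laplace_density b (v - a')" for v
  proof -
    have "- \<bar>v - a\<bar> / b \<le> \<bar>a - a'\<bar> / b + - \<bar>v - a'\<bar> / b"
      unfolding add_divide_distrib[symmetric] using b by (intro divide_right_mono) auto
    then have "exp (- \<bar>v - a\<bar> / b) \<le> exp (\<bar>a - a'\<bar> / b) * exp (- \<bar>v - a'\<bar> / b)"
      unfolding exp_add[symmetric] by simp
    then have "exp (- \<bar>v - a\<bar> / b) / (2 * b) \<le> exp (\<bar>a - a'\<bar> / b) * exp (- \<bar>v - a'\<bar> / b) / (2 * b)"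
      using b by (intro divide_right_mono) auto
    then show ?thesis
      unfolding laplace_density_def by simp
  qed
  then have "(\<integral>v. laplace_density b (v - a) * f v \<partial>lborel) \<le>
      (\<integral>v. exp (\<bar>a - a'\<bar> / b) * (laplace_density b (v - a') * f v) \<partial>lborel)"
    unfolding mult.assoc[symmetric]
    by (intro integral_mono int[unfolded mult.assoc[symmetric]] mult_right_mono f(2))
       (simp_all add: mult.assoc int)
  then show ?thesis
    unfolding integral_laplace_shift[OF f(1)] by simp
qed

lemma integrable_laplace_truncated:
  "integrable (laplace b) (\<lambda>z. if \<bar>a + z\<bar> \<le> r then a + z else 0)"
  by (intro integrable_laplace_bounded[of _ "\<bar>r\<bar>"]) auto

text \<open>
  The noisy value exceeds \<open>r\<close> in the positive direction at least as often as in the negative one,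
  because the density of the noise is symmetric and decreasing in the modulus.
\<close>

lemma laplace_truncated_mean_le:
  assumes "a \<ge> 0"
  shows "(\<integral>z. (if \<bar>a + z\<bar> \<le> r then a + z else 0) \<partial>laplace b) \<le> a"
proof -
  interpret prob_space "laplace b" by (rule prob_space_laplace)
  \<comment> \<open>\<open>f\<close> is the discarded part, so the claim is that
    \<open>f (a + z)\<close> has nonnegative mean. As \<open>f\<close> is odd, averaging with the
    reflected integral leaves \<open>f v\<close> times the difference of the densities at
    \<open>v - a\<close> and \<open>v + a\<close>, two factors that never have opposite signs since
    \<open>a \<ge> 0\<close>.\<close>
  define f :: "real \<Rightarrow> real" where "f v = (if \<bar>v\<bar> \<le> r then 0 else v)" for v
  have f [measurable]: "f \<in> borel_measurable borel"
    unfolding f_def by measurable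
  have "integrable (laplace b) (\<lambda>z. (a + z) - (if \<bar>a + z\<bar> \<le> r then a + z else 0))"
    using laplace_first_moment(1) integrable_laplace_truncated by simp
  also have "(\<lambda>z. (a + z) - (if \<bar>a + z\<bar> \<le> r then a + z else 0)) = (\<lambda>z. f (a + z))"
    by (auto simp: f_def)
  finally have int: "integrable (laplace b) (\<lambda>z. f (a + z))" .
  then have int1: "integrable lborel (\<lambda>v. laplace_density b (v - a) * f v)"
    using integrable_laplace_shift[OF f] by blast
  have f_minus: "f (- v) = - f v" for v
    by (auto simp: f_def)
  have sym: "laplace_density b (- v - a) * f (- v) = - (laplace_density b (v + a) * f v)" for v
  proof -
    have "laplace_density b (- v - a) = laplace_density b (v + a)"
      unfolding laplace_density_def by (simp add: abs_if)
    then show ?thesis by (simp add: f_minus)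
  qed
  have int2: "integrable lborel (\<lambda>v. - (laplace_density b (v + a) * f v))"
    using int1 lborel_integrable_real_affine_iff[of "-1" "\<lambda>v. laplace_density b (v - a) * f v" 0]
    by (simp add: sym)
  let ?I = "\<integral>v. laplace_density b (v - a) * f v \<partial>lborel"
  have "?I = (\<integral>v. - (laplace_density b (v + a) * f v) \<partial>lborel)"
    using lborel_integral_real_affine[of "-1" "\<lambda>v. laplace_density b (v - a) * f v" 0] by (simp add: sym)
  then have "2 * ?I = (\<integral>v. laplace_density b (v - a) * f v + - (laplace_density b (v + a) * f v) \<partial>lborel)"
    using int1 int2 by (subst Bochner_Integration.integral_add) auto
  also have "\<dots> \<ge> 0"
  proof (rule integral_nonneg_AE[OF AE_I2])
    fix v :: real
    show "0 \<le> laplace_density b (v - a) * f v + - (laplace_density b (v + a) * f v)"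
    proof (cases "v \<ge> 0")
      case True
      then have "laplace_density b (v + a) \<le> laplace_density b (v - a)"
        using assms by (intro laplace_density_antimono) auto
      moreover have "f v \<ge> 0" using True by (simp add: f_def)
      ultimately show ?thesis
        by (simp add: mult_right_mono)
    next
      case False
      then have "laplace_density b (v - a) \<le> laplace_density b (v + a)"
        using assms by (intro laplace_density_antimono) auto
      moreover have "f v \<le> 0" using False by (simp add: f_def)
      ultimately show ?thesis
        by (simp add: mult_right_mono_neg)
    qed
  qed
  finally have "0 \<le> (\<integral>z. f (a + z) \<partial>laplace b)"
    unfolding integral_laplace_shift[OF f] by simp
  also have "\<dots> = (\<integral>z. (a + z) - (if \<bar>a + z\<bar> \<le> r then a + z else 0) \<partial>laplace b)"
    by (intro Bochner_Integration.integral_cong) (auto simp: f_def)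
  also have "\<dots> = a - (\<integral>z. (if \<bar>a + z\<bar> \<le> r then a + z else 0) \<partial>laplace b)"
    using laplace_first_moment integrable_laplace_truncated
    by simp
  finally show ?thesis by simp
qed

lemma laplace_shifted_second_moment:
  shows "integrable (laplace b) (\<lambda>z. (a + z)\<^sup>2)" and "(\<integral>z. (a + z)\<^sup>2 \<partial>laplace b) = a\<^sup>2 + 2 * b\<^sup>2"
proof -
  interpret prob_space "laplace b" by (rule prob_space_laplace)
  show "integrable (laplace b) (\<lambda>z. (a + z)\<^sup>2)" and "(\<integral>z. (a + z)\<^sup>2 \<partial>laplace b) = a\<^sup>2 + 2 * b\<^sup>2"
    using laplace_first_moment laplace_second_moment by (simp_all add: power2_sum)
qed

end

section \<open>The law of the actions of the conversion\<close>

text \<open>Values off the support have probability 0, but \<open>bind\<close> takes its target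
  sigma-algebra from the kernel at a chosen point, which may lie off the support. This is why the
  sigma-algebras must agree everywhere.\<close>

lemma bind_measure_pmf_cong_sets:
  assumes "\<And>x. x \<in> set_pmf p \<Longrightarrow> f x = g x" "\<And>x. sets (f x) = sets (g x)"
  shows "measure_pmf p \<bind> f = measure_pmf p \<bind> g"
proof -
  have sp: "subprob_algebra (f x) = subprob_algebra (g x)" for x
    by (intro subprob_algebra_cong assms)
  have "emeasure (measure_pmf p) (f -` A) = emeasure (measure_pmf p) (g -` A)" for A
  proof -
    have "f -` A \<inter> set_pmf p = g -` A \<inter> set_pmf p" using assms(1) by auto
    then show ?thesis by (metis emeasure_Int_set_pmf)
  qed
  then show ?thesis
    unfolding bind_def distr_def by (simp add: sp)
qed

lemma measurable_measure_pmf_finite: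
  fixes Q :: "'a \<Rightarrow> 'b pmf"
  assumes "finite S" "\<And>z x. x \<notin> S \<Longrightarrow> pmf (Q z) x = 0"
    and [measurable]: "\<And>x. (\<lambda>z. pmf (Q z) x) \<in> borel_measurable M"
  shows "(\<lambda>z. measure_pmf (Q z)) \<in> measurable M (subprob_algebra (count_space UNIV))"
proof (rule measurable_subprob_algebra)
  fix z show "subprob_space (measure_pmf (Q z))"
    by (rule prob_space_imp_subprob_space) (rule prob_space_measure_pmf)
next
  fix A :: "'b set"
  have "emeasure (measure_pmf (Q z)) A = ennreal (\<Sum>x\<in>A \<inter> S. pmf (Q z) x)" for z
  proof -
    have "emeasure (measure_pmf (Q z)) A = emeasure (measure_pmf (Q z)) (A \<inter> S)"
      using assms(2)[of _ z] by (intro emeasure_eq_AE AE_pmfI) (auto simp: set_pmf_iff)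
    also have "\<dots> = ennreal (\<Sum>x\<in>A \<inter> S. pmf (Q z) x)"
      using assms(1) by (simp add: emeasure_measure_pmf_finite sum_ennreal)
    finally show ?thesis .
  qed
  then show "(\<lambda>z. emeasure (measure_pmf (Q z)) A) \<in> borel_measurable M"
    by simp
qed simp_all

text \<open>With a common finite support, mixing over continuous noise yields a discrete law with
  averaged probabilities. The measurability of the bandit algorithm enters the law of the conversion
  here.\<close>

lemma bind_measure_pmf_finite:
  fixes Q :: "'a \<Rightarrow> 'b :: countable pmf"
  assumes "prob_space M" "finite S" "\<And>z x. x \<notin> S \<Longrightarrow> pmf (Q z) x = 0"
    and meas [measurable]: "\<And>x. (\<lambda>z. pmf (Q z) x) \<in> borel_measurable M"
  shows "\<exists>R. M \<bind> (\<lambda>z. measure_pmf (Q z)) = measure_pmf R \<and> (\<forall>x. pmf R x = (\<integral>z. pmf (Q z) x \<partial>M))"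
proof -
  interpret prob_space M by fact
  have int: "integrable M (\<lambda>z. pmf (Q z) x)" for x
    by (intro integrable_const_bound[of _ 1]) (auto simp: pmf_le_1)
  have "(\<Sum>x\<in>S. \<integral>z. pmf (Q z) x \<partial>M) = (\<integral>z. (\<Sum>x\<in>S. pmf (Q z) x) \<partial>M)"
    using int by simp
  also have "\<dots> = (\<integral>z. 1 \<partial>M)"
    using assms(2,3) by (intro Bochner_Integration.integral_cong refl sum_pmf_eq_1) (auto simp: set_pmf_eq)
  finally have "(\<Sum>x\<in>S. \<integral>z. pmf (Q z) x \<partial>M) = 1"
    by (simp add: prob_space)
  then obtain R where R: "\<And>x. pmf R x = (if x \<in> S then \<integral>z. pmf (Q z) x \<partial>M else 0)"
    using exists_pmf_finite_support[OF assms(2), of "\<lambda>x. \<integral>z. pmf (Q z) x \<partial>M"] by auto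
  have R: "pmf R x = (\<integral>z. pmf (Q z) x \<partial>M)" for x
    using assms(3) by (simp add: R)
  have kernel: "(\<lambda>z. measure_pmf (Q z)) \<in> measurable M (subprob_algebra (count_space UNIV))"
    by (rule measurable_measure_pmf_finite[OF assms(2,3) meas])
  have "M \<bind> (\<lambda>z. measure_pmf (Q z)) = measure_pmf R"
  proof (rule measure_eqI_countable)
    show "sets (M \<bind> (\<lambda>z. measure_pmf (Q z))) = Pow UNIV"
      using not_empty by (subst sets_bind[where N = "count_space UNIV"]) auto
    fix x
    have "emeasure (M \<bind> (\<lambda>z. measure_pmf (Q z))) {x} = (\<integral>\<^sup>+z. emeasure (measure_pmf (Q z)) {x} \<partial>M)"
      using not_empty kernel by (intro emeasure_bind) auto
    also have "\<dots> = ennreal (\<integral>z. pmf (Q z) x \<partial>M)"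
      unfolding emeasure_pmf_single by (intro nn_integral_eq_integral int) simp
    finally show "emeasure (M \<bind> (\<lambda>z. measure_pmf (Q z))) {x} = emeasure (measure_pmf R) {x}"
      by (simp add: emeasure_pmf_single R)
  qed auto
  with R show ?thesis by blast
qed

lemma pmf_map_Cons: "pmf (map_pmf ((#) i) p) (x # xs) = (if x = i then pmf p xs else 0)"
  "pmf (map_pmf ((#) i) p) [] = 0"
proof -
  show "pmf (map_pmf ((#) i) p) (x # xs) = (if x = i then pmf p xs else 0)"
    by (cases "x = i") (auto intro!: pmf_map_outside simp: pmf_map_inj' inj_on_def)
  show "pmf (map_pmf ((#) i) p) [] = 0"
    by (intro pmf_map_outside) auto
qed

section \<open>Action sequences and their histories\<close>

definition action_lists :: "nat \<Rightarrow> nat \<Rightarrow> nat list set" where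
  "action_lists K n = {xs. set xs \<subseteq> {1..K} \<and> length xs = n}"

lemma finite_action_lists [simp, intro]: "finite (action_lists K n)"
  unfolding action_lists_def by (rule finite_lists_length_eq) simp

lemma action_lists_0 [simp]: "action_lists K 0 = {[]}"
  by (auto simp: action_lists_def)

lemma Nil_in_action_lists [simp]: "[] \<in> action_lists K n \<longleftrightarrow> n = 0"
  and Cons_in_action_lists [simp]: "x # xs \<in> action_lists K (Suc n) \<longleftrightarrow> x \<in> {1..K} \<and> xs \<in> action_lists K n"
  by (auto simp: action_lists_def)

lemma sum_action_lists_Suc:
  "(\<Sum>xs\<in>action_lists K (Suc n). f xs) = (\<Sum>x=1..K. \<Sum>xs\<in>action_lists K n. f (x # xs))"
proof -
  have "action_lists K (Suc n) = (\<lambda>(x, xs). x # xs) ` ({1..K} \<times> action_lists K n)"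
    by (auto simp: action_lists_def length_Suc_conv image_iff)
  also have "sum f \<dots> = (\<Sum>p\<in>{1..K} \<times> action_lists K n. f (case p of (x, xs) \<Rightarrow> x # xs))"
    by (subst sum.reindex) (auto simp: inj_on_def o_def)
  also have "\<dots> = (\<Sum>x=1..K. \<Sum>xs\<in>action_lists K n. f (x # xs))"
    by (simp add: sum.cartesian_product split_def)
  finally show ?thesis .
qed

text \<open>\<open>history\<close> with a variable starting round, for inductions that remove the
  first action.\<close>

primrec history_from :: "(nat \<Rightarrow> nat \<Rightarrow> real) \<Rightarrow> nat \<Rightarrow> nat list \<Rightarrow> (nat \<times> real) list" where
  "history_from l t [] = []"
| "history_from l t (x # xs) = (x, l t x) # history_from l (Suc t) xs"

lemma history_eq_history_from: "history l xs = history_from l 1 xs"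
proof -
  have "map2 (\<lambda>s i. (i, l s i)) [t..<t + length xs] xs = history_from l t xs" for t
  proof (induction xs arbitrary: t)
    case (Cons x xs)
    have "[t..<t + length (x # xs)] = t # [Suc t..<Suc t + length xs]"
      by (simp add: upt_conv_Cons del: upt_Suc)
    then show ?case using Cons.IH[of "Suc t"] by (simp del: upt_Suc)
  qed simp
  from this[of 1] show ?thesis by (simp add: history_def)
qed

lemma length_history_from [simp]: "length (history_from l t xs) = length xs"
  by (induction xs arbitrary: t) auto

lemma map_fst_history_from [simp]: "map fst (history_from l t xs) = xs"
  by (induction xs arbitrary: t) auto

lemma history_from_snoc: "history_from l t (xs @ [i]) = history_from l t xs @ [(i, l (t + length xs) i)]"
  by (induction xs arbitrary: t) auto

lemma history_from_cong:
  "(\<And>s i. s \<in> {t..<t + length xs} \<Longrightarrow> i \<in> set xs \<Longrightarrow> l s i = l' s i) \<Longrightarrow> history_from l t xs = history_from l' t xs"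
  by (induction xs arbitrary: t) auto

declare batch_arm.simps [simp del] batch_noise.simps [simp del] batch_update.simps [simp del]

lemma batch_update_complete:
  "Suc (length cur) = \<tau> \<Longrightarrow>
    batch_update \<tau> (g, cur) j v z = (g @ [(j, (sum_list (map snd cur) + v) / real \<tau> + z)], [])"
  by (simp add: batch_update.simps Let_def)

lemma batch_update_incomplete:
  "Suc (length cur) \<noteq> \<tau> \<Longrightarrow> batch_update \<tau> (g, cur) j v z = (g, cur @ [(j, v)])"
  by (simp add: batch_update.simps Let_def)

lemma sum_pmf_le_1: "finite A \<Longrightarrow> (\<Sum>x\<in>A. pmf p x) \<le> 1"
  by (metis measure_measure_pmf_finite measure_pmf.prob_le_1)

section \<open>Bandit algorithms measurable in the observed losses\<close>

text \<open>With the arms fixed, histories are parametrized by real sequences, so measurability can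
  be stated on a product space instead of a space of lists.\<close>

definition with_losses :: "nat list \<Rightarrow> (nat \<Rightarrow> real) \<Rightarrow> (nat \<times> real) list" where
  "with_losses js v = zip js (map v [0..<length js])"

definition measurable_bandit :: "nat \<Rightarrow> bandit_algorithm \<Rightarrow> bool" where
  "measurable_bandit N B \<longleftrightarrow> (\<forall>g. B g \<in> distributions_on N) \<and>
     (\<forall>js i. (\<lambda>v. pmf (B (with_losses js v)) i) \<in> borel_measurable borel)"

lemma with_losses_snoc: "with_losses (js @ [j]) v = with_losses js v @ [(j, v (length js))]"
  by (simp add: with_losses_def)

lemma with_losses_cong: "(\<And>k. k < length js \<Longrightarrow> v k = v' k) \<Longrightarrow> with_losses js v = with_losses js v'"
  unfolding with_losses_def by (intro arg_cong2[of _ _ _ _ zip] map_cong) auto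

lemma append_eq_with_losses:
  "g @ [(j, y)] = with_losses (map fst g @ [j]) (\<lambda>k. if k < length g then snd (g ! k) else y)"
  by (rule nth_equalityI) (auto simp: with_losses_def nth_append less_Suc_eq)

text \<open>
  For a history \<open>h\<close> with actions \<open>xs\<close>, \<open>weight h ms s\<close> is the probability that the conversion, started
  in state \<open>s\<close>, plays \<open>xs\<close> against the advice \<open>ms\<close> when the losses of these actions are as in \<open>h\<close>.
\<close>

locale batched_bandit =
  fixes N \<tau> :: nat and \<epsilon> :: real and B :: bandit_algorithm
  assumes \<tau>: "\<tau> \<ge> 1" and \<epsilon>: "\<epsilon> > 0" and B: "measurable_bandit N B"
begin

fun weight :: "(nat \<times> real) list \<Rightarrow> advice list \<Rightarrow> batch_state \<Rightarrow> real" where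
  "weight [] ms s = 1"
| "weight (p # h) [] s = 0"
| "weight ((x, v) # h) (m # ms) s = (\<Sum>j=1..N. pmf (batch_arm B s) j * pmf (m j) x *
     (\<integral>z. weight h ms (batch_update \<tau> s j v z) \<partial>batch_noise \<tau> \<epsilon> s))"

lemma noise_scale_pos: "1 / (real \<tau> * \<epsilon>) > 0"
  using \<tau> \<epsilon> by simp

lemma sets_batch_noise [measurable_cong, simp]: "sets (batch_noise \<tau> \<epsilon> s) = sets borel"
  by (cases s) (simp add: batch_noise.simps)

lemma space_batch_noise [simp]: "space (batch_noise \<tau> \<epsilon> s) = UNIV"
  by (cases s) (simp add: batch_noise.simps)

lemma prob_space_batch_noise: "prob_space (batch_noise \<tau> \<epsilon> s)"
  using prob_space_laplace[OF noise_scale_pos]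
  by (cases s) (auto simp: batch_noise.simps intro!: prob_space_return)

lemma measure_batch_noise_UNIV [simp]: "measure (batch_noise \<tau> \<epsilon> s) UNIV = 1"
  using prob_space.prob_space[OF prob_space_batch_noise] by simp

lemma integrable_batch_noise_bounded:
  fixes f :: "real \<Rightarrow> real"
  assumes "f \<in> borel_measurable borel" "\<And>x. \<bar>f x\<bar> \<le> c"
  shows "integrable (batch_noise \<tau> \<epsilon> s) f"
proof -
  interpret prob_space "batch_noise \<tau> \<epsilon> s" by (rule prob_space_batch_noise)
  show ?thesis using assms by (intro integrable_const_bound[of _ c]) auto
qed

lemma integral_batch_noise_incomplete:
  fixes f :: "real \<Rightarrow> real"
  assumes "Suc (length cur) \<noteq> \<tau>" "f \<in> borel_measurable borel"
  shows "(\<integral>z. f z \<partial>batch_noise \<tau> \<epsilon> (g, cur)) = f 0"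
  using assms by (simp add: batch_noise.simps integral_return)

lemma pmf_bandit_measurable [measurable]: "(\<lambda>v. pmf (B (with_losses js v)) i) \<in> borel_measurable borel"
  using B by (simp add: measurable_bandit_def)

lemma bandit_in_distributions_on: "B g \<in> distributions_on N"
  using B by (simp add: measurable_bandit_def)

text \<open>Joint measurability in all losses fed so far, not only in the newest one, is what the
  induction needs: after integrating out the noise of a batch, the result must still be measurable
  in the earlier values.\<close>

lemma weight_measurable_losses:
  "(\<lambda>v. weight h ms (with_losses js v, cur)) \<in> borel_measurable borel"
proof (induction h arbitrary: ms js cur)
  case Nil
  show ?case by simp
next
  case (Cons p h)
  note [measurable] = Cons.IH
  obtain x w where p: "p = (x, w)" by (cases p)
  show ?case
  proof (cases ms)
    case Nil
    then show ?thesis by simp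
  next
    case ms: (Cons m ms')
    have [measurable]: "(\<lambda>v. pmf (batch_arm B (with_losses js v, cur)) j) \<in> borel_measurable borel" for j
      by (cases "cur = []") (simp_all add: batch_arm.simps)
    have [measurable]: "(\<lambda>v. \<integral>z. weight h ms' (batch_update \<tau> (with_losses js v, cur) j w z)
        \<partial>batch_noise \<tau> \<epsilon> (with_losses js v, cur)) \<in> borel_measurable borel" for j
    proof (cases "Suc (length cur) = \<tau>")
      case True
      interpret prob_space "laplace (1 / (real \<tau> * \<epsilon>))"
        by (rule prob_space_laplace[OF noise_scale_pos])
      define c where "c = (sum_list (map snd cur) + w) / real \<tau>"
      \<comment> \<open>Coordinate \<open>length js\<close> is the first one that
        \<open>with_losses js v\<close> does not read; it receives the noisy average of the
        completed batch, which belongs to the arm appended to \<open>js\<close>.\<close>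
      define u :: "(nat \<Rightarrow> real) \<times> real \<Rightarrow> nat \<Rightarrow> real"
        where "u = (\<lambda>p k. if k = length js then c + snd p else fst p k)"
      have "(\<lambda>p. u p k) \<in> borel_measurable (borel \<Otimes>\<^sub>M borel)" for k
      proof (cases "k = length js")
        case False
        then show ?thesis
          using measurable_compose[OF measurable_fst measurable_product_coordinates[of k]]
          by (simp add: u_def)
      qed (simp add: u_def)
      then have [measurable]: "u \<in> borel_measurable (borel \<Otimes>\<^sub>M borel)"
        by (intro measurable_coordinatewise_then_product)
      have "with_losses js v @ [(j, c + z)] = with_losses (js @ [j]) (u (v, z))" for v z
        unfolding with_losses_snoc by (auto simp: u_def intro!: with_losses_cong)
      then show ?thesis
        using True by (simp add: batch_noise.simps batch_update_complete c_def[symmetric])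
    next
      case False
      then show ?thesis
        by (simp add: integral_batch_noise_incomplete batch_update_incomplete)
    qed
    show ?thesis by (simp add: p ms)
  qed
qed

lemma weight_measurable_noise [measurable]:
  "(\<lambda>z. weight h ms (batch_update \<tau> s j v z)) \<in> borel_measurable borel"
proof (cases s)
  case (Pair g cur)
  show ?thesis
  proof (cases "Suc (length cur) = \<tau>")
    case True
    define c where "c = (sum_list (map snd cur) + v) / real \<tau>"
    have "(\<lambda>z. (\<lambda>k. if k < length g then snd (g ! k) else c + z)) \<in> borel_measurable borel"
      by (intro measurable_coordinatewise_then_product) measurable
    from measurable_compose[OF this weight_measurable_losses] show ?thesis
      using True by (simp add: Pair batch_update_complete append_eq_with_losses c_def[symmetric])
  qed (simp add: Pair batch_update_incomplete)
qed

lemma weight_nonneg: "weight h ms s \<ge> 0"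
  by (induction h ms s rule: weight.induct) (auto intro!: sum_nonneg integral_nonneg_AE)

lemma weight_le_1: "weight h ms s \<le> 1"
proof (induction h ms s rule: weight.induct)
  case (3 x v h m ms s)
  have "(\<Sum>j=1..N. pmf (batch_arm B s) j * pmf (m j) x *
      (\<integral>z. weight h ms (batch_update \<tau> s j v z) \<partial>batch_noise \<tau> \<epsilon> s)) \<le> (\<Sum>j=1..N. pmf (batch_arm B s) j)"
  proof (rule sum_mono)
    fix j assume j: "j \<in> {1..N}"
    interpret prob_space "batch_noise \<tau> \<epsilon> s" by (rule prob_space_batch_noise)
    have "(\<integral>z. weight h ms (batch_update \<tau> s j v z) \<partial>batch_noise \<tau> \<epsilon> s) \<le> 1"
      using 3[OF j] by (intro integral_le_const integrable_batch_noise_bounded[of _ 1])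
        (auto simp: weight_nonneg)
    then have "pmf (batch_arm B s) j * pmf (m j) x *
        (\<integral>z. weight h ms (batch_update \<tau> s j v z) \<partial>batch_noise \<tau> \<epsilon> s) \<le> pmf (batch_arm B s) j * 1 * 1"
      by (intro mult_mono pmf_le_1) (auto simp: weight_nonneg intro!: integral_nonneg_AE)
    then show "pmf (batch_arm B s) j * pmf (m j) x *
        (\<integral>z. weight h ms (batch_update \<tau> s j v z) \<partial>batch_noise \<tau> \<epsilon> s) \<le> pmf (batch_arm B s) j"
      by simp
  qed
  also have "\<dots> \<le> 1" by (rule sum_pmf_le_1) simp
  finally show ?case by simp
qed simp_all

lemma integrable_weight:
  "integrable (batch_noise \<tau> \<epsilon> s) (\<lambda>z. weight h ms (batch_update \<tau> s' j v z))"
  by (intro integrable_batch_noise_bounded[of _ 1]) (auto simp: weight_nonneg weight_le_1)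

text \<open>
  Losses that differ by \<open>d\<close> in total shift the noisy batch averages by \<open>d/\<tau>\<close> in total, at the
  price of a factor \<open>exp (\<epsilon> d)\<close>.
\<close>

lemma weight_private:
  assumes "map fst h = map fst h'" "map fst cur = map fst cur'"
  shows "weight h ms (g, cur) \<le> exp (\<epsilon> * (\<bar>sum_list (map snd cur) - sum_list (map snd cur')\<bar> +
    (\<Sum>(p, p')\<leftarrow>zip h h'. \<bar>snd p - snd p'\<bar>))) * weight h' ms (g, cur')"
  using assms
proof (induction h arbitrary: h' ms g cur cur')
  case Nil
  then show ?case using \<epsilon> by simp
next
  case (Cons p h)
  obtain x v where p: "p = (x, v)" by (cases p)
  obtain v' h'' where h': "h' = (x, v') # h''" and h'': "map fst h = map fst h''"
    using Cons.prems(1) p by (cases h') auto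
  define r where "r = (\<Sum>(p, p')\<leftarrow>zip h h''. \<bar>snd p - snd p'\<bar>)"
  define S S' where "S = sum_list (map snd cur)" and "S' = sum_list (map snd cur')"
  have len: "length cur = length cur'"
    using Cons.prems(2) by (rule map_eq_imp_length_eq)
  show ?case
  proof (cases ms)
    case Nil
    then show ?thesis by (simp add: p h')
  next
    case ms: (Cons m ms')
    have arm: "batch_arm B (g, cur) = batch_arm B (g, cur')"
      using Cons.prems(2) by (cases cur; cases cur') (auto simp: batch_arm.simps)
    let ?I = "\<lambda>h cur v j. \<integral>z. weight h ms' (batch_update \<tau> (g, cur) j v z) \<partial>batch_noise \<tau> \<epsilon> (g, cur)"
    have step: "?I h cur v j \<le> exp (\<epsilon> * (\<bar>S - S'\<bar> + (\<bar>v - v'\<bar> + r))) * ?I h'' cur' v' j" for j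
    proof (cases "Suc (length cur) = \<tau>")
      case False
      then have eq: "?I h cur v j = weight h ms' (g, cur @ [(j, v)])"
        "?I h'' cur' v' j = weight h'' ms' (g, cur' @ [(j, v')])"
        by (simp_all add: integral_batch_noise_incomplete batch_update_incomplete len)
      \<comment> \<open>Inside a batch the difference of \<open>v\<close> and \<open>v'\<close>
        merely moves from the remaining history into the partial sum; the total budget does not
        grow.\<close>
      have "weight h ms' (g, cur @ [(j, v)]) \<le>
          exp (\<epsilon> * (\<bar>S + v - (S' + v')\<bar> + r)) * weight h'' ms' (g, cur' @ [(j, v')])"
        using Cons.IH[OF h'', of "cur @ [(j, v)]" "cur' @ [(j, v')]" ms' g] Cons.prems(2)
        by (simp add: S_def S'_def r_def)
      also have "exp (\<epsilon> * (\<bar>S + v - (S' + v')\<bar> + r)) * weight h'' ms' (g, cur' @ [(j, v')]) \<le>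
          exp (\<epsilon> * (\<bar>S - S'\<bar> + (\<bar>v - v'\<bar> + r))) * weight h'' ms' (g, cur' @ [(j, v')])"
        using \<epsilon> by (intro mult_right_mono weight_nonneg) auto
      finally show ?thesis unfolding eq .
    next
      case True
      then have True': "Suc (length cur') = \<tau>" by (simp add: len)
      let ?L = "laplace (1 / (real \<tau> * \<epsilon>))"
      define c c' where "c = (S + v) / real \<tau>" and "c' = (S' + v') / real \<tau>"
      define f where "f = (\<lambda>y. weight h ms' (g @ [(j, y)], []))"
      define f' where "f' = (\<lambda>y. weight h'' ms' (g @ [(j, y)], []))"
      have f_meas: "(\<lambda>y. weight k ms' (g @ [(j, y)], [])) \<in> borel_measurable borel" for k
      proof -
        have "(\<lambda>y. (\<lambda>k. if k < length g then snd (g ! k) else y)) \<in> borel_measurable borel"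
          by (intro measurable_coordinatewise_then_product) measurable
        from measurable_compose[OF this weight_measurable_losses] show ?thesis
          by (simp add: append_eq_with_losses)
      qed
      then have [measurable]: "f \<in> borel_measurable borel" "f' \<in> borel_measurable borel"
        by (simp_all add: f_def f'_def)
      \<comment> \<open>Once both runs feed the same value \<open>y\<close>, their states coincide
        and only the later differences \<open>r\<close> count.\<close>
      have f_le: "f y \<le> exp (\<epsilon> * r) * f' y" for y
        using Cons.IH[OF h'', of "[]" "[]" ms'] by (simp add: f_def f'_def r_def)
      have f'_bounds: "0 \<le> f' y" "f' y \<le> 1" for y
        by (simp_all add: f'_def weight_nonneg weight_le_1)
      have f_bounds: "0 \<le> f y" "f y \<le> 1" for y
        by (simp_all add: f_def weight_nonneg weight_le_1)
      have int: "integrable ?L (\<lambda>z. f (c + z))" "integrable ?L (\<lambda>z. f' (c + z))"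
        using f_bounds f'_bounds by (auto intro!: integrable_laplace_bounded[OF noise_scale_pos, of _ 1])
      have "?I h cur v j = (\<integral>z. f (c + z) \<partial>?L)"
        using True by (simp add: batch_noise.simps batch_update_complete f_def c_def S_def)
      also have "\<dots> \<le> (\<integral>z. exp (\<epsilon> * r) * f' (c + z) \<partial>?L)"
        using int f_le by (intro integral_mono) auto
      also have "\<dots> = exp (\<epsilon> * r) * (\<integral>z. f' (c + z) \<partial>?L)" by simp
      also have "\<dots> \<le> exp (\<epsilon> * r) * (exp (\<bar>c - c'\<bar> / (1 / (real \<tau> * \<epsilon>))) * (\<integral>z. f' (c' + z) \<partial>?L))"
        using f'_bounds by (intro mult_left_mono laplace_shift_le[OF noise_scale_pos, of _ 1]) auto
      \<comment> \<open>The factor \<open>\<tau>\<close> in the noise scale cancels the one in the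
        average.\<close>
      also have "\<bar>c - c'\<bar> / (1 / (real \<tau> * \<epsilon>)) = \<epsilon> * \<bar>S + v - (S' + v')\<bar>"
        using \<tau> by (simp add: c_def c'_def diff_divide_distrib[symmetric] abs_divide)
      also have "exp (\<epsilon> * r) * (exp (\<epsilon> * \<bar>S + v - (S' + v')\<bar>) * (\<integral>z. f' (c' + z) \<partial>?L)) =
          exp (\<epsilon> * (\<bar>S + v - (S' + v')\<bar> + r)) * (\<integral>z. f' (c' + z) \<partial>?L)"
        by (simp add: exp_add[symmetric] algebra_simps)
      also have "\<dots> \<le> exp (\<epsilon> * (\<bar>S - S'\<bar> + (\<bar>v - v'\<bar> + r))) * (\<integral>z. f' (c' + z) \<partial>?L)"
        using \<epsilon> f'_bounds by (intro mult_right_mono integral_nonneg_AE) auto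
      also have "(\<integral>z. f' (c' + z) \<partial>?L) = ?I h'' cur' v' j"
        using True' by (simp add: batch_noise.simps batch_update_complete f'_def c'_def S'_def)
      finally show ?thesis .
    qed
    let ?e = "exp (\<epsilon> * (\<bar>S - S'\<bar> + (\<bar>v - v'\<bar> + r)))"
    have "weight (p # h) ms (g, cur) = (\<Sum>j=1..N. pmf (batch_arm B (g, cur)) j * pmf (m j) x * ?I h cur v j)"
      by (simp add: p ms)
    also have "\<dots> \<le> (\<Sum>j=1..N. pmf (batch_arm B (g, cur)) j * pmf (m j) x * (?e * ?I h'' cur' v' j))"
      by (intro sum_mono mult_left_mono step) simp
    also have "\<dots> = ?e * weight h' ms (g, cur')"
      by (simp add: h' ms arm sum_distrib_left mult_ac)
    also have "\<bar>v - v'\<bar> + r = (\<Sum>(p, p')\<leftarrow>zip (p # h) h'. \<bar>snd p - snd p'\<bar>)"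
      by (simp add: p h' r_def)
    finally show ?thesis by (simp only: S_def S'_def)
  qed
qed

end

section \<open>Action probabilities of the conversion in closed form\<close>

context batched_bandit
begin

text \<open>During a batch the arm is stored in the state, so an arbitrary state could name an arm
  that is no expert; the probabilities over \<open>{1..N}\<close> would then not sum to 1.\<close>

definition valid_state :: "batch_state \<Rightarrow> bool" where
  "valid_state s \<longleftrightarrow> set_pmf (batch_arm B s) \<subseteq> {1..N}"

lemma valid_state_Nil [simp]: "valid_state (g, [])"
  using bandit_in_distributions_on by (simp add: valid_state_def batch_arm.simps distributions_on_def)

lemma valid_state_update: "valid_state s \<Longrightarrow> j \<in> {1..N} \<Longrightarrow> valid_state (batch_update \<tau> s j v z)"
proof (cases s)
  case (Pair g cur)
  assume "valid_state s" "j \<in> {1..N}"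
  then have "valid_state (g, cur @ [(j, v)])"
    by (cases cur) (auto simp: valid_state_def Pair batch_arm.simps)
  then show ?thesis
    by (cases "Suc (length cur) = \<tau>") (simp_all add: Pair batch_update_complete batch_update_incomplete)
qed

lemma sum_pmf_batch_arm: "valid_state s \<Longrightarrow> (\<Sum>j=1..N. pmf (batch_arm B s) j) = 1"
  unfolding valid_state_def by (intro sum_pmf_eq_1) auto

text \<open>Consistency: summing over the next action gives back the weight of the prefix. This
  makes the quotients that define the conditional algorithm a distribution.\<close>

lemma sum_weight_snoc:
  assumes "length h < length ms" "set ms \<subseteq> advice_tuples K N" "valid_state s"
  shows "(\<Sum>i=1..K. weight (h @ [(i, v i)]) ms s) = weight h ms s"
  using assms
proof (induction h arbitrary: ms s)
  case Nil
  then obtain m ms' where ms: "ms = m # ms'" by (cases ms) auto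
  have m: "m j \<in> distributions_on K" if "j \<in> {1..N}" for j
    using Nil that by (auto simp: ms advice_tuples_def)
  have "(\<Sum>i=1..K. weight ([] @ [(i, v i)]) ms s) = (\<Sum>i=1..K. \<Sum>j=1..N. pmf (batch_arm B s) j * pmf (m j) i)"
    by (simp add: ms)
  also have "\<dots> = (\<Sum>j=1..N. pmf (batch_arm B s) j * (\<Sum>i=1..K. pmf (m j) i))"
    by (subst sum.swap) (simp add: sum_distrib_left)
  also have "\<dots> = 1"
    using sum_pmf_distributions_on[OF m] sum_pmf_batch_arm[OF Nil.prems(3)] by simp
  finally show ?case by simp
next
  case (Cons p h)
  obtain x w where p: "p = (x, w)" by (cases p)
  obtain m ms' where ms: "ms = m # ms'" using Cons.prems by (cases ms) auto
  let ?n = "batch_noise \<tau> \<epsilon> s"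
  have "(\<Sum>i=1..K. weight ((p # h) @ [(i, v i)]) ms s) =
      (\<Sum>j=1..N. \<Sum>i=1..K. pmf (batch_arm B s) j * pmf (m j) x *
        (\<integral>z. weight (h @ [(i, v i)]) ms' (batch_update \<tau> s j w z) \<partial>?n))"
    by (simp add: p ms) (rule sum.swap)
  also have "\<dots> = (\<Sum>j=1..N. pmf (batch_arm B s) j * pmf (m j) x *
        (\<integral>z. weight h ms' (batch_update \<tau> s j w z) \<partial>?n))"
  proof (rule sum.cong[OF refl])
    fix j assume j: "j \<in> {1..N}"
    have "(\<Sum>i=1..K. (\<integral>z. weight (h @ [(i, v i)]) ms' (batch_update \<tau> s j w z) \<partial>?n)) =
        (\<integral>z. (\<Sum>i=1..K. weight (h @ [(i, v i)]) ms' (batch_update \<tau> s j w z)) \<partial>?n)"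
      by (subst Bochner_Integration.integral_sum) (simp_all add: integrable_weight)
    also have "\<dots> = (\<integral>z. weight h ms' (batch_update \<tau> s j w z) \<partial>?n)"
      using Cons.prems j by (intro Bochner_Integration.integral_cong refl Cons.IH valid_state_update) (auto simp: ms)
    finally show "(\<Sum>i=1..K. pmf (batch_arm B s) j * pmf (m j) x *
        (\<integral>z. weight (h @ [(i, v i)]) ms' (batch_update \<tau> s j w z) \<partial>?n)) =
        pmf (batch_arm B s) j * pmf (m j) x * (\<integral>z. weight h ms' (batch_update \<tau> s j w z) \<partial>?n)"
      by (simp add: sum_distrib_left[symmetric])
  qed
  finally show ?case by (simp add: p ms)
qed

abbreviation weight_from :: "(nat \<Rightarrow> nat \<Rightarrow> real) \<Rightarrow> (nat \<Rightarrow> advice) \<Rightarrow> nat \<Rightarrow> nat \<Rightarrow> batch_state \<Rightarrow> nat list \<Rightarrow> real"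
  where "weight_from l \<mu> n t s xs \<equiv> weight (history_from l t xs) (map \<mu> [t..<t + n]) s"

lemma upt_Suc_shift: "[t..<t + Suc n] = t # [Suc t..<Suc t + n]"
  by (simp add: upt_conv_Cons del: upt_Suc)

lemma weight_from_Cons:
  "weight_from l \<mu> (Suc n) t s (x # xs) = (\<Sum>j=1..N. pmf (batch_arm B s) j * pmf (\<mu> t j) x *
     (\<integral>z. weight_from l \<mu> n (Suc t) (batch_update \<tau> s j (l t x) z) xs \<partial>batch_noise \<tau> \<epsilon> s))"
  unfolding upt_Suc_shift by simp

lemma weight_from_sum:
  assumes "valid_state s" "\<And>r j. r \<in> {t..<t + n} \<Longrightarrow> j \<in> {1..N} \<Longrightarrow> \<mu> r j \<in> distributions_on K"
  shows "(\<Sum>xs\<in>action_lists K n. weight_from l \<mu> n t s xs) = 1"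
  using assms
proof (induction n arbitrary: t s)
  case (Suc n)
  let ?n = "batch_noise \<tau> \<epsilon> s"
  have "(\<Sum>xs\<in>action_lists K (Suc n). weight_from l \<mu> (Suc n) t s xs) =
      (\<Sum>x=1..K. \<Sum>xs\<in>action_lists K n. \<Sum>j=1..N. pmf (batch_arm B s) j * pmf (\<mu> t j) x *
        (\<integral>z. weight_from l \<mu> n (Suc t) (batch_update \<tau> s j (l t x) z) xs \<partial>?n))"
    unfolding sum_action_lists_Suc weight_from_Cons ..
  also have "\<dots> = (\<Sum>x=1..K. \<Sum>j=1..N. pmf (batch_arm B s) j * pmf (\<mu> t j) x)"
  proof (intro sum.cong refl)
    fix x
    have "(\<Sum>xs\<in>action_lists K n. \<Sum>j=1..N. pmf (batch_arm B s) j * pmf (\<mu> t j) x *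
        (\<integral>z. weight_from l \<mu> n (Suc t) (batch_update \<tau> s j (l t x) z) xs \<partial>?n)) =
      (\<Sum>j=1..N. pmf (batch_arm B s) j * pmf (\<mu> t j) x * (\<Sum>xs\<in>action_lists K n.
        (\<integral>z. weight_from l \<mu> n (Suc t) (batch_update \<tau> s j (l t x) z) xs \<partial>?n)))"
      by (subst sum.swap) (simp add: sum_distrib_left)
    also have "\<dots> = (\<Sum>j=1..N. pmf (batch_arm B s) j * pmf (\<mu> t j) x * 1)"
    proof (intro sum.cong refl arg_cong2[of _ _ _ _ "(*)"])
      fix j assume j: "j \<in> {1..N}"
      have "(\<Sum>xs\<in>action_lists K n. (\<integral>z. weight_from l \<mu> n (Suc t) (batch_update \<tau> s j (l t x) z) xs \<partial>?n))
         = (\<integral>z. (\<Sum>xs\<in>action_lists K n. weight_from l \<mu> n (Suc t) (batch_update \<tau> s j (l t x) z) xs) \<partial>?n)"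
        by (subst Bochner_Integration.integral_sum) (simp_all add: integrable_weight)
      also have "\<dots> = (\<integral>z. 1 \<partial>?n)"
        using j Suc.prems by (intro Bochner_Integration.integral_cong refl Suc.IH valid_state_update) auto
      finally show "(\<Sum>xs\<in>action_lists K n. (\<integral>z. weight_from l \<mu> n (Suc t) (batch_update \<tau> s j (l t x) z) xs \<partial>?n)) = 1"
        by simp
    qed
    finally show "(\<Sum>xs\<in>action_lists K n. \<Sum>j=1..N. pmf (batch_arm B s) j * pmf (\<mu> t j) x *
        (\<integral>z. weight_from l \<mu> n (Suc t) (batch_update \<tau> s j (l t x) z) xs \<partial>?n)) =
        (\<Sum>j=1..N. pmf (batch_arm B s) j * pmf (\<mu> t j) x)" by simp
  qed
  also have "\<dots> = (\<Sum>j=1..N. pmf (batch_arm B s) j * (\<Sum>x=1..K. pmf (\<mu> t j) x))"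
    by (subst sum.swap) (simp add: sum_distrib_left)
  also have "\<dots> = 1"
    using sum_pmf_distributions_on[OF Suc.prems(2)] sum_pmf_batch_arm[OF Suc.prems(1)] by simp
  finally show ?case .
qed simp

lemma space_eq_UNIV: "sets M = UNIV \<Longrightarrow> space M = UNIV"
  using sets_eq_imp_space_eq[of M "count_space UNIV"] by simp

lemma sets_conversion_from: "sets (conversion_from N \<tau> \<epsilon> B \<mu> l n t s) = UNIV"
proof (induction n arbitrary: t s)
  case (Suc n)
  show ?case
    using Suc.IH by (simp add: space_eq_UNIV sets_bind[where N = "count_space UNIV"])
qed simp

text \<open>Evaluates the monadic definition once and for all; afterwards only finite sums of
  weights remain.\<close>

lemma conversion_from_eq_pmf:
  assumes "valid_state s" "\<And>r j. r \<in> {t..<t + n} \<Longrightarrow> j \<in> {1..N} \<Longrightarrow> \<mu> r j \<in> distributions_on K"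
  shows "\<exists>p. conversion_from N \<tau> \<epsilon> B \<mu> l n t s = measure_pmf p \<and>
    (\<forall>xs. pmf p xs = (if xs \<in> action_lists K n then weight_from l \<mu> n t s xs else 0))"
  using assms
proof (induction n arbitrary: t s)
  case 0
  show ?case by (intro exI[of _ "return_pmf []"]) (auto simp: return_pmf.rep_eq indicator_def)
next
  case (Suc n)
  let ?n = "batch_noise \<tau> \<epsilon> s" and ?C = "conversion_from N \<tau> \<epsilon> B \<mu> l n (Suc t)"
  have "\<exists>p. ?C s' = measure_pmf p \<and>
      (\<forall>xs. pmf p xs = (if xs \<in> action_lists K n then weight_from l \<mu> n (Suc t) s' xs else 0))"
    if "valid_state s'" for s'
    using Suc.prems that by (intro Suc.IH) auto
  then obtain P where P: "\<And>s'. valid_state s' \<Longrightarrow> ?C s' = measure_pmf (P s')"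
    "\<And>s' xs. valid_state s' \<Longrightarrow> pmf (P s') xs = (if xs \<in> action_lists K n then weight_from l \<mu> n (Suc t) s' xs else 0)"
    by metis
  define Q where "Q I j z = map_pmf ((#) (I j)) (P (batch_update \<tau> s j (l t (I j)) z))"
    for I :: "nat \<Rightarrow> nat" and j z
  have valid: "valid_state (batch_update \<tau> s j v z)" if "j \<in> {1..N}" for j v z
    using Suc.prems(1) that by (rule valid_state_update)
  have Q: "?C (batch_update \<tau> s j (l t (I j)) z) \<bind> (\<lambda>xs. return (count_space UNIV) (I j # xs)) = measure_pmf (Q I j z)"
    if "j \<in> {1..N}" for I j z
    unfolding P(1)[OF valid[OF that]] Q_def map_pmf_def measure_pmf_bind return_pmf.rep_eq ..
  have pmf_Q: "pmf (Q I j z) ys = (case ys of [] \<Rightarrow> 0 | x # xs \<Rightarrow>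
      if x = I j \<and> xs \<in> action_lists K n then weight_from l \<mu> n (Suc t) (batch_update \<tau> s j (l t x) z) xs else 0)"
    if "j \<in> {1..N}" for I j z ys
    unfolding Q_def by (cases ys) (auto simp: pmf_map_Cons P(2)[OF valid[OF that]])
  have "\<exists>R. ?n \<bind> (\<lambda>z. measure_pmf (Q I j z)) = measure_pmf R \<and> (\<forall>ys. pmf R ys = (\<integral>z. pmf (Q I j z) ys \<partial>?n))"
    if j: "j \<in> {1..N}" for I j
  proof (rule bind_measure_pmf_finite[OF prob_space_batch_noise])
    show "finite ((#) (I j) ` action_lists K n)" by simp
    show "pmf (Q I j z) ys = 0" if "ys \<notin> (#) (I j) ` action_lists K n" for z ys
      using that unfolding pmf_Q[OF j] by (auto split: list.split)
    show "(\<lambda>z. pmf (Q I j z) ys) \<in> borel_measurable ?n" for ys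
      unfolding pmf_Q[OF j] by (cases ys) auto
  qed
  then have ex: "\<forall>I. \<forall>j\<in>{1..N}. \<exists>R. ?n \<bind> (\<lambda>z. measure_pmf (Q I j z)) = measure_pmf R \<and>
      (\<forall>ys. pmf R ys = (\<integral>z. pmf (Q I j z) ys \<partial>?n))"
    by blast
  define R where "R I j = (SOME R. ?n \<bind> (\<lambda>z. measure_pmf (Q I j z)) = measure_pmf R \<and>
      (\<forall>ys. pmf R ys = (\<integral>z. pmf (Q I j z) ys \<partial>?n)))" for I j
  have R: "?n \<bind> (\<lambda>z. measure_pmf (Q I j z)) = measure_pmf (R I j)"
    "pmf (R I j) ys = (\<integral>z. pmf (Q I j z) ys \<partial>?n)" if "j \<in> {1..N}" for I j ys
    using someI_ex[OF ex[rule_format, OF that, of I]] unfolding R_def[symmetric] by blast+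
  define p where "p = bind_pmf (Pi_pmf {1..N} undefined (\<mu> t)) (\<lambda>I. bind_pmf (batch_arm B s) (R I))"
  have "conversion_from N \<tau> \<epsilon> B \<mu> l (Suc n) t s = measure_pmf p"
    unfolding conversion_from.simps p_def measure_pmf_bind
  \<comment> \<open>For arms outside \<open>{1..N}\<close> the continuation is not known to be a
    pmf; there only its sigma-algebra is compared.\<close>
  proof (rule arg_cong2[of _ _ _ _ bind], rule refl, rule ext, rule bind_measure_pmf_cong_sets)
    fix I j assume "j \<in> set_pmf (batch_arm B s)"
    then have j: "j \<in> {1..N}" using Suc.prems(1) by (auto simp: valid_state_def)
    show "?n \<bind> (\<lambda>z. ?C (batch_update \<tau> s j (l t (I j)) z) \<bind> (\<lambda>xs. return (count_space UNIV) (I j # xs)))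
        = measure_pmf (R I j)"
      unfolding Q[OF j] by (rule R(1)[OF j])
  next
    fix I j
    show "sets (?n \<bind> (\<lambda>z. ?C (batch_update \<tau> s j (l t (I j)) z) \<bind> (\<lambda>xs. return (count_space UNIV) (I j # xs))))
        = sets (measure_pmf (R I j))"
      by (simp add: space_eq_UNIV sets_conversion_from sets_bind[where N = "count_space UNIV"])
  qed
  moreover have "pmf p ys = (if ys \<in> action_lists K (Suc n) then weight_from l \<mu> (Suc n) t s ys else 0)" for ys
  proof (cases ys)
    case Nil
    have "pmf (R I j) [] = 0" if "j \<in> set_pmf (batch_arm B s)" for I j
      using that Suc.prems(1) by (subst R(2)) (auto simp: valid_state_def pmf_Q subset_iff)
    then have "pmf p [] = 0"
      by (auto simp: p_def pmf_eq_0_set_pmf)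
    then show ?thesis by (simp add: Nil)
  next
    case ys: (Cons x xs)
    define c where "c j = (if xs \<in> action_lists K n then
      (\<integral>z. weight_from l \<mu> n (Suc t) (batch_update \<tau> s j (l t x) z) xs \<partial>?n) else 0)" for j
    have "pmf (bind_pmf (batch_arm B s) (R I)) ys = (\<Sum>j=1..N. pmf (batch_arm B s) j * c j * indicator {I. I j = x} I)" for I
    proof -
      have "pmf (bind_pmf (batch_arm B s) (R I)) ys = (\<Sum>j=1..N. pmf (R I j) ys * pmf (batch_arm B s) j)"
        unfolding pmf_bind using Suc.prems(1)
        by (intro integral_measure_pmf_real) (auto simp: valid_state_def)
      also have "\<dots> = (\<Sum>j=1..N. pmf (batch_arm B s) j * c j * indicator {I. I j = x} I)"
        by (intro sum.cong refl) (auto simp: R(2) pmf_Q ys c_def indicator_def)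
      finally show ?thesis .
    qed
    then have "pmf p ys = (\<integral>I. (\<Sum>j=1..N. pmf (batch_arm B s) j * c j * indicator {I. I j = x} I)
        \<partial>measure_pmf (Pi_pmf {1..N} undefined (\<mu> t)))"
      unfolding p_def pmf_bind[of "Pi_pmf _ _ _"] by simp
    also have "\<dots> = (\<Sum>j=1..N. pmf (batch_arm B s) j * c j *
        measure_pmf.prob (Pi_pmf {1..N} undefined (\<mu> t)) {I. I j = x})"
      by (subst Bochner_Integration.integral_sum) (auto simp: measure_pmf.emeasure_eq_measure)
    \<comment> \<open>Tuple and arm are drawn independently, and only coordinate \<open>j\<close> of
      the tuple is ever seen, so the tuple contributes its marginal
      \<open>\<mu> t j\<close>.\<close>
    also have "\<dots> = (\<Sum>j=1..N. pmf (batch_arm B s) j * c j * pmf (\<mu> t j) x)"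
    proof (intro sum.cong refl arg_cong2[of _ _ _ _ "(*)"])
      fix j assume "j \<in> {1..N}"
      then have "pmf (\<mu> t j) x = pmf (map_pmf (\<lambda>I. I j) (Pi_pmf {1..N} undefined (\<mu> t))) x"
        by (subst Pi_pmf_component) auto
      also have "\<dots> = measure_pmf.prob (Pi_pmf {1..N} undefined (\<mu> t)) {I. I j = x}"
        by (simp add: pmf_map vimage_def)
      finally show "measure_pmf.prob (Pi_pmf {1..N} undefined (\<mu> t)) {I. I j = x} = pmf (\<mu> t j) x" ..
    qed
    also have "\<dots> = (if ys \<in> action_lists K (Suc n) then weight_from l \<mu> (Suc n) t s ys else 0)"
    proof (cases "ys \<in> action_lists K (Suc n)")
      case True
      then have xs: "xs \<in> action_lists K n" by (simp add: ys)
      have "(\<Sum>j=1..N. pmf (batch_arm B s) j * c j * pmf (\<mu> t j) x) = weight_from l \<mu> (Suc n) t s (x # xs)"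
        unfolding weight_from_Cons using xs by (intro sum.cong refl) (simp add: c_def)
      with True show ?thesis by (simp add: ys)
    next
      case False
      then have "x \<notin> {1..K} \<or> xs \<notin> action_lists K n" by (simp add: ys)
      then have "c j * pmf (\<mu> t j) x = 0" if "j \<in> {1..N}" for j
        using pmf_distributions_on_eq_0[OF Suc.prems(2)[of t j]] that by (auto simp: c_def)
      then have "(\<Sum>j=1..N. pmf (batch_arm B s) j * c j * pmf (\<mu> t j) x) = 0"
        by (intro sum.neutral) (auto simp: mult.assoc)
      with False show ?thesis by simp
    qed
    finally show ?thesis .
  qed
  ultimately show ?case by blast
qed

section \<open>The conditional law as an algorithm\<close>

text \<open>The loss 0 of the appended action is a dummy, since the algorithm does not know that
  loss yet. Action 1 is the default on malformed or impossible histories.\<close>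

definition conditional_algorithm :: "nat \<Rightarrow> expert_algorithm" where
  "conditional_algorithm K h ms =
     (if fst ` set h \<subseteq> {1..K} \<and> set ms \<subseteq> advice_tuples K N \<and> length ms = Suc (length h) \<and> weight h ms ([], []) > 0
      then SOME p. \<forall>i. pmf p i = (if i \<in> {1..K} then weight (h @ [(i, 0)]) ms ([], []) / weight h ms ([], []) else 0)
      else return_pmf 1)"

text \<open>The last loss affects only the state after the last action, where the weight is 1 in any
  case.\<close>

lemma weight_last_loss_irrelevant:
  "weight (h @ [(i, v)]) ms s = weight (h @ [(i, v')]) ms s"
proof (induction h arbitrary: ms s)
  case Nil
  show ?case by (cases ms) auto
next
  case (Cons p h)
  show ?case
  proof (cases ms)
    case (Cons m ms')
    then show ?thesis using Cons.IH by (cases p) (simp add: Cons.IH)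
  qed (cases p, simp)
qed

lemma pmf_conditional_algorithm:
  assumes "fst ` set h \<subseteq> {1..K}" "set ms \<subseteq> advice_tuples K N" "length ms = Suc (length h)" "weight h ms ([], []) > 0"
  shows "pmf (conditional_algorithm K h ms) i =
    (if i \<in> {1..K} then weight (h @ [(i, v)]) ms ([], []) / weight h ms ([], []) else 0)"
proof -
  let ?f = "\<lambda>i. weight (h @ [(i, 0)]) ms ([], []) / weight h ms ([], [])"
  have "(\<Sum>i=1..K. ?f i) = 1"
    using sum_weight_snoc[of h ms K "([], [])" "\<lambda>_. 0"] assms by (simp add: sum_divide_distrib[symmetric])
  then have "\<exists>p. \<forall>i. pmf p i = (if i \<in> {1..K} then ?f i else 0)"
    by (intro exists_pmf_finite_support) (auto simp: weight_nonneg)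
  then have "\<forall>i. pmf (conditional_algorithm K h ms) i = (if i \<in> {1..K} then ?f i else 0)"
    unfolding conditional_algorithm_def using assms by (simp only: if_True conj_absorb simp_thms) (rule someI_ex)
  then show ?thesis using weight_last_loss_irrelevant[of h i v ms _ 0] by simp
qed

lemma is_expert_algorithm_conditional:
  assumes "K \<ge> 1"
  shows "is_expert_algorithm K N (conditional_algorithm K)"
  unfolding is_expert_algorithm_def
proof (intro allI impI)
  fix h :: "(nat \<times> real) list" and ms :: "advice list"
  assume *: "fst ` set h \<subseteq> {1..K} \<and> set ms \<subseteq> advice_tuples K N \<and> length ms = Suc (length h)"
  show "conditional_algorithm K h ms \<in> distributions_on K"
  proof (cases "weight h ms ([], []) > 0")
    case True
    then show ?thesis
      using pmf_conditional_algorithm[of h K ms] *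
      by (fastforce simp: distributions_on_def set_pmf_iff split: if_splits)
  next
    case False
    then show ?thesis using assms by (simp add: conditional_algorithm_def distributions_on_def)
  qed
qed

end

section \<open>Law of the played actions and differential privacy\<close>

lemma measure_pmf_finite_support:
  assumes "finite S" "\<And>x. x \<notin> S \<Longrightarrow> pmf p x = 0"
  shows "measure_pmf.prob p E = (\<Sum>x\<in>E \<inter> S. pmf p x)"
proof -
  have "measure_pmf.prob p E = measure_pmf.prob p (E \<inter> S)"
    using assms(2) by (intro measure_pmf.finite_measure_eq_AE AE_pmfI) (auto simp: set_pmf_eq)
  then show ?thesis using assms(1) by (simp add: measure_measure_pmf_finite)
qed

lemma pmf_map_snoc:
  "pmf (map_pmf (\<lambda>i. xs @ [i]) p) (ys @ [i]) = (if xs = ys then pmf p i else 0)"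
  "pmf (map_pmf (\<lambda>i. xs @ [i]) p) [] = 0"
proof -
  show "pmf (map_pmf (\<lambda>i. xs @ [i]) p) (ys @ [i]) = (if xs = ys then pmf p i else 0)"
  proof (cases "xs = ys")
    case True
    then show ?thesis using pmf_map_inj'[of "\<lambda>i. ys @ [i]" p i] by (simp add: inj_on_def)
  qed (auto intro!: pmf_map_outside)
  show "pmf (map_pmf (\<lambda>i. xs @ [i]) p) [] = 0"
    by (intro pmf_map_outside) auto
qed

text \<open>Along one common action sequence, neighbouring losses differ only in round
  \<open>t\<^sub>0\<close>; this is the sensitivity that \<open>weight_private\<close>
  consumes.\<close>

lemma sum_history_diff_le:
  assumes "\<And>s. s \<in> {t..<t + length xs} \<Longrightarrow> s \<noteq> t\<^sub>0 \<Longrightarrow> l s = l' s"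
    "t\<^sub>0 \<in> {t..<t + length xs} \<Longrightarrow> (\<And>i. i \<in> set xs \<Longrightarrow> \<bar>l t\<^sub>0 i - l' t\<^sub>0 i\<bar> \<le> 1)"
  shows "(\<Sum>(p, p')\<leftarrow>zip (history_from l t xs) (history_from l' t xs). \<bar>snd p - snd p'\<bar>)
    \<le> (if t\<^sub>0 \<in> {t..<t + length xs} then 1 else (0::real))"
  using assms
proof (induction xs arbitrary: t)
  case (Cons x xs)
  have IH: "(\<Sum>(p, p')\<leftarrow>zip (history_from l (Suc t) xs) (history_from l' (Suc t) xs). \<bar>snd p - snd p'\<bar>)
    \<le> (if t\<^sub>0 \<in> {Suc t..<Suc t + length xs} then 1 else 0)"
    using Cons.prems by (intro Cons.IH) auto
  show ?case
  proof (cases "t\<^sub>0 = t")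
    case True
    then show ?thesis using IH Cons.prems(2)[of x] by simp
  next
    case False
    then show ?thesis using IH Cons.prems(1)[of t] by (auto split: if_splits)
  qed
qed simp

context batched_bandit
begin

lemma weight_append_advice:
  "length h \<le> length ms \<Longrightarrow> weight h (ms @ ms') s = weight h ms s"
proof (induction h arbitrary: ms s)
  case (Cons p h)
  then show ?case by (cases p; cases ms) simp_all
qed simp

lemma weight_from_Suc:
  "length xs \<le> n \<Longrightarrow> weight_from l \<mu> (Suc n) t s xs = weight_from l \<mu> n t s xs"
  using weight_append_advice[of "history_from l t xs" "map \<mu> [t..<t + n]" "[\<mu> (t + n)]"] by simp

text \<open>Impossible prefixes stay impossible, so the default distribution chosen there never
  influences \<open>play\<close>.\<close>

lemma weight_snoc_eq_0:
  assumes "weight h ms s = 0" "length h < length ms" "set ms \<subseteq> advice_tuples K N" "valid_state s" "i \<in> {1..K}"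
  shows "weight (h @ [(i, v)]) ms s = 0"
proof -
  have "weight (h @ [(i, v)]) ms s \<le> (\<Sum>i=1..K. weight (h @ [(i, v)]) ms s)"
    using assms(5) by (intro member_le_sum) (auto simp: weight_nonneg)
  also have "\<dots> = 0"
    using sum_weight_snoc[OF assms(2-4), of "\<lambda>_. v"] assms(1) by simp
  finally show ?thesis using weight_nonneg[of "h @ [(i, v)]" ms s] by simp
qed

lemma snoc_in_action_lists: "xs @ [i] \<in> action_lists K (Suc n) \<longleftrightarrow> i \<in> {1..K} \<and> xs \<in> action_lists K n"
  by (auto simp: action_lists_def)

text \<open>Chain rule: the quotients of consecutive weights telescope to the weight of the whole
  sequence.\<close>

lemma pmf_play_conditional_algorithm:
  assumes "\<And>r. r \<in> {1..T} \<Longrightarrow> \<mu> r \<in> advice_tuples K N"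
  shows "pmf (play (conditional_algorithm K) \<mu> l T) xs =
    (if xs \<in> action_lists K T then weight_from l \<mu> T 1 ([], []) xs else 0)"
  using assms
proof (induction T arbitrary: xs)
  case 0
  show ?case by (auto simp: indicator_def)
next
  case (Suc T)
  let ?A = "conditional_algorithm K" and ?ms = "map \<mu> [1..<1 + Suc T]"
  have IH: "pmf (play ?A \<mu> l T) xs = (if xs \<in> action_lists K T then weight_from l \<mu> T 1 ([], []) xs else 0)" for xs
    using Suc.prems by (intro Suc.IH) auto
  have play: "play ?A \<mu> l (Suc T) = bind_pmf (play ?A \<mu> l T)
      (\<lambda>xs. map_pmf (\<lambda>i. xs @ [i]) (?A (history_from l 1 xs) ?ms))"
    by (simp add: map_pmf_def history_eq_history_from)
  have ms: "set ?ms \<subseteq> advice_tuples K N"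
    using Suc.prems by (auto simp del: upt_Suc)
  have "pmf (play ?A \<mu> l (Suc T)) xs = (\<Sum>ys\<in>action_lists K T.
      pmf (map_pmf (\<lambda>i. ys @ [i]) (?A (history_from l 1 ys) ?ms)) xs * pmf (play ?A \<mu> l T) ys)"
    unfolding play pmf_bind
    by (intro integral_measure_pmf_real) (auto simp: set_pmf_eq IH split: if_splits)
  also have "\<dots> = (if xs \<in> action_lists K (Suc T) then weight_from l \<mu> (Suc T) 1 ([], []) xs else 0)"
  proof (cases xs rule: rev_cases)
    case Nil
    then show ?thesis by (simp add: pmf_map_snoc)
  next
    case xs: (snoc ys i)
    let ?h = "history_from l 1 ys"
    have "(\<Sum>zs\<in>action_lists K T. pmf (map_pmf (\<lambda>i. zs @ [i]) (?A (history_from l 1 zs) ?ms)) xs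
        * pmf (play ?A \<mu> l T) zs) =
      (\<Sum>zs\<in>action_lists K T. if zs = ys then pmf (?A ?h ?ms) i * pmf (play ?A \<mu> l T) ys else 0)"
      by (intro sum.cong refl) (simp add: xs pmf_map_snoc del: upt_Suc)
    also have "\<dots> = (if ys \<in> action_lists K T then pmf (?A ?h ?ms) i * pmf (play ?A \<mu> l T) ys else 0)"
      by simp
    also have "\<dots> = (if xs \<in> action_lists K (Suc T) then weight_from l \<mu> (Suc T) 1 ([], []) xs else 0)"
    proof (cases "ys \<in> action_lists K T")
      case True
      then have len: "length ys = T" and acts: "set ys \<subseteq> {1..K}" by (auto simp: action_lists_def)
      have fst: "fst ` set ?h \<subseteq> {1..K}"
        using acts by (metis list.set_map map_fst_history_from)
      \<comment> \<open>\<open>?ms\<close> already contains the advice of the round about to be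
        played, one entry more than \<open>ys\<close> has; the surplus leaves the weight
        unchanged.\<close>
      have w: "pmf (play ?A \<mu> l T) ys = weight ?h ?ms ([], [])"
        using weight_from_Suc[where xs = ys and n = T and t = 1] True by (simp add: IH len del: upt_Suc)
      have h: "history_from l 1 xs = ?h @ [(i, l (1 + length ys) i)]"
        unfolding xs by (rule history_from_snoc)
      show ?thesis
      proof (cases "weight ?h ?ms ([], []) > 0")
        case pos: True
        then show ?thesis
          using pmf_conditional_algorithm[OF fst ms _ pos, of i "l (1 + length ys) i"] True
          unfolding h w by (simp add: xs snoc_in_action_lists len del: upt_Suc)
      next
        case False
        then have zero: "weight ?h ?ms ([], []) = 0" using weight_nonneg[of ?h ?ms "([], [])"] by linarith
        have "weight (history_from l 1 xs) ?ms ([], []) = 0" if "i \<in> {1..K}"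
          unfolding h using zero ms that by (intro weight_snoc_eq_0[where K = K]) (auto simp: len)
        then show ?thesis unfolding w zero by (simp add: xs snoc_in_action_lists del: upt_Suc)
      qed
    next
      case False
      then show ?thesis by (simp add: xs snoc_in_action_lists)
    qed
    finally show ?thesis .
  qed
  finally show ?case .
qed

lemma differentially_private_conditional_algorithm:
  "differentially_private \<epsilon> K N (conditional_algorithm K)"
  unfolding differentially_private_def
proof (intro allI ballI impI)
  fix T :: nat and \<mu> :: "nat \<Rightarrow> advice" and l l' :: "nat \<Rightarrow> nat \<Rightarrow> real" and E
  assume \<mu>: "\<mu> \<in> {1..T} \<rightarrow>\<^sub>E advice_tuples K N"
    and l: "l \<in> {1..T} \<rightarrow>\<^sub>E ({1..K} \<rightarrow>\<^sub>E {0..1})" "l' \<in> {1..T} \<rightarrow>\<^sub>E ({1..K} \<rightarrow>\<^sub>E {0..1})"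
    and diff: "\<exists>!t. t \<in> {1..T} \<and> l t \<noteq> l' t"
  obtain t\<^sub>0 where t\<^sub>0: "t\<^sub>0 \<in> {1..T}" "\<And>s. s \<in> {1..T} \<Longrightarrow> s \<noteq> t\<^sub>0 \<Longrightarrow> l s = l' s"
    using diff by auto
  have \<mu>': "\<mu> r \<in> advice_tuples K N" if "r \<in> {1..T}" for r
    using \<mu> that by auto
  have le: "weight_from l \<mu> T 1 ([], []) xs \<le> exp \<epsilon> * weight_from l' \<mu> T 1 ([], []) xs"
    if xs: "xs \<in> action_lists K T" for xs
  proof -
    have len: "length xs = T" "set xs \<subseteq> {1..K}" using xs by (auto simp: action_lists_def)
    have "\<bar>l t\<^sub>0 i - l' t\<^sub>0 i\<bar> \<le> 1" if "i \<in> set xs" for i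
    proof -
      have "i \<in> {1..K}" using that len(2) by blast
      then have "l t\<^sub>0 i \<in> {0..1}" "l' t\<^sub>0 i \<in> {0..1}"
        by (rule PiE_mem[OF PiE_mem[OF l(1) t\<^sub>0(1)]], rule PiE_mem[OF PiE_mem[OF l(2) t\<^sub>0(1)]])
      then show ?thesis by auto
    qed
    then have "(\<Sum>(p, p')\<leftarrow>zip (history_from l 1 xs) (history_from l' 1 xs). \<bar>snd p - snd p'\<bar>)
      \<le> (if t\<^sub>0 \<in> {1..<1 + length xs} then 1 else (0::real))"
      using t\<^sub>0(2) by (intro sum_history_diff_le) (auto simp: len)
    also have "\<dots> \<le> 1" by simp
    finally have "exp (\<epsilon> * (\<Sum>(p, p')\<leftarrow>zip (history_from l 1 xs) (history_from l' 1 xs). \<bar>snd p - snd p'\<bar>)) \<le> exp \<epsilon>"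
      using \<epsilon> by (simp add: mult_le_cancel_left1)
    then have "exp (\<epsilon> * (\<Sum>(p, p')\<leftarrow>zip (history_from l 1 xs) (history_from l' 1 xs). \<bar>snd p - snd p'\<bar>))
        * weight_from l' \<mu> T 1 ([], []) xs \<le> exp \<epsilon> * weight_from l' \<mu> T 1 ([], []) xs"
      by (intro mult_right_mono weight_nonneg)
    then show ?thesis
      using weight_private[of "history_from l 1 xs" "history_from l' 1 xs" "[]" "[]" "map \<mu> [1..<1 + T]" "[]"]
      by simp
  qed
  have pmf_play: "pmf (play (conditional_algorithm K) \<mu> l T) xs =
      (if xs \<in> action_lists K T then weight_from l \<mu> T 1 ([], []) xs else 0)" for l xs
    by (intro pmf_play_conditional_algorithm \<mu>')
  have prob: "measure_pmf.prob (play (conditional_algorithm K) \<mu> l T) E =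
      (\<Sum>xs\<in>E \<inter> action_lists K T. weight_from l \<mu> T 1 ([], []) xs)" for l
    by (subst measure_pmf_finite_support[OF finite_action_lists[of K T]])
      (simp_all add: pmf_play del: upt_Suc)
  show "measure_pmf.prob (play (conditional_algorithm K) \<mu> l T) E \<le>
      exp \<epsilon> * measure_pmf.prob (play (conditional_algorithm K) \<mu> l' T) E"
    unfolding prob sum_distrib_left by (intro sum_mono le) auto
qed

text \<open>Numerator and denominator of the conditional probability are weights of
  \<open>xs\<close> with and without one further action. Since weights accept arbitrary real losses
  in the history, this covers all real-valued loss functions.\<close>

lemma conditional_law_of_conditional_algorithm:
  "conditional_law_of K N (\<lambda>\<mu> l T. conversion_from N \<tau> \<epsilon> B \<mu> l T 1 ([], [])) (conditional_algorithm K)"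
  unfolding conditional_law_of_def
proof (intro allI ballI)
  fix t :: nat and \<mu> :: "nat \<Rightarrow> advice" and l :: "nat \<Rightarrow> nat \<Rightarrow> real"
  assume \<mu>: "\<mu> \<in> {1..Suc t} \<rightarrow>\<^sub>E advice_tuples K N"
  let ?P = "conversion_from N \<tau> \<epsilon> B \<mu> l (Suc t) 1 ([], [])"
  let ?ms = "map \<mu> [1..<1 + Suc t]"
  have ms: "set ?ms \<subseteq> advice_tuples K N"
    using \<mu> by (auto simp del: upt_Suc)
  obtain p where p: "?P = measure_pmf p"
    "\<And>xs. pmf p xs = (if xs \<in> action_lists K (Suc t) then weight_from l \<mu> (Suc t) 1 ([], []) xs else 0)"
    using conversion_from_eq_pmf[of "([], [])" 1 "Suc t" \<mu> K l] \<mu>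
    by (fastforce simp: advice_tuples_def simp del: upt_Suc dest: PiE_mem)
  have prob: "measure_pmf.prob p E = (\<Sum>xs\<in>E \<inter> action_lists K (Suc t). weight_from l \<mu> (Suc t) 1 ([], []) xs)" for E
    by (subst measure_pmf_finite_support[OF finite_action_lists[of K "Suc t"]]) (simp_all add: p(2) del: upt_Suc)
  have "pmf (conditional_algorithm K (history l xs) (map \<mu> [1..<Suc (Suc t)])) i =
      \<P>(w in ?P. w ! t = i \<bar> take t w = xs)"
    if xs: "length xs = t" "set xs \<subseteq> {1..K}" and pos: "\<P>(w in ?P. take t w = xs) > 0" for xs i
  proof -
    let ?h = "history_from l 1 xs"
    have fst: "fst ` set ?h \<subseteq> {1..K}"
      using xs(2) by (metis list.set_map map_fst_history_from)
    have decomp: "w = xs @ [w ! t]" if "length w = Suc t" "take t w = xs" for w :: "nat list"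
      using that by (metis lessI order_refl take_Suc_conv_app_nth take_all)
    have h: "history_from l 1 (xs @ [i]) = ?h @ [(i, l (1 + t) i)]" for i
      using history_from_snoc[of l 1 xs i] by (simp add: xs(1))
    have w: "measure_pmf.prob p {w. w ! t = i \<and> take t w = xs} =
        (if i \<in> {1..K} then weight (?h @ [(i, l (1 + t) i)]) ?ms ([], []) else 0)" for i
    proof -
      have "{w. w ! t = i \<and> take t w = xs} \<inter> action_lists K (Suc t) = (if i \<in> {1..K} then {xs @ [i]} else {})"
        using decomp xs by (auto simp: action_lists_def nth_append) (metis in_set_conv_nth lessI subsetD atLeastAtMost_iff)+
      then show ?thesis unfolding prob h[symmetric] by simp
    qed
    have "{w. take t w = xs} \<inter> action_lists K (Suc t) = (\<lambda>i. xs @ [i]) ` {1..K}"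
      using decomp xs by (auto simp: action_lists_def image_iff) (metis in_set_conv_nth lessI subsetD atLeastAtMost_iff)
    then have "measure_pmf.prob p {w. take t w = xs} = (\<Sum>i=1..K. weight (?h @ [(i, l (1 + t) i)]) ?ms ([], []))"
      unfolding prob by (simp add: sum.reindex inj_on_def history_from_snoc xs(1) del: upt_Suc)
    also have "\<dots> = weight ?h ?ms ([], [])"
      using ms by (intro sum_weight_snoc) (auto simp: xs(1))
    finally have w': "measure_pmf.prob p {w. take t w = xs} = weight ?h ?ms ([], [])" .
    have "weight ?h ?ms ([], []) > 0"
      using pos unfolding p(1) w'[symmetric] by simp
    then have "pmf (conditional_algorithm K ?h ?ms) i =
        (if i \<in> {1..K} then weight (?h @ [(i, l (1 + t) i)]) ?ms ([], []) / weight ?h ?ms ([], []) else 0)"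
      by (intro pmf_conditional_algorithm[OF fst ms]) (simp_all add: xs(1))
    also have "\<dots> = measure_pmf.prob p {w. w ! t = i \<and> take t w = xs} / measure_pmf.prob p {w. take t w = xs}"
      unfolding w w' by simp
    finally show ?thesis
      unfolding p(1) cond_prob_def history_eq_history_from by simp
  qed
  then show "prob_space ?P \<and> (\<forall>xs. length xs = t \<and> set xs \<subseteq> {1..K} \<and> \<P>(w in ?P. take t w = xs) > 0 \<longrightarrow>
      (\<forall>i. pmf (conditional_algorithm K (history l xs) (map \<mu> [1..<Suc (Suc t)])) i =
        \<P>(w in ?P. w ! t = i \<bar> take t w = xs)))"
    using prob_space_measure_pmf[of p] p(1) by auto
qed

end

section \<open>Expected loss of HTINF on noisy batches\<close>

text \<open>Isolates the vector of accumulated estimates: the next distribution depends on the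
  history only through this vector and the length.\<close>

fun htinf_loss :: "nat \<Rightarrow> real \<Rightarrow> nat \<Rightarrow> (nat \<Rightarrow> real) \<Rightarrow> (nat \<times> real) list \<Rightarrow> nat \<Rightarrow> real" where
  "htinf_loss N \<sigma> t L [] = L"
| "htinf_loss N \<sigma> t L ((J, v) # h) = htinf_loss N \<sigma> (Suc t)
     (\<lambda>j. L j + htinf_estimate \<sigma> t (htinf_distribution N \<sigma> t L) J v j) h"

lemma htinf_from_eq: "htinf_from N \<sigma> t L h = htinf_distribution N \<sigma> (t + length h) (htinf_loss N \<sigma> t L h)"
  by (induction N \<sigma> t L h rule: htinf_loss.induct) auto

lemma htinf_loss_snoc: "htinf_loss N \<sigma> t L (h @ [(J, v)]) = (\<lambda>j. htinf_loss N \<sigma> t L h j +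
    htinf_estimate \<sigma> (t + length h) (htinf_distribution N \<sigma> (t + length h) (htinf_loss N \<sigma> t L h)) J v j)"
  by (induction N \<sigma> t L h rule: htinf_loss.induct) auto

definition skip_factor :: real where
  "skip_factor = 1 - 2 powr (- 1 / 3)"

lemma skip_factor_pos: "skip_factor > 0"
proof -
  have "(2::real) powr (- 1 / 3) < 2 powr 0" by (intro powr_less_mono) auto
  then show ?thesis by (simp add: skip_factor_def)
qed

text \<open>An estimate that survives skipping thereby satisfies the smallness hypothesis of
  \<open>htinf_value_shift_ge\<close>, for losses of either sign.\<close>

lemma skip_factor_le: "skip_factor \<le> 1 / 2"
proof -
  have "(2::real) powr - 1 \<le> 2 powr (- 1 / 3)" by (intro powr_mono) auto
  then show ?thesis by (simp add: skip_factor_def powr_minus)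
qed

lemma htinf_estimate_eq: "htinf_estimate \<sigma> t x J v j = (if j = J then
    (if \<bar>v\<bar> \<le> skip_factor * \<sigma> * sqrt t * sqrt (pmf x J) then v / pmf x J else 0) else 0)"
  by (auto simp: htinf_estimate_def skip_factor_def Let_def)

text \<open>Induction from the right, because the newest estimate is a function of the newest loss
  and of a distribution that is measurable in the earlier accumulated estimates.\<close>

lemma measurable_bandit_htinf:
  assumes "N \<ge> 1" "\<sigma> > 0"
  shows "measurable_bandit N (htinf N \<sigma>)"
  unfolding measurable_bandit_def
proof (intro conjI allI)
  fix g
  show "htinf N \<sigma> g \<in> distributions_on N"
    unfolding htinf_def htinf_from_eq using assms by (intro htinf_distribution_in) auto
next
  fix js and i :: nat
  have meas: "(\<lambda>v. htinf_loss N \<sigma> 1 (\<lambda>_. 0) (with_losses js v)) \<in> borel_measurable borel"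
  proof (induction js rule: rev_induct)
    case Nil
    show ?case by (simp add: with_losses_def)
  next
    case (snoc J js)
    note [measurable] = snoc
    let ?x = "\<lambda>v. htinf_distribution N \<sigma> (1 + length js) (htinf_loss N \<sigma> 1 (\<lambda>_. 0) (with_losses js v))"
    have [measurable]: "(\<lambda>v. pmf (?x v) J) \<in> borel_measurable borel"
      using assms by (intro measurable_compose[OF snoc] pmf_htinf_distribution_measurable) auto
    have len: "length (with_losses js v) = length js" for v
      by (simp add: with_losses_def)
    have [measurable]: "(\<lambda>v. htinf_loss N \<sigma> 1 (\<lambda>_. 0) (with_losses js v) j) \<in> borel_measurable borel" for j
      by (intro measurable_compose[OF snoc] measurable_product_coordinates)
    have "(\<lambda>v. htinf_loss N \<sigma> 1 (\<lambda>_. 0) (with_losses (js @ [J]) v) j) \<in> borel_measurable borel" for j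
    proof (cases "j = J")
      case True
      have [measurable]: "(\<lambda>v :: nat \<Rightarrow> real. v k) \<in> borel_measurable borel" for k
        by (rule measurable_product_coordinates)
      show ?thesis
        unfolding with_losses_snoc htinf_loss_snoc htinf_estimate_eq len True by measurable
    next
      case False
      show ?thesis
        unfolding with_losses_snoc htinf_loss_snoc htinf_estimate_eq if_not_P[OF False] by measurable
    qed
    then show ?case
      by (intro measurable_coordinatewise_then_product)
  qed
  have "htinf N \<sigma> (with_losses js v) = htinf_distribution N \<sigma> (1 + length js) (htinf_loss N \<sigma> 1 (\<lambda>_. 0) (with_losses js v))" for v
    unfolding htinf_def htinf_from_eq by (simp add: with_losses_def)
  then show "(\<lambda>v. pmf (htinf N \<sigma> (with_losses js v)) i) \<in> borel_measurable borel"
    using assms by (simp only:) (intro measurable_compose[OF meas] pmf_htinf_distribution_measurable, auto)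
qed

section \<open>Dynamic programming for the expected loss\<close>

text \<open>The bounds are required in all rounds, which frees the inductions from tracking the
  horizon; sequences on \<open>{1..T}\<close> are extended before use.\<close>

locale bounded_losses = batched_bandit +
  fixes K :: nat and \<mu> :: "nat \<Rightarrow> advice" and l :: "nat \<Rightarrow> nat \<Rightarrow> real"
  assumes \<mu>: "\<And>r j. j \<in> {1..N} \<Longrightarrow> \<mu> r j \<in> distributions_on K"
    and l: "\<And>r i. i \<in> {1..K} \<Longrightarrow> l r i \<in> {0..1}"
begin

definition expected_loss :: "nat \<Rightarrow> nat \<Rightarrow> batch_state \<Rightarrow> real" where
  "expected_loss n t s = (\<Sum>xs\<in>action_lists K n. weight_from l \<mu> n t s xs * (\<Sum>k<n. l (t + k) (xs ! k)))"

text \<open>The value of choosing \<open>j\<close> in round \<open>t\<close> and continuing as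
  usual. It covers \<open>n + 1\<close> rounds: round \<open>t\<close> and the \<open>n\<close>
  rounds after it.\<close>

definition arm_loss :: "nat \<Rightarrow> nat \<Rightarrow> batch_state \<Rightarrow> nat \<Rightarrow> real" where
  "arm_loss n t s j = (\<Sum>i=1..K. pmf (\<mu> t j) i * (l t i +
     (\<integral>z. expected_loss n (Suc t) (batch_update \<tau> s j (l t i) z) \<partial>batch_noise \<tau> \<epsilon> s)))"

definition mean_loss :: "nat \<Rightarrow> nat \<Rightarrow> real" where
  "mean_loss t j = (\<Sum>i=1..K. pmf (\<mu> t j) i * l t i)"

lemma integrable_expected_loss:
  "integrable (batch_noise \<tau> \<epsilon> s) (\<lambda>z. expected_loss n t (batch_update \<tau> s' j v z))"
  unfolding expected_loss_def
  by (intro Bochner_Integration.integrable_sum integrable_mult_left integrable_weight)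

lemma expected_loss_le:
  assumes "valid_state s"
  shows "expected_loss n t s \<le> n"
proof -
  have "expected_loss n t s \<le> (\<Sum>xs\<in>action_lists K n. weight_from l \<mu> n t s xs * n)"
    unfolding expected_loss_def
  proof (intro sum_mono mult_left_mono weight_nonneg)
    fix xs assume xs: "xs \<in> action_lists K n"
    have "(\<Sum>k<n. l (t + k) (xs ! k)) \<le> (\<Sum>k<n. 1)"
    proof (rule sum_mono)
      fix k assume "k \<in> {..<n}"
      then have "xs ! k \<in> {1..K}"
        using xs nth_mem[of k xs] by (auto simp: action_lists_def simp del: nth_mem)
      then show "l (t + k) (xs ! k) \<le> 1" using l[of "xs ! k" "t + k"] by simp
    qed
    then show "(\<Sum>k<n. l (t + k) (xs ! k)) \<le> n" by simp
  qed
  also have "\<dots> = (\<Sum>xs\<in>action_lists K n. weight_from l \<mu> n t s xs) * n"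
    by (simp add: sum_distrib_right)
  also have "\<dots> = n"
    using weight_from_sum[OF assms, of t n \<mu> K l] \<mu> by simp
  finally show ?thesis .
qed

text \<open>The Bellman equation. Splitting off the loss of the first round uses that the weights of
  the remaining rounds sum to 1.\<close>

lemma expected_loss_Suc:
  assumes "valid_state s"
  shows "expected_loss (Suc n) t s = (\<Sum>j=1..N. pmf (batch_arm B s) j * arm_loss n t s j)"
proof -
  let ?w = "\<lambda>j x xs z. weight_from l \<mu> n (Suc t) (batch_update \<tau> s j (l t x) z) xs"
  let ?n = "batch_noise \<tau> \<epsilon> s"
  let ?f = "\<lambda>xs. \<Sum>k<n. l (Suc t + k) (xs ! k)"
  have split: "(\<Sum>k<Suc n. l (t + k) ((x # xs) ! k)) = l t x + ?f xs" for x xs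
    by (subst sum.lessThan_Suc_shift) simp
  have inner: "(\<Sum>xs\<in>action_lists K n. (\<integral>z. ?w j x xs z \<partial>?n) * (l t x + ?f xs)) =
      l t x + (\<integral>z. expected_loss n (Suc t) (batch_update \<tau> s j (l t x) z) \<partial>?n)"
    if j: "j \<in> {1..N}" for j x
  proof -
    have "(\<Sum>xs\<in>action_lists K n. (\<integral>z. ?w j x xs z \<partial>?n) * (l t x + ?f xs)) =
      (\<integral>z. (\<Sum>xs\<in>action_lists K n. ?w j x xs z * (l t x + ?f xs)) \<partial>?n)"
      by (subst Bochner_Integration.integral_sum) (auto intro!: integrable_mult_left integrable_weight)
    also have "\<dots> = (\<integral>z. l t x + expected_loss n (Suc t) (batch_update \<tau> s j (l t x) z) \<partial>?n)"
    proof (rule Bochner_Integration.integral_cong[OF refl])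
      fix z
      have "(\<Sum>xs\<in>action_lists K n. ?w j x xs z) = 1"
        using assms j \<mu> by (intro weight_from_sum valid_state_update) auto
      then show "(\<Sum>xs\<in>action_lists K n. ?w j x xs z * (l t x + ?f xs)) =
          l t x + expected_loss n (Suc t) (batch_update \<tau> s j (l t x) z)"
        by (simp add: expected_loss_def distrib_left sum.distrib sum_distrib_right[symmetric])
    qed
    also have "\<dots> = l t x + (\<integral>z. expected_loss n (Suc t) (batch_update \<tau> s j (l t x) z) \<partial>?n)"
      by (subst Bochner_Integration.integral_add)
        (auto intro!: integrable_expected_loss integrable_batch_noise_bounded[of _ "\<bar>l t x\<bar>"])
    finally show ?thesis .
  qed
  have "expected_loss (Suc n) t s = (\<Sum>x=1..K. \<Sum>xs\<in>action_lists K n. \<Sum>j=1..N.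
      pmf (batch_arm B s) j * (pmf (\<mu> t j) x * ((\<integral>z. ?w j x xs z \<partial>?n) * (l t x + ?f xs))))"
    unfolding expected_loss_def sum_action_lists_Suc weight_from_Cons split
    by (simp add: sum_distrib_right mult.assoc)
  also have "\<dots> = (\<Sum>x=1..K. \<Sum>j=1..N. pmf (batch_arm B s) j * (pmf (\<mu> t j) x *
      (\<Sum>xs\<in>action_lists K n. (\<integral>z. ?w j x xs z \<partial>?n) * (l t x + ?f xs))))"
    by (subst sum.swap) (simp add: sum_distrib_left)
  also have "\<dots> = (\<Sum>x=1..K. \<Sum>j=1..N. pmf (batch_arm B s) j * (pmf (\<mu> t j) x *
      (l t x + (\<integral>z. expected_loss n (Suc t) (batch_update \<tau> s j (l t x) z) \<partial>?n))))"
    by (intro sum.cong refl) (simp only: inner)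
  also have "\<dots> = (\<Sum>j=1..N. pmf (batch_arm B s) j * arm_loss n t s j)"
    unfolding arm_loss_def by (subst sum.swap) (simp add: sum_distrib_left)
  finally show ?thesis .
qed

lemma mean_loss_nonneg: "mean_loss t j \<ge> 0"
  unfolding mean_loss_def using l by (intro sum_nonneg mult_nonneg_nonneg) auto

lemma sum_affine_mean:
  assumes "j \<in> {1..N}"
  shows "(\<Sum>i=1..K. pmf (\<mu> t j) i * (a + b * l t i)) = a + b * mean_loss t j"
proof -
  have "(\<Sum>i=1..K. pmf (\<mu> t j) i * (a + b * l t i)) = a * (\<Sum>i=1..K. pmf (\<mu> t j) i) + b * mean_loss t j"
    unfolding mean_loss_def by (simp add: distrib_left sum.distrib sum_distrib_left mult_ac)
  then show ?thesis using sum_pmf_distributions_on[OF \<mu>[OF assms]] by simp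
qed

text \<open>The continuation after the batch is bounded by an affine function of the noiseless
  average. Affine bounds are preserved when the action of each round is averaged out, so realized
  losses turn into \<open>mean_loss\<close> one round at a time, whatever the sign of
  \<open>D\<close>. Here \<open>k\<close> counts the rounds of the batch that follow round
  \<open>t\<close>.\<close>

lemma arm_loss_batch_le:
  assumes A: "\<And>a. a \<in> {0..1} \<Longrightarrow>
      (\<integral>z. expected_loss n t' (g @ [(j, a + z)], []) \<partial>laplace (1 / (real \<tau> * \<epsilon>))) \<le> A + D * a"
    and j: "j \<in> {1..N}"
  shows "length cur + Suc k = \<tau> \<Longrightarrow> Suc (t + k) = t' \<Longrightarrow> (cur \<noteq> [] \<longrightarrow> fst (hd cur) = j) \<Longrightarrow>
    snd ` set cur \<subseteq> {0..1} \<Longrightarrow> arm_loss (k + n) t (g, cur) j \<le>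
    A + D * ((sum_list (map snd cur) + (\<Sum>s=t..<t'. mean_loss s j)) / real \<tau>) + (\<Sum>s=t..<t'. mean_loss s j)"
proof (induction k arbitrary: t cur)
  case 0
  have sum01: "sum_list (map snd cur) \<in> {0..real (length cur)}"
    using 0(4) by (induction cur) auto
  have "arm_loss (0 + n) t (g, cur) j \<le> (\<Sum>i=1..K. pmf (\<mu> t j) i *
      (A + D * (sum_list (map snd cur) / real \<tau>) + (D / real \<tau> + 1) * l t i))"
    unfolding arm_loss_def
  proof (intro sum_mono mult_left_mono pmf_nonneg)
    fix i assume i: "i \<in> {1..K}"
    define a where "a = (sum_list (map snd cur) + l t i) / real \<tau>"
    have "a \<in> {0..1}"
      using sum01 l[OF i, of t] \<tau> 0(1) unfolding a_def by (auto simp: field_simps)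
    from A[OF this] have "(\<integral>z. expected_loss n (Suc t) (batch_update \<tau> (g, cur) j (l t i) z) \<partial>batch_noise \<tau> \<epsilon> (g, cur)) \<le> A + D * a"
      using 0(1,2) by (simp add: batch_noise.simps batch_update_complete a_def)
    then show "l t i + (\<integral>z. expected_loss (0 + n) (Suc t) (batch_update \<tau> (g, cur) j (l t i) z) \<partial>batch_noise \<tau> \<epsilon> (g, cur))
        \<le> A + D * (sum_list (map snd cur) / real \<tau>) + (D / real \<tau> + 1) * l t i"
      by (simp add: a_def add_divide_distrib algebra_simps)
  qed
  also have "\<dots> = A + D * (sum_list (map snd cur) / real \<tau>) + (D / real \<tau> + 1) * mean_loss t j"
    by (rule sum_affine_mean[OF j])
  finally show ?case
    using 0(2) by (auto simp: add_divide_distrib algebra_simps)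
next
  case (Suc k)
  define S where "S = sum_list (map snd cur)"
  define M where "M = (\<Sum>s=Suc t..<t'. mean_loss s j)"
  have M: "(\<Sum>s=t..<t'. mean_loss s j) = mean_loss t j + M"
    using Suc.prems(2) unfolding M_def by (subst sum.atLeast_Suc_lessThan) auto
  have "arm_loss (Suc k + n) t (g, cur) j \<le> (\<Sum>i=1..K. pmf (\<mu> t j) i *
      (A + D * ((S + M) / real \<tau>) + M + (D / real \<tau> + 1) * l t i))"
    unfolding arm_loss_def
  proof (intro sum_mono mult_left_mono pmf_nonneg)
    fix i assume i: "i \<in> {1..K}"
    define cur' where "cur' = cur @ [(j, l t i)]"
    \<comment> \<open>The batch has begun, so the arm is deterministic and the Bellman equation
      collapses to the single arm \<open>j\<close>.\<close>
    have arm: "batch_arm B (g, cur') = return_pmf j"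
      using Suc.prems(3) by (cases cur) (auto simp: cur'_def batch_arm.simps)
    have "(\<integral>z. expected_loss (Suc k + n) (Suc t) (batch_update \<tau> (g, cur) j (l t i) z) \<partial>batch_noise \<tau> \<epsilon> (g, cur))
        = expected_loss (Suc (k + n)) (Suc t) (g, cur')"
      using Suc.prems(1) by (simp add: batch_update_incomplete integral_batch_noise_incomplete cur'_def)
    also have "\<dots> = (\<Sum>j'=1..N. pmf (return_pmf j) j' * arm_loss (k + n) (Suc t) (g, cur') j')"
      using j by (subst expected_loss_Suc) (auto simp: valid_state_def arm)
    also have "\<dots> = (\<Sum>j'=1..N. if j' = j then arm_loss (k + n) (Suc t) (g, cur') j else 0)"
      by (intro sum.cong) (auto simp: indicator_def)
    also have "\<dots> = arm_loss (k + n) (Suc t) (g, cur') j"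
      using j by simp
    also have "\<dots> \<le> A + D * ((S + l t i + M) / real \<tau>) + M"
    proof -
      have "length cur' + Suc k = \<tau>" "Suc (Suc t + k) = t'" "sum_list (map snd cur') = S + l t i"
        using Suc.prems(1,2) by (simp_all add: cur'_def S_def)
      moreover have "cur' \<noteq> [] \<longrightarrow> fst (hd cur') = j"
        using Suc.prems(3) by (cases cur) (auto simp: cur'_def)
      moreover have "snd ` set cur' \<subseteq> {0..1}"
        using Suc.prems(4) l[OF i, of t] by (auto simp: cur'_def)
      ultimately show ?thesis
        using Suc.IH[of cur' "Suc t"] by (simp only: M_def)
    qed
    finally show "l t i + (\<integral>z. expected_loss (Suc k + n) (Suc t) (batch_update \<tau> (g, cur) j (l t i) z) \<partial>batch_noise \<tau> \<epsilon> (g, cur))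
        \<le> A + D * ((S + M) / real \<tau>) + M + (D / real \<tau> + 1) * l t i"
      by (simp add: add_divide_distrib algebra_simps)
  qed
  also have "\<dots> = A + D * ((S + M) / real \<tau>) + M + (D / real \<tau> + 1) * mean_loss t j"
    by (rule sum_affine_mean[OF j])
  finally show ?case
    unfolding M S_def by (simp add: add_divide_distrib algebra_simps)
qed

end

section \<open>One noisy batch: moments and potential\<close>

text \<open>\<open>f\<close> has the shape of the one-step bound: a constant, the truncated
  comparator term, the learner's own loss and an error quadratic in the observation. The truncated
  mean is bounded only from above, hence \<open>c\<^sub>1 \<ge> 0\<close>; the 3 bounds
  \<open>a\<^sup>2 + 2 * b\<^sup>2\<close>.\<close>

lemma laplace_quadratic_bound:
  fixes a b c\<^sub>0 c\<^sub>1 c\<^sub>2 d r :: real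
  assumes b: "b > 0" "b \<le> 1" and a: "a \<in> {0..1}" and c: "c\<^sub>1 \<ge> 0" "c\<^sub>2 \<ge> 0"
  defines "f \<equiv> \<lambda>v::real. c\<^sub>0 + c\<^sub>1 * (if \<bar>v\<bar> \<le> r then v else 0) - d * v + c\<^sub>2 * v\<^sup>2"
  shows "integrable (laplace b) (\<lambda>z. f (a + z))"
    and "(\<integral>z. f (a + z) \<partial>laplace b) \<le> c\<^sub>0 + c\<^sub>1 * a - d * a + 3 * c\<^sub>2"
proof -
  interpret prob_space "laplace b" by (rule prob_space_laplace[OF b(1)])
  note int = laplace_first_moment(1)[OF b(1)] integrable_laplace_truncated[OF b(1)]
    laplace_shifted_second_moment(1)[OF b(1)]
  have int': "integrable (laplace b) (\<lambda>z. a + z)" using int(1) by simp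
  show "integrable (laplace b) (\<lambda>z. f (a + z))"
    unfolding f_def by (intro Bochner_Integration.integrable_add Bochner_Integration.integrable_diff
      integrable_mult_right int int' integrable_const)
  have "(\<integral>z. f (a + z) \<partial>laplace b) = c\<^sub>0 + c\<^sub>1 * (\<integral>z. (if \<bar>a + z\<bar> \<le> r then a + z else 0) \<partial>laplace b)
      - d * (\<integral>z. a + z \<partial>laplace b) + c\<^sub>2 * (\<integral>z. (a + z)\<^sup>2 \<partial>laplace b)"
    unfolding f_def using int int' measure_laplace_UNIV[OF b(1)] by simp
  also have "(\<integral>z. a + z \<partial>laplace b) = a"
    using int(1) laplace_first_moment(2)[OF b(1)] measure_laplace_UNIV[OF b(1)] by simp
  also have "(\<integral>z. (a + z)\<^sup>2 \<partial>laplace b) = a\<^sup>2 + 2 * b\<^sup>2"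
    by (rule laplace_shifted_second_moment(2)[OF b(1)])
  also have "c\<^sub>0 + c\<^sub>1 * (\<integral>z. (if \<bar>a + z\<bar> \<le> r then a + z else 0) \<partial>laplace b) - d * a + c\<^sub>2 * (a\<^sup>2 + 2 * b\<^sup>2)
      \<le> c\<^sub>0 + c\<^sub>1 * a - d * a + c\<^sub>2 * 3"
  proof -
    have "a\<^sup>2 \<le> 1" "b\<^sup>2 \<le> 1" using a b by (auto intro!: power_le_one)
    then have "c\<^sub>2 * (a\<^sup>2 + 2 * b\<^sup>2) \<le> c\<^sub>2 * 3" using c by (intro mult_left_mono) auto
    moreover have "c\<^sub>1 * (\<integral>z. (if \<bar>a + z\<bar> \<le> r then a + z else 0) \<partial>laplace b) \<le> c\<^sub>1 * a"
      using a c laplace_truncated_mean_le[OF b(1), of a r] by (intro mult_left_mono) auto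
    ultimately show ?thesis by linarith
  qed
  finally show "(\<integral>z. f (a + z) \<partial>laplace b) \<le> c\<^sub>0 + c\<^sub>1 * a - d * a + 3 * c\<^sub>2" by simp
qed

text \<open>
  One step of the regularized leader. The estimate of the comparator \<open>u\<close> keeps its truncated
  loss, whose mean is controlled by \<open>laplace_truncated_mean_le\<close>; for the played arm the truncation
  error is at most \<open>v\<^sup>2\<close> divided by the threshold.
\<close>

lemma htinf_potential_step:
  fixes v :: real and L :: "nat \<Rightarrow> real"
  assumes N: "N \<ge> 1" and \<sigma>: "\<sigma> > 0" and p: "p \<ge> 1" and j: "j \<in> {1..N}"
  defines "x \<equiv> htinf_distribution N \<sigma> p L" and "b \<equiv> \<sigma> * sqrt p"
  defines "L' \<equiv> \<lambda>i. L i + htinf_estimate \<sigma> p x j v i"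
  shows "L' u - htinf_value N \<sigma> (Suc p) L' \<le> L u - htinf_value N \<sigma> p L
      + 2 * sqrt N * (\<sigma> * sqrt (Suc p) - b)
      + of_bool (j = u) / pmf x j * (if \<bar>v\<bar> \<le> skip_factor * b * sqrt (pmf x j) then v else 0) - v
      + (1 / skip_factor + 2) / (b * sqrt (pmf x j)) * v\<^sup>2"
proof -
  define s where "s = sqrt (pmf x j)"
  define r where "r = skip_factor * b * s"
  define w where "w = (if \<bar>v\<bar> \<le> r then v else 0)"
  define d where "d = w / pmf x j"
  have b: "b > 0" using \<sigma> p by (simp add: b_def)
  have q: "pmf x j > 0" unfolding x_def by (rule htinf_distribution_pos[OF N \<sigma> p j])
  then have s: "s > 0" "pmf x j = s\<^sup>2" by (simp_all add: s_def)
  have r: "r > 0" unfolding r_def using skip_factor_pos b s(1) by simp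
  have L': "L' = (\<lambda>i. L i + (if i = j then d else 0))"
    unfolding L'_def htinf_estimate_eq by (auto simp: d_def w_def r_def b_def s_def mult.assoc)
  have w_le: "\<bar>w\<bar> \<le> r" using r by (simp add: w_def)
  have "\<bar>d\<bar> * s = \<bar>w\<bar> / s"
    using s by (simp add: d_def abs_divide power2_eq_square)
  also have "\<dots> \<le> r / s" using w_le s by (intro divide_right_mono) auto
  also have "\<dots> = skip_factor * b" using s by (simp add: r_def)
  also have "\<dots> \<le> 1 / 2 * b" using b skip_factor_le by (intro mult_right_mono) auto
  finally have "\<bar>d\<bar> * s \<le> \<sigma> * sqrt p / 2" by (simp add: b_def)
  then have shift: "htinf_value N \<sigma> p L' \<ge> htinf_value N \<sigma> p L + d * pmf x j - 2 * d\<^sup>2 * pmf x j * s / b"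
    unfolding L' x_def s_def b_def by (intro htinf_value_shift_ge N \<sigma> p j)
  have dw: "d * pmf x j = w" using q by (simp add: d_def)
  have "d\<^sup>2 * pmf x j * s = w\<^sup>2 / s"
    unfolding d_def s(2) using s(1) by (simp add: field_simps power2_eq_square)
  also have "\<dots> \<le> v\<^sup>2 / s" using s by (intro divide_right_mono) (auto simp: w_def)
  finally have "2 * (d\<^sup>2 * pmf x j * s) / b \<le> 2 * (v\<^sup>2 / s) / b"
    using b by (intro divide_right_mono) auto
  then have stab: "2 * d\<^sup>2 * pmf x j * s / b \<le> 2 / (b * s) * v\<^sup>2"
    by (simp add: mult.assoc) (simp add: mult.commute)
  have "v - w \<le> v\<^sup>2 / r"
  proof (cases "\<bar>v\<bar> \<le> r")
    case True
    then show ?thesis using r by (simp add: w_def)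
  next
    case False
    have "v * r \<le> \<bar>v\<bar> * r" using r by (intro mult_right_mono) auto
    also have "\<dots> \<le> \<bar>v\<bar> * \<bar>v\<bar>" using False by (intro mult_left_mono) auto
    finally show ?thesis using r False by (simp add: w_def field_simps power2_eq_square)
  qed
  also have "v\<^sup>2 / r = 1 / skip_factor / (b * s) * v\<^sup>2"
    by (simp add: r_def mult.assoc)
  finally have trunc: "- w \<le> - v + 1 / skip_factor / (b * s) * v\<^sup>2" by simp
  have suc: "htinf_value N \<sigma> (Suc p) L' \<ge> htinf_value N \<sigma> p L' - 2 * sqrt N * (\<sigma> * sqrt (Suc p) - b)"
    unfolding b_def by (rule htinf_value_Suc_ge[OF N \<sigma> p])
  have L'u: "L' u = L u + of_bool (j = u) / pmf x j * w"
    by (auto simp: L' d_def)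
  have coef: "(1 / skip_factor + 2) / (b * s) * v\<^sup>2 = 1 / skip_factor / (b * s) * v\<^sup>2 + 2 / (b * s) * v\<^sup>2"
    by (simp only: add_divide_distrib distrib_right)
  show ?thesis
    unfolding s_def[symmetric] r_def[symmetric] w_def[symmetric] coef
    using suc shift stab trunc dw L'u by linarith
qed

section \<open>Induction over the batches\<close>

locale htinf_batches = bounded_losses +
  fixes \<sigma> :: real and u :: nat
  assumes B_eq: "B = htinf N \<sigma>" and \<sigma>: "\<sigma> > 0" and \<tau>\<epsilon>: "real \<tau> * \<epsilon> \<ge> 1" and u: "u \<in> {1..N}"
begin

text \<open>Regret still to be paid, per round of a batch, when \<open>R\<close> batches remain from
  batch \<open>p\<close> on: the gap between comparator and minimal value, the telescoped
  learning-rate changes, and the error of each batch. In the latter, 3 bounds the second moment,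
  \<open>1 / skip_factor\<close> comes from skipping and 2 from stability.\<close>

definition potential :: "nat \<Rightarrow> nat \<Rightarrow> (nat \<Rightarrow> real) \<Rightarrow> real" where
  "potential R p L = L u - htinf_value N \<sigma> p L + 2 * sqrt N * (\<sigma> * sqrt (p + R) - \<sigma> * sqrt p)
     + 3 * (1 / skip_factor + 2) * sqrt N * (\<Sum>r=p..<p + R. 1 / (\<sigma> * sqrt (real r)))"

abbreviation "cumulative_loss g \<equiv> htinf_loss N \<sigma> 1 (\<lambda>_. 0) g"

lemma N: "N \<ge> 1" using u by simp

lemma bandit_eq: "B g = htinf_distribution N \<sigma> (Suc (length g)) (cumulative_loss g)"
  by (simp add: B_eq htinf_def htinf_from_eq)

text \<open>Induction on the number of remaining batches for every history \<open>g\<close>, because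
  the noise makes the next history random. The \<open>m\<close> leftover rounds cost at most 1
  each.\<close>

lemma expected_loss_batches_le:
  "expected_loss (R * \<tau> + m) t (g, []) \<le>
     (\<Sum>s=t..<t + (R * \<tau> + m). mean_loss s u) + m + real \<tau> * potential R (Suc (length g)) (cumulative_loss g)"
proof (induction R arbitrary: t g)
  case 0
  have "0 \<le> real \<tau> * potential 0 (Suc (length g)) (cumulative_loss g)"
    unfolding potential_def using htinf_value_le_arm[OF N \<sigma> _ u] by simp
  moreover have "0 \<le> (\<Sum>s=t..<t + m. mean_loss s u)"
    by (intro sum_nonneg mean_loss_nonneg)
  ultimately show ?case
    using expected_loss_le[of "(g, [])" m t] by simp
next
  case (Suc R)
  define n p L x b where "n = R * \<tau> + m" and "p = Suc (length g)" and "L = cumulative_loss g"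
    and "x = htinf_distribution N \<sigma> p L" and "b = \<sigma> * sqrt p"
  define t' where "t' = t + \<tau>"
  let ?c = "1 / skip_factor + 2"
  have p: "p \<ge> 1" by (simp add: p_def)
  have b: "b > 0" using \<sigma> p by (simp add: b_def)
  have c: "?c \<ge> 0" using skip_factor_pos by simp
  have x: "x \<in> distributions_on N" unfolding x_def by (rule htinf_distribution_in[OF N \<sigma> p])
  have x_pos: "pmf x j > 0" if "j \<in> {1..N}" for j
    unfolding x_def by (rule htinf_distribution_pos[OF N \<sigma> p that])
  have arm: "batch_arm B (g, []) = x"
    by (simp add: batch_arm.simps bandit_eq x_def p_def L_def)
  define S where "S = (\<Sum>r=Suc p..<Suc p + R. 1 / (\<sigma> * sqrt (real r)))"
  define E where "E = (\<Sum>s=t'..<t' + n. mean_loss s u) + m + real \<tau> * (2 * sqrt N * (\<sigma> * sqrt (Suc p + R) - \<sigma> * sqrt (Suc p))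
     + 3 * ?c * sqrt N * S)"
  define F where "F = E + real \<tau> * (L u - htinf_value N \<sigma> p L + 2 * sqrt N * (\<sigma> * sqrt (Suc p) - b))"
  let ?A = "\<lambda>j. F + real \<tau> * (3 * (?c / (b * sqrt (pmf x j))))"
  \<comment> \<open>After weighting with \<open>pmf x j\<close>, the part \<open>- 1\<close> cancels
    the learner's own batch loss \<open>?M j\<close>, and the indicator part leaves the comparator's
    loss \<open>?M u\<close>.\<close>
  let ?D = "\<lambda>j. real \<tau> * (of_bool (j = u) / pmf x j - 1)"
  let ?M = "\<lambda>j. \<Sum>s=t..<t'. mean_loss s j"
  have noise: "(\<integral>z. expected_loss n t' (g @ [(j, a + z)], []) \<partial>laplace (1 / (real \<tau> * \<epsilon>))) \<le> ?A j + ?D j * a"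
    if j: "j \<in> {1..N}" and a: "a \<in> {0..1}" for j a
  proof -
    let ?lap = "laplace (1 / (real \<tau> * \<epsilon>))"
    define f where "f v = F + real \<tau> * (of_bool (j = u) / pmf x j) *
        (if \<bar>v\<bar> \<le> skip_factor * b * sqrt (pmf x j) then v else 0) - real \<tau> * v
        + real \<tau> * (?c / (b * sqrt (pmf x j))) * v\<^sup>2" for v
    have le: "expected_loss n t' (g @ [(j, v)], []) \<le> f v" for v
    proof -
      define L' where "L' = (\<lambda>i. L i + htinf_estimate \<sigma> p x j v i)"
      have L': "cumulative_loss (g @ [(j, v)]) = L'"
        unfolding htinf_loss_snoc L'_def x_def L_def p_def by simp
      have "expected_loss n t' (g @ [(j, v)], []) \<le> (\<Sum>s=t'..<t' + n. mean_loss s u) + m + real \<tau> * potential R (Suc p) L'"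
        using Suc.IH[of t' "g @ [(j, v)]"] unfolding L' n_def p_def by simp
      also have "\<dots> = E + real \<tau> * (L' u - htinf_value N \<sigma> (Suc p) L')"
        unfolding E_def potential_def S_def[symmetric] by (simp add: algebra_simps)
      also have "\<dots> \<le> E + real \<tau> * (L u - htinf_value N \<sigma> p L
          + 2 * sqrt N * (\<sigma> * sqrt (Suc p) - b)
          + of_bool (j = u) / pmf x j * (if \<bar>v\<bar> \<le> skip_factor * b * sqrt (pmf x j) then v else 0) - v
          + ?c / (b * sqrt (pmf x j)) * v\<^sup>2)"
        unfolding L'_def x_def b_def
        by (intro add_left_mono mult_left_mono htinf_potential_step N \<sigma> p j) simp
      also have "\<dots> = f v"
        unfolding f_def F_def by (simp only: distrib_left right_diff_distrib mult.assoc add.assoc add_diff_eq)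
      finally show ?thesis .
    qed
    have scale: "1 / (real \<tau> * \<epsilon>) \<le> 1" using \<tau>\<epsilon> by simp
    have coef: "0 \<le> real \<tau> * (of_bool (j = u) / pmf x j)" "0 \<le> real \<tau> * (?c / (b * sqrt (pmf x j)))"
      using b c by (auto intro!: mult_nonneg_nonneg divide_nonneg_nonneg)
    note bound = laplace_quadratic_bound[OF noise_scale_pos scale a coef,
        of F "skip_factor * b * sqrt (pmf x j)" "real \<tau>", folded f_def]
    \<comment> \<open>An artificial batch of constant losses \<open>a\<close>: completing it feeds
      exactly \<open>a + z\<close>, so integrability follows from the general lemma about batch
      updates.\<close>
    define cur where "cur = replicate (\<tau> - 1) (j, a)"
    have "integrable (batch_noise \<tau> \<epsilon> (g, cur)) (\<lambda>z. expected_loss n t' (batch_update \<tau> (g, cur) j a z))"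
      by (rule integrable_expected_loss)
    moreover have "Suc (length cur) = \<tau>" "(sum_list (map snd cur) + a) / real \<tau> = a"
      using \<tau> by (simp_all add: cur_def sum_list_replicate of_nat_diff field_simps)
    ultimately have "integrable ?lap (\<lambda>z. expected_loss n t' (g @ [(j, a + z)], []))"
      by (simp add: batch_noise.simps batch_update_complete)
    then have "(\<integral>z. expected_loss n t' (g @ [(j, a + z)], []) \<partial>?lap) \<le> (\<integral>z. f (a + z) \<partial>?lap)"
      using bound(1) le by (intro integral_mono) auto
    also note bound(2)
    finally show ?thesis by (simp add: algebra_simps)
  qed
  have "expected_loss (Suc R * \<tau> + m) t (g, []) = expected_loss (Suc (\<tau> - 1 + n)) t (g, [])"
    using \<tau> by (simp add: n_def algebra_simps)
  also have "\<dots> = (\<Sum>j=1..N. pmf x j * arm_loss (\<tau> - 1 + n) t (g, []) j)"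
    by (subst expected_loss_Suc) (simp_all add: arm)
  also have "\<dots> \<le> (\<Sum>j=1..N. pmf x j * (?A j + ?D j * (?M j / real \<tau>) + ?M j))"
  proof (intro sum_mono mult_left_mono pmf_nonneg)
    fix j assume j: "j \<in> {1..N}"
    show "arm_loss (\<tau> - 1 + n) t (g, []) j \<le> ?A j + ?D j * (?M j / real \<tau>) + ?M j"
      using arm_loss_batch_le[OF noise[OF j] j, of "[]" "\<tau> - 1" t] \<tau> by (simp add: t'_def)
  qed
  \<comment> \<open>The weight \<open>pmf x j\<close> turns the error coefficient
    \<open>1 / sqrt (pmf x j)\<close> into \<open>sqrt (pmf x j)\<close>, which stays bounded in
    sum.\<close>
  also have "\<dots> = (\<Sum>j=1..N. pmf x j * F + 3 * ?c * real \<tau> / b * sqrt (pmf x j) + (if j = u then ?M j else 0))"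
  proof (rule sum.cong[OF refl])
    fix j assume j: "j \<in> {1..N}"
    define s where "s = sqrt (pmf x j)"
    have s: "s > 0" "pmf x j = s\<^sup>2" using x_pos[OF j] by (simp_all add: s_def)
    show "pmf x j * (?A j + ?D j * (?M j / real \<tau>) + ?M j) =
        pmf x j * F + 3 * ?c * real \<tau> / b * sqrt (pmf x j) + (if j = u then ?M j else 0)"
      unfolding s_def[symmetric] unfolding s(2) using s(1) b \<tau>
      by (cases "j = u") (simp_all add: field_simps power2_eq_square)
  qed
  also have "\<dots> = F + 3 * ?c * real \<tau> / b * (\<Sum>j=1..N. sqrt (pmf x j)) + ?M u"
    using u sum_pmf_distributions_on[OF x]
    by (simp only: sum.distrib sum_distrib_right[symmetric] sum_distrib_left[symmetric]) simp
  also have "\<dots> \<le> F + 3 * ?c * real \<tau> / b * sqrt N + ?M u"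
    using b c by (intro add_left_mono add_right_mono mult_left_mono sum_sqrt_pmf_le x) auto
  also have "\<dots> = (\<Sum>s=t..<t + (Suc R * \<tau> + m). mean_loss s u) + m + real \<tau> * potential (Suc R) p L"
  proof -
    have M: "(\<Sum>s=t..<t + (Suc R * \<tau> + m). mean_loss s u) = ?M u + (\<Sum>s=t'..<t' + n. mean_loss s u)"
      by (subst sum.atLeastLessThan_concat) (auto simp: t'_def n_def algebra_simps)
    have S: "(\<Sum>r=p..<p + Suc R. 1 / (\<sigma> * sqrt (real r))) = 1 / b + S"
      unfolding S_def by (subst sum.atLeast_Suc_lessThan) (simp_all add: b_def)
    have "p + Suc R = Suc p + R" by simp
    then show ?thesis
      unfolding M F_def E_def potential_def S b_def[symmetric] by (simp add: algebra_simps add_divide_distrib)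
  qed
  finally show ?case by (simp add: p_def L_def)
qed

end

section \<open>Summation and the final bound\<close>

lemma sum_inverse_sqrt_le: "(\<Sum>r=1..<1 + R. 1 / sqrt (real r)) \<le> 2 * sqrt R"
proof (induction R)
  case (Suc R)
  have "1 = (sqrt (Suc R) - sqrt R) * (sqrt (Suc R) + sqrt R)"
    by (simp add: algebra_simps)
  also have "\<dots> \<le> (sqrt (Suc R) - sqrt R) * (2 * sqrt (Suc R))"
    by (intro mult_left_mono) auto
  finally have "1 / sqrt (Suc R) \<le> 2 * (sqrt (Suc R) - sqrt R)"
    by (subst pos_divide_le_eq) (simp, simp only: mult_ac)
  with Suc show ?case by simp
qed simp

text \<open>The leading 2 pays for the incomplete batch, \<open>sqrt 2\<close> stems from
  \<open>\<tau> \<le> 2 / \<epsilon>\<close>, and the bracket is the initial potential divided by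
  \<open>sqrt N * sqrt R\<close>.\<close>

definition regret_constant :: "real \<Rightarrow> real" where
  "regret_constant \<sigma> = 2 + sqrt 2 * (2 * \<sigma> * sqrt 2 + 6 * (1 / skip_factor + 2) / \<sigma>)"

context htinf_batches
begin

lemma potential_initial_le:
  assumes "R \<ge> 1"
  shows "potential R 1 (\<lambda>_. 0) \<le> sqrt N * sqrt R * (2 * \<sigma> * sqrt 2 + 6 * (1 / skip_factor + 2) / \<sigma>)"
proof -
  let ?c = "1 / skip_factor + 2"
  have c: "?c \<ge> 0" using skip_factor_pos by simp
  define S where "S = (\<Sum>r=1..<1 + R. 1 / (\<sigma> * sqrt (real r)))"
  have "S = (\<Sum>r=1..<1 + R. 1 / sqrt (real r)) / \<sigma>"
    unfolding S_def sum_divide_distrib by (intro sum.cong) (auto simp: mult.commute)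
  also have "\<dots> \<le> 2 * sqrt R / \<sigma>"
    using \<sigma> sum_inverse_sqrt_le[of R] by (intro divide_right_mono) auto
  finally have "3 * ?c * sqrt N * S \<le> 3 * ?c * sqrt N * (2 * sqrt R / \<sigma>)"
    using c by (intro mult_left_mono) auto
  moreover have "2 * sqrt N * (\<sigma> * sqrt (1 + R)) \<le> 2 * sqrt N * (\<sigma> * (sqrt 2 * sqrt R))"
    using assms \<sigma> unfolding real_sqrt_mult[symmetric] by (intro mult_left_mono) auto
  moreover have "- 2 * \<sigma> * sqrt N \<le> htinf_value N \<sigma> 1 (\<lambda>_. 0)"
    using htinf_value_zero_ge[OF N \<sigma>, of 1] by simp
  moreover have "potential R 1 (\<lambda>_. 0) = - htinf_value N \<sigma> 1 (\<lambda>_. 0)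
      + (2 * sqrt N * (\<sigma> * sqrt (1 + R)) - 2 * sqrt N * \<sigma>) + 3 * ?c * sqrt N * S"
    unfolding potential_def S_def[symmetric] by (simp add: right_diff_distrib)
  ultimately have "potential R 1 (\<lambda>_. 0) \<le> 2 * \<sigma> * sqrt N + (2 * sqrt N * (\<sigma> * (sqrt 2 * sqrt R)) - 2 * sqrt N * \<sigma>)
      + 3 * ?c * sqrt N * (2 * sqrt R / \<sigma>)"
    by linarith
  also have "\<dots> = sqrt N * sqrt R * (2 * \<sigma> * sqrt 2 + 6 * ?c / \<sigma>)"
    by (simp add: algebra_simps add_divide_distrib)
  finally show ?thesis .
qed

lemma expected_loss_le_mean_loss:
  assumes T: "\<tau> \<le> T" and \<tau>_le: "real \<tau> \<le> 2 / \<epsilon>"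
  shows "expected_loss T 1 ([], []) - (\<Sum>s=1..T. mean_loss s u) \<le>
    regret_constant \<sigma> * (sqrt (real T * real N) / sqrt \<epsilon> + 1 / \<epsilon>)"
proof -
  define R where "R = T div \<tau>"
  define k where "k = 2 * \<sigma> * sqrt 2 + 6 * (1 / skip_factor + 2) / \<sigma>"
  have k: "k \<ge> 0" using \<sigma> skip_factor_pos by (simp add: k_def)
  have R: "R \<ge> 1" using T \<tau> by (simp add: R_def div_greater_zero_iff Suc_le_eq)
  have "real (\<tau> * R) \<le> real T"
    unfolding R_def of_nat_le_iff by simp
  \<comment> \<open>One factor \<open>\<tau>\<close> is spent on \<open>\<tau> * R \<le> T\<close>,
    the other on \<open>2 / \<epsilon>\<close>; the square root gives the rate.\<close>
  then have "real \<tau> * (real \<tau> * real R) \<le> (2 / \<epsilon>) * real T"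
    using \<tau>_le \<epsilon> by (intro mult_mono) auto
  then have "sqrt (real \<tau> * real \<tau> * real R) \<le> sqrt (2 / \<epsilon> * real T)"
    by (simp add: mult.assoc)
  then have \<tau>R: "real \<tau> * sqrt R \<le> sqrt 2 * (sqrt T / sqrt \<epsilon>)"
    by (simp add: real_sqrt_mult real_sqrt_divide)
  have "expected_loss T 1 ([], []) \<le> (\<Sum>s=1..<1 + T. mean_loss s u) + real (T mod \<tau>) + real \<tau> * potential R 1 (\<lambda>_. 0)"
    using expected_loss_batches_le[of R "T mod \<tau>" 1 "[]"] by (simp add: R_def)
  also have "real (T mod \<tau>) \<le> 2 / \<epsilon>"
    using \<tau> \<tau>_le mod_less_divisor[of \<tau> T] by linarith
  also have "real \<tau> * potential R 1 (\<lambda>_. 0) \<le> real \<tau> * (sqrt N * sqrt R * k)"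
    unfolding k_def by (intro mult_left_mono potential_initial_le R) auto
  also have "\<dots> = (real \<tau> * sqrt R) * (sqrt N * k)" by simp
  also have "\<dots> \<le> (sqrt 2 * (sqrt T / sqrt \<epsilon>)) * (sqrt N * k)"
    using k \<tau>R by (intro mult_right_mono) auto
  also have "\<dots> = sqrt 2 * k * (sqrt (real T * real N) / sqrt \<epsilon>)"
    by (simp add: real_sqrt_mult)
  finally have "expected_loss T 1 ([], []) - (\<Sum>s=1..T. mean_loss s u) \<le>
      2 * (1 / \<epsilon>) + sqrt 2 * k * (sqrt (real T * real N) / sqrt \<epsilon>)"
    by (simp add: atLeastLessThanSuc_atLeastAtMost)
  also have "\<dots> \<le> (2 + sqrt 2 * k) * (1 / \<epsilon>) + (2 + sqrt 2 * k) * (sqrt (real T * real N) / sqrt \<epsilon>)"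
    using k \<epsilon> by (intro add_mono mult_right_mono) auto
  finally show ?thesis
    unfolding regret_constant_def k_def[symmetric] by (simp add: algebra_simps)
qed

end

lemma (in batched_bandit) expectation_play_conditional_algorithm:
  assumes "\<And>r. r \<in> {1..T} \<Longrightarrow> \<mu> r \<in> advice_tuples K N"
  shows "measure_pmf.expectation (play (conditional_algorithm K) \<mu> l T) f =
    (\<Sum>xs\<in>action_lists K T. weight_from l \<mu> T 1 ([], []) xs * f xs)"
proof -
  have pmf: "pmf (play (conditional_algorithm K) \<mu> l T) xs =
      (if xs \<in> action_lists K T then weight_from l \<mu> T 1 ([], []) xs else 0)" for xs
    by (intro pmf_play_conditional_algorithm assms)
  have "measure_pmf.expectation (play (conditional_algorithm K) \<mu> l T) f =
      (\<Sum>xs\<in>action_lists K T. f xs * pmf (play (conditional_algorithm K) \<mu> l T) xs)"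
    by (intro integral_measure_pmf_real) (auto simp: set_pmf_eq pmf split: if_splits)
  also have "\<dots> = (\<Sum>xs\<in>action_lists K T. weight_from l \<mu> T 1 ([], []) xs * f xs)"
    by (intro sum.cong refl) (simp add: pmf del: upt_Suc)
  finally show ?thesis .
qed

lemma worst_case_regret_htinf_le:
  assumes "K \<ge> 1" "N \<ge> 1" "\<sigma> > 0" "\<epsilon> > 0" "\<tau> \<ge> 1" "real \<tau> * \<epsilon> \<ge> 1" "\<tau> \<le> T" "real \<tau> \<le> 2 / \<epsilon>"
  shows "worst_case_regret (batched_bandit.conditional_algorithm N \<tau> \<epsilon> (htinf N \<sigma>) K) T K N \<le>
    ereal (regret_constant \<sigma> * (sqrt (real T * real N) / sqrt \<epsilon> + 1 / \<epsilon>))"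
  unfolding worst_case_regret_def
proof (intro SUP_least, unfold ereal_less_eq)
  fix l \<mu> assume losses: "l \<in> {1..T} \<rightarrow>\<^sub>E ({1..K} \<rightarrow>\<^sub>E {0..(1::real)})"
    and advice: "\<mu> \<in> {1..T} \<rightarrow>\<^sub>E advice_tuples K N"
  interpret batched_bandit N \<tau> \<epsilon> "htinf N \<sigma>"
    using assms by unfold_locales (auto intro!: measurable_bandit_htinf)
  let ?bound = "regret_constant \<sigma> * (sqrt (real T * real N) / sqrt \<epsilon> + 1 / \<epsilon>)"
  \<comment> \<open>Both sequences are extended beyond \<open>{1..T}\<close> by harmless values; on
    the rounds that are played they agree with the given ones, so weights and losses do not
    change.\<close>
  define l' where "l' r = (if r \<in> {1..T} then l r else (\<lambda>_. 0))" for r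
  define \<mu>' where "\<mu>' r = (if r \<in> {1..T} then \<mu> r else (\<lambda>_. return_pmf 1))" for r
  have bounded: "bounded_losses N \<tau> \<epsilon> (htinf N \<sigma>) K \<mu>' l'"
  proof unfold_locales
    show "\<mu>' r j \<in> distributions_on K" if "j \<in> {1..N}" for r j
    proof (cases "r \<in> {1..T}")
      case True
      then have "\<mu> r \<in> advice_tuples K N" by (rule PiE_mem[OF advice])
      then show ?thesis using True that by (auto simp: \<mu>'_def advice_tuples_def)
    next
      case False
      then show ?thesis unfolding \<mu>'_def if_not_P[OF False] using assms(1) by (simp add: distributions_on_def)
    qed
    show "l' r i \<in> {0..1}" if "i \<in> {1..K}" for r i
      using PiE_mem[OF PiE_mem[OF losses] that, of r] by (simp add: l'_def)
  qed
  interpret bounded_losses N \<tau> \<epsilon> "htinf N \<sigma>" K \<mu>' l' by (rule bounded)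
  have expectation: "measure_pmf.expectation (play (conditional_algorithm K) \<mu> l T)
      (\<lambda>xs. \<Sum>t=1..T. l t (xs ! (t - 1))) = expected_loss T 1 ([], [])"
  proof -
    have "measure_pmf.expectation (play (conditional_algorithm K) \<mu> l T) (\<lambda>xs. \<Sum>t=1..T. l t (xs ! (t - 1))) =
        (\<Sum>xs\<in>action_lists K T. weight_from l \<mu> T 1 ([], []) xs * (\<Sum>t=1..T. l t (xs ! (t - 1))))"
      using advice by (intro expectation_play_conditional_algorithm) auto
    also have "\<dots> = expected_loss T 1 ([], [])"
      unfolding expected_loss_def
    proof (rule sum.cong[OF refl], rule arg_cong2[of _ _ _ _ "(*)"])
      fix xs assume xs: "xs \<in> action_lists K T"
      have "history_from l 1 xs = history_from l' 1 xs"
        using xs by (intro history_from_cong) (auto simp: l'_def action_lists_def)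
      moreover have "map \<mu> [1..<1 + T] = map \<mu>' [1..<1 + T]"
        by (auto simp: \<mu>'_def simp del: upt_Suc)
      ultimately show "weight_from l \<mu> T 1 ([], []) xs = weight_from l' \<mu>' T 1 ([], []) xs"
        by (simp only:)
      have "(\<Sum>t=1..T. l t (xs ! (t - 1))) = (\<Sum>k<T. l (1 + k) (xs ! k))"
        by (rule sum.reindex_bij_witness[of _ "\<lambda>k. 1 + k" "\<lambda>t. t - 1"]) auto
      then show "(\<Sum>t=1..T. l t (xs ! (t - 1))) = (\<Sum>k<T. l' (1 + k) (xs ! k))"
        by (simp add: l'_def)
    qed
    finally show ?thesis .
  qed
  have "expected_loss T 1 ([], []) - ?bound \<le> (INF j\<in>{1..N}. \<Sum>t=1..T. \<Sum>i=1..K. pmf (\<mu> t j) i * l t i)"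
  proof (rule cINF_greatest)
    show "{1..N} \<noteq> {}" using assms by simp
    fix u assume u: "u \<in> {1..N}"
    \<comment> \<open>The algorithm is the same for every comparator; only the potential depends on
      \<open>u\<close>, so the analysis is instantiated once per expert.\<close>
    interpret htinf_batches N \<tau> \<epsilon> "htinf N \<sigma>" K \<mu>' l' \<sigma> u
      using assms u by unfold_locales auto
    have "(\<Sum>t=1..T. mean_loss t u) = (\<Sum>t=1..T. \<Sum>i=1..K. pmf (\<mu> t u) i * l t i)"
      unfolding mean_loss_def by (intro sum.cong refl) (auto simp: l'_def \<mu>'_def)
    then show "expected_loss T 1 ([], []) - ?bound \<le> (\<Sum>t=1..T. \<Sum>i=1..K. pmf (\<mu> t u) i * l t i)"
      using expected_loss_le_mean_loss[OF assms(7,8)] by linarith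
  qed
  then show "regret (conditional_algorithm K) T K N l \<mu> \<le> ?bound"
    unfolding regret_def expectation by linarith
qed

theorem corollary8:
  shows "\<exists>C::real. C > 0 \<and>
    (\<forall>(T::nat) (K::nat) (N::nat) (\<epsilon>::real).
       T \<ge> 1 \<and> K \<ge> 1 \<and> N \<ge> 1 \<and> 1 / real T \<le> \<epsilon> \<and> \<epsilon> \<le> 1 \<longrightarrow>
       (\<exists>A. is_expert_algorithm K N A \<and>
            conditional_law_of K N (conversion N \<epsilon> (htinf N (sqrt 6))) A \<and>
            differentially_private \<epsilon> K N A \<and>
            worst_case_regret A T K N \<le> ereal (C * (sqrt (real T * real N) / sqrt \<epsilon> + 1 / \<epsilon>))))"
proof (intro exI[of _ "regret_constant (sqrt 6)"] conjI allI impI)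
  show "regret_constant (sqrt 6) > 0"
    unfolding regret_constant_def using skip_factor_pos by (intro add_pos_nonneg) auto
next
  fix T K N :: nat and \<epsilon> :: real
  assume *: "T \<ge> 1 \<and> K \<ge> 1 \<and> N \<ge> 1 \<and> 1 / real T \<le> \<epsilon> \<and> \<epsilon> \<le> 1"
  define \<tau> where "\<tau> = nat \<lceil>1 / \<epsilon>\<rceil>"
  have "0 < 1 / real T" using * by simp
  then have \<epsilon>: "\<epsilon> > 0" using * by linarith
  have inv: "1 \<le> 1 / \<epsilon>" "1 / \<epsilon> \<le> real T"
    using * \<epsilon> by (auto simp: field_simps)
  have \<tau>_ge: "1 / \<epsilon> \<le> real \<tau>" unfolding \<tau>_def by linarith
  have "real \<tau> < 1 / \<epsilon> + 1" unfolding \<tau>_def using inv by linarith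
  then have \<tau>_le: "real \<tau> \<le> 2 / \<epsilon>" using inv by (simp add: field_simps)
  \<comment> \<open>The lower bound on \<open>\<epsilon>\<close> guarantees at least one complete
    batch within the horizon.\<close>
  have "\<lceil>1 / \<epsilon>\<rceil> \<le> int T" using inv by (simp add: ceiling_le_iff)
  then have \<tau>_le_T: "\<tau> \<le> T" unfolding \<tau>_def by linarith
  have \<tau>: "\<tau> \<ge> 1" using \<tau>_ge inv by linarith
  have \<tau>\<epsilon>: "real \<tau> * \<epsilon> \<ge> 1" using \<tau>_ge \<epsilon> by (simp add: field_simps)
  interpret batched_bandit N \<tau> \<epsilon> "htinf N (sqrt 6)"
    using * \<epsilon> \<tau> by unfold_locales (auto intro!: measurable_bandit_htinf)
  show "\<exists>A. is_expert_algorithm K N A \<and>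
      conditional_law_of K N (conversion N \<epsilon> (htinf N (sqrt 6))) A \<and>
      differentially_private \<epsilon> K N A \<and>
      worst_case_regret A T K N \<le> ereal (regret_constant (sqrt 6) * (sqrt (real T * real N) / sqrt \<epsilon> + 1 / \<epsilon>))"
  proof (intro exI[of _ "conditional_algorithm K"] conjI)
    show "is_expert_algorithm K N (conditional_algorithm K)"
      using * by (intro is_expert_algorithm_conditional) auto
    have "conversion N \<epsilon> (htinf N (sqrt 6)) =
        (\<lambda>\<mu> l T. conversion_from N \<tau> \<epsilon> (htinf N (sqrt 6)) \<mu> l T 1 ([], []))"
      by (simp add: fun_eq_iff conversion_def \<tau>_def)
    then show "conditional_law_of K N (conversion N \<epsilon> (htinf N (sqrt 6))) (conditional_algorithm K)"
      using conditional_law_of_conditional_algorithm by simp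
    show "differentially_private \<epsilon> K N (conditional_algorithm K)"
      by (rule differentially_private_conditional_algorithm)
    show "worst_case_regret (conditional_algorithm K) T K N \<le>
        ereal (regret_constant (sqrt 6) * (sqrt (real T * real N) / sqrt \<epsilon> + 1 / \<epsilon>))"
      using * \<epsilon> \<tau> \<tau>\<epsilon> \<tau>_le \<tau>_le_T by (intro worst_case_regret_htinf_le) auto
  qed
qed

end
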